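(* For every vexillary signed permutation $w$ there is a strict partition $\lambda(w)$ such that $G^C_w=GQ^{(\beta)}_{\lambda(w)}$.
   Context: **Signed permutations.** $W_n$ is the group of bijections $w$ of $\{-n,\dots,-1,1,\dots,n\}$ with $w(-i)=-w(i)$, written in one-line notation $w(1)\cdots w(n)$ with $\bar a=-a$; Coxeter generators $s_0=(-1\ 1)$, $s_i=(-i{-}1\ \,{-}i)(i\ \,i{+}1)$ for $1\le i\le n-1$; $\ell(w)$ is Coxeter length. $w\in W_n$ contains $v\in W_m$ as a pattern if there is a length-$m$ subsequence $w'$ of $w(1)\cdots w(n)$ such that for all $i,j\in[m]$, $w'(i)$ and $v(i)$ have the same sign, and $|w'(i)|<|w'(j)|$ iff $|v(i)|<|v(j)|$. $w$ is vexillary if it contains none of the 18 patterns $\bar132,\ \bar231,\ 3\bar12,\ 321,\ \bar321,\ 32\bar1,\ \bar32\bar1,\ 2143,\ 2\bar34\bar1,\ \bar2\bar34\bar1,\ 2413,\ 3142,\ 3\bar41\bar2,\ \bar3\bar41\bar2,\ 3\bar4\bar1\bar2,\ \bar3\bar4\bar1\bar2,\ \bar41\bar23,\ \bar4\bar1\bar23.$ **$G^C_w$.** Let $u_0,\dots,u_{n-1}$ be noncommuting variables (commuting with $\beta$ and $x_1,x_2,\dots$) with $u_i^2=\beta u_i$, $u_1u_0u_1u_0=u_0u_1u_0u_1$, $u_iu_{i+1}u_i=u_{i+1}u_iu_{i+1}$ ($i>0$), $u_iu_j=u_ju_i$ ($|i-j|>1$). For $w\in W_n$ with reduced word $(a_1,\dots,a_\ell)$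 put $u_w=u_{a_1}\cdots u_{a_\ell}$. $G^C_w$ (the type C $K$-Stanley symmetric function) is the coefficient of $u_w$ in $$\prod_{i\ge1}(1+x_iu_{n-1})\cdots(1+x_iu_1)(1+x_iu_0)(1+x_iu_0)(1+x_iu_1)\cdots(1+x_iu_{n-1}),$$ the product taken in order $i=1,2,\dots$ from left to right. **$GQ$.** A strict partition is $\lambda=(\lambda_1>\dots>\lambda_k>0)$, with shifted diagram $D_\lambda=\{(i,j):1\le i\le k,\ i\le j\le\lambda_i+i-1\}$. Order $\mathbb{Z}\setminus\{0\}$ by $\bar1\prec1\prec\bar2\prec2\prec\cdots$. A shifted set-valued semistandard tableau of shape $\lambda$ is a filling $T$ of $D_\lambda$ by finite nonempty subsets of $\mathbb{Z}\setminus\{0\}$ with $\max T_{ij}\preceq\min T_{i+1,j}$, equality allowed only for negative values, and $\max T_{ij}\preceq\min T_{i,j+1}$, equality allowed only for positive values ($\max,\min$ with respect to $\prec$). With $|T|=\sum|T_{ij}|$ and $x^T=\prod_{(i,j)}\prod_{s\in T_{ij}}x_{|s|}$, set $GQ^{(\beta)}_\lambda=\sum_T\beta^{|T|-|\lambda|}x^T$. *)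

theory Defs
  imports
    "HOL-Library.Poly_Mapping"
    "HOL-Library.Sublist"
    "HOL-Combinatorics.Permutations"
    "HOL-Computational_Algebra.Polynomial"
begin

section \<open>Signed permutations\<close>

text \<open>
  The Coxeter group \<open>W\<^sub>n\<close>. Its elements are extended by the identity outside
  \<open>{-n..n} - {0}\<close>, so that they are determined by their one-line notation.
\<close>

definition signed_perms :: "nat \<Rightarrow> (int \<Rightarrow> int) set" where
  "signed_perms n = {w. w permutes ({- int n..int n} - {0}) \<and> (\<forall>i. w (- i) = - w i)}"

definition cox_gen :: "nat \<Rightarrow> int \<Rightarrow> int" where
  "cox_gen i =
     (if i = 0 then Transposition.transpose (- 1) 1
      else Transposition.transpose (- int i - 1) (- int i)
             \<circ> Transposition.transpose (int i) (int i + 1))"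

definition word_perm :: "nat list \<Rightarrow> int \<Rightarrow> int" where
  "word_perm a = foldr (\<lambda>i v. cox_gen i \<circ> v) a id"

definition cox_length :: "nat \<Rightarrow> (int \<Rightarrow> int) \<Rightarrow> nat" where
  "cox_length n w = (LEAST l. \<exists>a. set a \<subseteq> {..<n} \<and> word_perm a = w \<and> length a = l)"

definition is_reduced_word :: "nat \<Rightarrow> (int \<Rightarrow> int) \<Rightarrow> nat list \<Rightarrow> bool" where
  "is_reduced_word n w a \<longleftrightarrow>
     set a \<subseteq> {..<n} \<and> word_perm a = w \<and> length a = cox_length n w"

definition one_line :: "nat \<Rightarrow> (int \<Rightarrow> int) \<Rightarrow> int list" where
  "one_line n w = map (\<lambda>i. w (int i)) [1..<Suc n]"

text \<open>Both arguments are signed permutations in one-line notation, pattern second.\<close>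

definition contains_pattern :: "int list \<Rightarrow> int list \<Rightarrow> bool" where
  "contains_pattern w v \<longleftrightarrow>
     (\<exists>w'. subseq w' w \<and> length w' = length v \<and>
        (\<forall>i < length v. sgn (w' ! i) = sgn (v ! i)) \<and>
        (\<forall>i < length v. \<forall>j < length v.
            \<bar>w' ! i\<bar> < \<bar>w' ! j\<bar> \<longleftrightarrow> \<bar>v ! i\<bar> < \<bar>v ! j\<bar>))"

definition vexillary_patterns :: "int list set" where
  "vexillary_patterns =
     {[-1, 3, 2], [-2, 3, 1], [3, -1, 2], [3, 2, 1], [-3, 2, 1], [3, 2, -1], [-3, 2, -1],
      [2, 1, 4, 3], [2, -3, 4, -1], [-2, -3, 4, -1], [2, 4, 1, 3], [3, 1, 4, 2],
      [3, -4, 1, -2], [-3, -4, 1, -2], [3, -4, -1, -2], [-3, -4, -1, -2],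
      [-4, 1, -2, 3], [-4, -1, -2, 3]}"

definition vexillary :: "nat \<Rightarrow> (int \<Rightarrow> int) \<Rightarrow> bool" where
  "vexillary n w \<longleftrightarrow> (\<forall>v \<in> vexillary_patterns. \<not> contains_pattern (one_line n w) v)"


section \<open>Power series in \<open>x\<^sub>1, x\<^sub>2, \<dots>\<close> over \<open>\<int>[\<beta>]\<close>\<close>

text \<open>
  A monomial is its exponent vector. The type also has a variable \<open>x\<^sub>0\<close>, which occurs in none
  of the series below.
\<close>

type_synonym monomial = "nat \<Rightarrow>\<^sub>0 nat"
type_synonym power_series = "monomial \<Rightarrow> int poly"

abbreviation beta :: "int poly" where
  "beta \<equiv> [:0, 1:]"


section \<open>The algebra generated by \<open>u\<^sub>0, \<dots>, u\<^sub>n\<^sub>-\<^sub>1\<close>\<close>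

text \<open>
  Finitely supported functions on the free monoid, with convolution product, form the free
  associative algebra \<open>\<int>[\<beta>]\<langle>u\<^sub>0, u\<^sub>1, \<dots>\<rangle>\<close>. The monoid is written additively because
  this is what the product on \<^typ>\<open>'a \<Rightarrow>\<^sub>0 'b\<close> expects.
\<close>

datatype u_word = Word (letters: "nat list")

instantiation u_word :: monoid_add
begin

definition zero_u_word :: u_word where
  "0 = Word []"

definition plus_u_word :: "u_word \<Rightarrow> u_word \<Rightarrow> u_word" where
  "v + w = Word (letters v @ letters w)"

instance
  by standard (simp_all add: zero_u_word_def plus_u_word_def)

end

type_synonym free_alg = "u_word \<Rightarrow>\<^sub>0 int poly"

definition scalar :: "int poly \<Rightarrow> free_alg" where
  "scalar c = Poly_Mapping.single 0 c"

definition u_gen :: "nat \<Rightarrow> free_alg" where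
  "u_gen i = Poly_Mapping.single (Word [i]) 1"

definition free_alg_on :: "nat \<Rightarrow> free_alg set" where
  "free_alg_on n = {f. \<forall>a \<in> Poly_Mapping.keys f. set (letters a) \<subseteq> {..<n}}"

definition relators :: "nat \<Rightarrow> free_alg set" where
  "relators n =
     {u_gen i * u_gen i - scalar beta * u_gen i | i. i < n} \<union>
     (if 1 < n
      then {u_gen 1 * u_gen 0 * u_gen 1 * u_gen 0 - u_gen 0 * u_gen 1 * u_gen 0 * u_gen 1}
      else {}) \<union>
     {u_gen i * u_gen (i + 1) * u_gen i - u_gen (i + 1) * u_gen i * u_gen (i + 1)
        | i. 0 < i \<and> i + 1 < n} \<union>
     {u_gen i * u_gen j - u_gen j * u_gen i | i j. i < n \<and> j < n \<and> \<bar>int i - int j\<bar> > 1}"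

text \<open>The two-sided ideal of \<^term>\<open>free_alg_on n\<close> generated by \<^term>\<open>relators n\<close>.\<close>

inductive_set relation_ideal :: "nat \<Rightarrow> free_alg set" for n :: nat where
  zero: "0 \<in> relation_ideal n"
| add: "f \<in> relation_ideal n \<Longrightarrow> g \<in> relation_ideal n \<Longrightarrow> f + g \<in> relation_ideal n"
| mult: "r \<in> relators n \<Longrightarrow> f \<in> free_alg_on n \<Longrightarrow> g \<in> free_alg_on n \<Longrightarrow>
           f * r * g \<in> relation_ideal n"

definition u_perm :: "nat \<Rightarrow> (int \<Rightarrow> int) \<Rightarrow> free_alg" where
  "u_perm n w = prod_list (map u_gen (SOME a. is_reduced_word n w a))"

text \<open>
  The coefficient of \<open>u\<^sub>w\<close> in the class of \<open>h\<close> modulo the relations, that is, in the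
  expansion of this class in the basis \<open>(u\<^sub>v)\<close> indexed by \<open>v \<in> W\<^sub>n\<close>.
\<close>

definition u_coeff :: "nat \<Rightarrow> free_alg \<Rightarrow> (int \<Rightarrow> int) \<Rightarrow> int poly" where
  "u_coeff n h =
     (THE c. (\<forall>v. v \<notin> signed_perms n \<longrightarrow> c v = 0) \<and>
        h - (\<Sum>v\<in>signed_perms n. scalar (c v) * u_perm n v) \<in> relation_ideal n)"


section \<open>Type C \<open>K\<close>-Stanley symmetric functions\<close>

text \<open>
  Polynomials in the central variables \<open>x\<^sub>i\<close> with coefficients in the free algebra.
\<close>

definition x_factor :: "nat \<Rightarrow> nat \<Rightarrow> monomial \<Rightarrow>\<^sub>0 free_alg" where
  "x_factor n i =
     prod_list (map (\<lambda>a. 1 + Poly_Mapping.single (Poly_Mapping.single i 1) (u_gen a))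
       (rev [0..<n] @ [0..<n]))"

definition partial_product :: "nat \<Rightarrow> nat \<Rightarrow> monomial \<Rightarrow>\<^sub>0 free_alg" where
  "partial_product n N = prod_list (map (x_factor n) [1..<Suc N])"

text \<open>
  The infinite product is the coefficientwise limit of its partial products; the coefficient of
  each monomial is eventually constant.
\<close>

definition product_coeff :: "nat \<Rightarrow> monomial \<Rightarrow> free_alg" where
  "product_coeff n m =
     (THE h. \<forall>\<^sub>F N in sequentially. Poly_Mapping.lookup (partial_product n N) m = h)"

definition GC :: "nat \<Rightarrow> (int \<Rightarrow> int) \<Rightarrow> power_series" where
  "GC n w = (\<lambda>m. u_coeff n (product_coeff n m) w)"


section \<open>The functions \<open>GQ\<close>\<close>

definition strict_partition :: "nat list \<Rightarrow> bool" where
  "strict_partition lam \<longleftrightarrow> sorted_wrt (>) lam \<and> (\<forall>p \<in> set lam. 0 < p)"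

text \<open>Rows and columns are numbered from 1, list positions from 0.\<close>

definition shifted_diagram :: "nat list \<Rightarrow> (nat \<times> nat) set" where
  "shifted_diagram lam =
     {(i, j). 1 \<le> i \<and> i \<le> length lam \<and> i \<le> j \<and> j \<le> lam ! (i - 1) + i - 1}"

text \<open>
  The order \<open>-1 \<prec> 1 \<prec> -2 \<prec> 2 \<prec> \<dots>\<close> on the nonzero integers is the usual order of ranks.
\<close>

definition prec_rank :: "int \<Rightarrow> int" where
  "prec_rank s = (if s < 0 then 2 * \<bar>s\<bar> - 1 else 2 * \<bar>s\<bar>)"

definition prec_max :: "int set \<Rightarrow> int" where
  "prec_max S = arg_max_on prec_rank S"

definition prec_min :: "int set \<Rightarrow> int" where
  "prec_min S = arg_min_on prec_rank S"

text \<open>Tableaux are extended by the empty set outside the diagram.\<close>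

definition set_valued_tableaux :: "nat list \<Rightarrow> (nat \<times> nat \<Rightarrow> int set) set" where
  "set_valued_tableaux lam =
     {T. (\<forall>b. b \<notin> shifted_diagram lam \<longrightarrow> T b = {}) \<and>
         (\<forall>b \<in> shifted_diagram lam. finite (T b) \<and> T b \<noteq> {} \<and> 0 \<notin> T b) \<and>
         (\<forall>i j. (i, j) \<in> shifted_diagram lam \<and> (i + 1, j) \<in> shifted_diagram lam \<longrightarrow>
            prec_rank (prec_max (T (i, j))) < prec_rank (prec_min (T (i + 1, j))) \<or>
            prec_max (T (i, j)) = prec_min (T (i + 1, j)) \<and> prec_max (T (i, j)) < 0) \<and>
         (\<forall>i j. (i, j) \<in> shifted_diagram lam \<and> (i, j + 1) \<in> shifted_diagram lam \<longrightarrow>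
            prec_rank (prec_max (T (i, j))) < prec_rank (prec_min (T (i, j + 1))) \<or>
            prec_max (T (i, j)) = prec_min (T (i, j + 1)) \<and> prec_max (T (i, j)) > 0)}"

definition tableau_size :: "nat list \<Rightarrow> (nat \<times> nat \<Rightarrow> int set) \<Rightarrow> nat" where
  "tableau_size lam T = (\<Sum>b\<in>shifted_diagram lam. card (T b))"

definition tableau_monomial :: "nat list \<Rightarrow> (nat \<times> nat \<Rightarrow> int set) \<Rightarrow> monomial" where
  "tableau_monomial lam T =
     (\<Sum>b\<in>shifted_diagram lam. \<Sum>s\<in>T b. Poly_Mapping.single (nat \<bar>s\<bar>) 1)"

text \<open>
  For every monomial the sum is finite: the entries of a contributing tableau are bounded by the
  largest index of a variable occurring in the monomial.
\<close>

definition GQ :: "nat list \<Rightarrow> power_series" where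
  "GQ lam =
     (\<lambda>m. \<Sum>T | T \<in> set_valued_tableaux lam \<and> tableau_monomial lam T = m.
        beta ^ (tableau_size lam T - sum_list lam))"

end

theory Submission
  imports Defs
begin

text \<open>
  The coefficients of the product are computed by letting the \<open>u\<^sub>i\<close> act on functions on the group.
  Write \<open>g = w\<^sup>-\<^sup>1\<close> and fix a position \<open>k > 0\<close>. A reflection operator moves the entry of \<open>g\<close> at
  position \<open>k\<close> to another position along a Bruhat covering. The operators \<open>1 + \<beta> \<cdot> reflection\<close>,
  multiplied over all positions to the right of \<open>k\<close>, intertwine the factors of the product with
  deformed factors, and so do those for all positions to the left, with deformed factors that agree
  up to a change of one equivariant parameter. Hence both products give the same value of the
  generating function: a transition equation.

  For vexillary \<open>w\<close>, at the last descent of \<open>g\<close>, only one reflection is possible on either side, so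
  the transition equation identifies \<open>G\<^sup>C\<close> of \<open>w\<close> with that of another vexillary element, for which
  the last descent comes earlier or is followed by fewer smaller entries. This ends with a \<open>g\<close> that
  is increasing on the positive integers. In that case \<open>w\<close> corresponds to the strict partition formed
  by the positions of its negative entries, \<open>u\<^sub>c\<close> adds a box of content \<open>c\<close>, and the factors of one
  variable \<open>x\<^sub>N\<close> insert the letter \<open>-N\<close> by decreasing content and then the letter \<open>N\<close> by
  increasing content.
\<close>

section \<open>Signed permutations\<close>

definition signed_perm :: "(int \<Rightarrow> int) \<Rightarrow> bool" where
  "signed_perm w \<longleftrightarrow> (\<exists>n. w \<in> signed_perms n)"

lemma signed_permI: "w \<in> signed_perms n \<Longrightarrow> signed_perm w"
  by (auto simp: signed_perm_def)

lemma signed_perms_iff: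
  "w \<in> signed_perms n \<longleftrightarrow> bij w \<and> (\<forall>x. w (- x) = - w x) \<and> (\<forall>x. int n < \<bar>x\<bar> \<longrightarrow> w x = x)"
proof
  assume w: "w \<in> signed_perms n"
  have "w x = x" if "int n < \<bar>x\<bar>" for x
    by (rule permutes_not_in[of w "{- int n..int n} - {0}"])
       (use w that in \<open>auto simp: signed_perms_def\<close>)
  moreover have "bij w" using w permutes_bij by (auto simp: signed_perms_def)
  ultimately show "bij w \<and> (\<forall>x. w (- x) = - w x) \<and> (\<forall>x. int n < \<bar>x\<bar> \<longrightarrow> w x = x)"
    using w by (auto simp: signed_perms_def)
next
  assume w: "bij w \<and> (\<forall>x. w (- x) = - w x) \<and> (\<forall>x. int n < \<bar>x\<bar> \<longrightarrow> w x = x)"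
  then have "w 0 = 0" by (metis add.inverse_neutral eq_neg_iff_add_eq_0 double_eq_0_iff)
  then have "w permutes ({- int n..int n} - {0})"
    unfolding permutes_def using w by (auto simp: bij_iff)
  then show "w \<in> signed_perms n" using w by (auto simp: signed_perms_def)
qed

lemma finite_signed_perms: "finite (signed_perms n)"
  by (rule finite_subset[OF _ finite_permutations[of "{- int n..int n} - {0}"]])
     (auto simp: signed_perms_def)

lemma signed_perms_mono: "n \<le> m \<Longrightarrow> w \<in> signed_perms n \<Longrightarrow> w \<in> signed_perms m"
  by (auto simp: signed_perms_iff)

lemma signed_perms_fixes: "w \<in> signed_perms n \<Longrightarrow> int n < \<bar>x\<bar> \<Longrightarrow> w x = x"
  by (simp add: signed_perms_iff)

lemma signed_perm_bij: "signed_perm w \<Longrightarrow> bij w"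
  by (auto simp: signed_perm_def signed_perms_iff)

lemma signed_perm_minus: "signed_perm w \<Longrightarrow> w (- x) = - w x"
  by (auto simp: signed_perm_def signed_perms_iff)

lemma signed_perm_0: "signed_perm w \<Longrightarrow> w 0 = 0"
  using signed_perm_minus[of w 0] by simp

lemma signed_perm_eq_iff: "signed_perm w \<Longrightarrow> w x = w y \<longleftrightarrow> x = y"
  using signed_perm_bij[of w] by (metis bij_def inj_eq)

lemma signed_perm_eq_minus_iff: "signed_perm w \<Longrightarrow> w x = - w y \<longleftrightarrow> x = - y"
  by (metis signed_perm_eq_iff signed_perm_minus)

lemma signed_perm_eq_0_iff: "signed_perm w \<Longrightarrow> w x = 0 \<longleftrightarrow> x = 0"
  by (metis signed_perm_eq_iff signed_perm_0)

lemma signed_perm_inv_eq_iff: "signed_perm w \<Longrightarrow> inv w y = x \<longleftrightarrow> w x = y"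
  by (metis bij_inv_eq_iff signed_perm_bij)

lemma signed_perm_inv_apply: "signed_perm w \<Longrightarrow> inv w (w x) = x"
  by (simp add: signed_perm_inv_eq_iff)

lemma signed_perm_apply_inv: "signed_perm w \<Longrightarrow> w (inv w x) = x"
  by (metis signed_perm_inv_eq_iff)

lemma signed_perm_inv_inv: "signed_perm w \<Longrightarrow> inv (inv w) = w"
  by (simp add: inv_inv_eq signed_perm_bij)

lemma signed_perm_inv_comp:
  "signed_perm v \<Longrightarrow> signed_perm w \<Longrightarrow> inv (v \<circ> w) = inv w \<circ> inv v"
  by (simp add: o_inv_distrib signed_perm_bij)

lemma signed_perms_id: "id \<in> signed_perms n"
  by (simp add: signed_perms_iff)

lemma signed_perms_comp:
  "v \<in> signed_perms n \<Longrightarrow> w \<in> signed_perms n \<Longrightarrow> v \<circ> w \<in> signed_perms n"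
  by (auto simp: signed_perms_iff bij_comp)

lemma signed_perms_inv: assumes "w \<in> signed_perms n" shows "inv w \<in> signed_perms n"
proof -
  note w = signed_permI[OF assms]
  show ?thesis
    using assms signed_perm_inv_eq_iff[OF w] signed_perm_apply_inv[OF w]
    by (auto simp: signed_perms_iff bij_imp_bij_inv)
qed

lemma signed_perm_id: "signed_perm id"
  using signed_perms_id by (rule signed_permI)

lemma signed_perm_comp:
  assumes "signed_perm v" "signed_perm w" shows "signed_perm (v \<circ> w)"
proof -
  obtain m n where "v \<in> signed_perms m" "w \<in> signed_perms n"
    using assms unfolding signed_perm_def by blast
  then have "v \<circ> w \<in> signed_perms (max m n)"
    by (intro signed_perms_comp) (auto intro: signed_perms_mono[rotated])
  then show ?thesis by (rule signed_permI)
qed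

lemma signed_perm_inv: "signed_perm w \<Longrightarrow> signed_perm (inv w)"
  using signed_perms_inv unfolding signed_perm_def by blast

lemma signed_perms_abs_le:
  assumes "w \<in> signed_perms n" "\<bar>x\<bar> \<le> int n" shows "\<bar>w x\<bar> \<le> int n"
proof (rule ccontr)
  assume n: "\<not> \<bar>w x\<bar> \<le> int n"
  then have "w (w x) = w x" using assms signed_perms_fixes by simp
  then have "w x = x" using signed_permI[OF assms(1)] by (simp add: signed_perm_eq_iff)
  then show False using assms n by simp
qed

lemma signed_perms_le_max:
  assumes "w \<in> signed_perms n" shows "w x \<le> max (int n) x" "min (- int n) x \<le> w x"
  using signed_perms_abs_le[OF assms, of x] signed_perms_fixes[OF assms, of x]
  by (cases "\<bar>x\<bar> \<le> int n"; auto)+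

subsection \<open>Reflections and Coxeter generators\<close>

definition signed_transpose :: "int \<Rightarrow> int \<Rightarrow> int \<Rightarrow> int" where
  "signed_transpose x y v =
     (if v = x then y else if v = y then x
      else if v = - x then - y else if v = - y then - x else v)"

lemma signed_transpose_values:
  "signed_transpose x y x = y" "signed_transpose x y y = x"
  "x \<noteq> 0 \<Longrightarrow> y \<noteq> 0 \<Longrightarrow> signed_transpose x y (- x) = - y"
  "x \<noteq> 0 \<Longrightarrow> y \<noteq> 0 \<Longrightarrow> signed_transpose x y (- y) = - x"
  "v \<noteq> x \<Longrightarrow> v \<noteq> y \<Longrightarrow> v \<noteq> - x \<Longrightarrow> v \<noteq> - y \<Longrightarrow> signed_transpose x y v = v"
  by (auto simp: signed_transpose_def)

lemma signed_transpose_involutory: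
  "x \<noteq> 0 \<Longrightarrow> y \<noteq> 0 \<Longrightarrow> signed_transpose x y \<circ> signed_transpose x y = id"
  by (rule ext) (auto simp: signed_transpose_def)

lemma signed_transpose_commute: "signed_transpose x y = signed_transpose y x"
  by (rule ext) (auto simp: signed_transpose_def)

lemma signed_transpose_uminus:
  "x \<noteq> 0 \<Longrightarrow> y \<noteq> 0 \<Longrightarrow> signed_transpose (- x) (- y) = signed_transpose x y"
  by (rule ext) (auto simp: signed_transpose_def)

lemma signed_transpose_eqD:
  assumes "signed_transpose a b = signed_transpose x y" "a \<noteq> b"
  shows "(a, b) \<in> {(x, y), (y, x), (- x, - y), (- y, - x)}"
proof -
  have "signed_transpose x y a = b" by (simp flip: assms(1) add: signed_transpose_values)
  then show ?thesis using assms(2) by (auto simp: signed_transpose_def split: if_splits)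
qed

lemma signed_perms_signed_transpose:
  assumes "x \<noteq> 0" "y \<noteq> 0" "\<bar>x\<bar> \<le> int n" "\<bar>y\<bar> \<le> int n"
  shows "signed_transpose x y \<in> signed_perms n"
proof -
  have "bij (signed_transpose x y)"
    by (rule o_bij) (use assms signed_transpose_involutory in auto)
  then show ?thesis using assms by (auto simp: signed_perms_iff signed_transpose_def)
qed

lemma signed_perm_signed_transpose:
  "x \<noteq> 0 \<Longrightarrow> y \<noteq> 0 \<Longrightarrow> signed_perm (signed_transpose x y)"
  by (rule signed_permI[of _ "nat (max \<bar>x\<bar> \<bar>y\<bar>)"], rule signed_perms_signed_transpose) auto

lemma inv_signed_transpose:
  "x \<noteq> 0 \<Longrightarrow> y \<noteq> 0 \<Longrightarrow> inv (signed_transpose x y) = signed_transpose x y"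
  by (rule inv_unique_comp) (simp_all add: signed_transpose_involutory)

lemma signed_perm_comp_signed_transpose:
  assumes "signed_perm w"
  shows "w \<circ> signed_transpose x y = signed_transpose (w x) (w y) \<circ> w"
  by (rule ext)
     (auto simp: signed_transpose_def signed_perm_eq_iff[OF assms] signed_perm_minus[OF assms]
       signed_perm_eq_minus_iff[OF assms])

text \<open>The generator \<open>s\<^sub>i\<close> exchanges the positions \<open>gen_left i < gen_right i\<close>, neighbours among the
  nonzero integers.\<close>

definition gen_left :: "nat \<Rightarrow> int" where "gen_left i = (if i = 0 then - 1 else int i)"
definition gen_right :: "nat \<Rightarrow> int" where "gen_right i = int i + 1"

lemma gen_left_less_gen_right: "gen_left i < gen_right i"
  by (simp add: gen_left_def gen_right_def)

lemma gen_left_nonzero [simp]: "gen_left i \<noteq> 0"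
  and gen_right_nonzero [simp]: "gen_right i \<noteq> 0"
  by (auto simp: gen_left_def gen_right_def)

lemma between_gen_left_gen_right:
  "gen_left i < v \<Longrightarrow> v < gen_right i \<Longrightarrow> v = 0 \<and> gen_right i = - gen_left i"
  by (auto simp: gen_left_def gen_right_def split: if_splits)

lemma cox_gen_eq: "cox_gen i = signed_transpose (gen_left i) (gen_right i)"
  by (rule ext)
     (auto simp: cox_gen_def signed_transpose_def gen_left_def gen_right_def transpose_def)

lemma cox_gen_apply:
  "cox_gen i v =
     (if v = gen_left i then gen_right i else if v = gen_right i then gen_left i
      else if v = - gen_left i then - gen_right i else if v = - gen_right i then - gen_left i
      else v)"
  by (simp add: cox_gen_eq signed_transpose_def)

lemma signed_perms_cox_gen: "i < n \<Longrightarrow> cox_gen i \<in> signed_perms n"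
  unfolding cox_gen_eq
  by (rule signed_perms_signed_transpose) (auto simp: gen_left_def gen_right_def)

lemma signed_perm_cox_gen: "signed_perm (cox_gen i)"
  by (simp add: cox_gen_eq signed_perm_signed_transpose)

lemma cox_gen_involutory: "cox_gen i \<circ> cox_gen i = id"
  by (simp add: cox_gen_eq signed_transpose_involutory)

lemma cox_gen_cox_gen: "cox_gen i (cox_gen i v) = v"
  using fun_cong[OF cox_gen_involutory[of i], of v] by simp

lemma comp_cox_gen_cox_gen: "w \<circ> cox_gen i \<circ> cox_gen i = w"
  by (simp add: comp_assoc cox_gen_involutory)

lemma cox_gen_gen_left: "cox_gen i (gen_left i) = gen_right i"
  and cox_gen_gen_right: "cox_gen i (gen_right i) = gen_left i"
  by (simp_all add: cox_gen_eq signed_transpose_values)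

lemma inv_cox_gen: "inv (cox_gen i) = cox_gen i"
  by (simp add: cox_gen_eq inv_signed_transpose)

lemma inv_comp_cox_gen: "signed_perm w \<Longrightarrow> inv (w \<circ> cox_gen i) = cox_gen i \<circ> inv w"
  by (simp add: signed_perm_inv_comp signed_perm_cox_gen inv_cox_gen)

lemma comp_cox_gen:
  "signed_perm w \<Longrightarrow> w \<circ> cox_gen i = signed_transpose (w (gen_left i)) (w (gen_right i)) \<circ> w"
  unfolding cox_gen_eq by (rule signed_perm_comp_signed_transpose)

lemma cox_gen_reverses:
  assumes "x \<noteq> 0" "y \<noteq> 0" "x < y" "\<not> cox_gen i x < cox_gen i y"
  shows "(x, y) = (gen_left i, gen_right i) \<or> (x, y) = (- gen_right i, - gen_left i)"
  using assms unfolding cox_gen_apply gen_left_def gen_right_def by (auto split: if_splits)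

lemma cox_gen_less_iff:
  assumes "x \<noteq> 0" "y \<noteq> 0" "signed_transpose x y \<noteq> cox_gen i"
  shows "cox_gen i x < cox_gen i y \<longleftrightarrow> x < y"
proof -
  have not_reversed: "cox_gen i a < cox_gen i b"
    if "a \<noteq> 0" "b \<noteq> 0" "a < b" "signed_transpose a b \<noteq> cox_gen i" for a b
    using cox_gen_reverses[OF that(1-3), of i] that(4)
      signed_transpose_uminus[of "gen_right i" "gen_left i"]
      signed_transpose_commute[of "gen_left i" "gen_right i"]
    by (auto simp: cox_gen_eq)
  consider "x < y" | "x = y" | "y < x" by linarith
  then show ?thesis
    using not_reversed[of x y] not_reversed[of y x] assms signed_transpose_commute[of x y]
    by cases auto
qed

abbreviation descent :: "(int \<Rightarrow> int) \<Rightarrow> nat \<Rightarrow> bool" where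
  "descent w i \<equiv> w (gen_right i) < w (gen_left i)"

lemma not_descent_iff: "signed_perm w \<Longrightarrow> \<not> descent w i \<longleftrightarrow> w (gen_left i) < w (gen_right i)"
  using gen_left_less_gen_right[of i] signed_perm_eq_iff[of w "gen_left i" "gen_right i"] by auto

lemma descent_comp_cox_gen: "signed_perm w \<Longrightarrow> descent (w \<circ> cox_gen i) i \<longleftrightarrow> \<not> descent w i"
  by (simp add: not_descent_iff cox_gen_gen_left cox_gen_gen_right)

section \<open>Inversions and Bruhat coverings\<close>

definition inversions :: "('a::linorder \<Rightarrow> 'b::linorder) \<Rightarrow> ('a \<times> 'a) set" where
  "inversions g = {(a, b). a < b \<and> g b < g a}"

definition between :: "('a::linorder \<Rightarrow> 'b::linorder) \<Rightarrow> 'a \<Rightarrow> 'a \<Rightarrow> 'a set" where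
  "between g x y = {j. x < j \<and> j < y \<and> g x < g j \<and> g j < g y}"

lemma inversions_comp_involution:
  fixes g :: "'a::linorder \<Rightarrow> 'b::linorder"
  assumes inj: "inj g" and t: "\<And>a. t (t a) = a"
    and fin: "finite (inversions g)" "finite (inversions t)"
  shows "card (inversions (g \<circ> t)) =
      card (inversions g - inversions t) + card (inversions t - inversions g)" (is ?card)
    and "finite (inversions (g \<circ> t))" (is ?finite)
proof -
  define sort_image where "sort_image p = (case p of (a, b) \<Rightarrow> (min (t a) (t b), max (t a) (t b)))" for p
  define D where "D = (inversions g - inversions t) \<union> (inversions t - inversions g)"
  have t_inj: "t a = t b \<longleftrightarrow> a = b" for a b using t by metis
  have sort_image_sort_image: "sort_image (sort_image p) = p" if "fst p < snd p" for p
    using that by (auto simp: sort_image_def min_def max_def t split: prod.splits)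
  have ordered: "fst p < snd p" if "p \<in> D" for p
    using that by (auto simp: D_def inversions_def)
  have image: "inversions (g \<circ> t) = sort_image ` D"
  proof (intro equalityI subsetI)
    fix p assume p: "p \<in> inversions (g \<circ> t)"
    obtain a b where ab: "p = (a, b)" by (cases p)
    have "sort_image p \<in> D"
      using p unfolding ab D_def sort_image_def inversions_def
      by (cases "t a < t b") (auto simp: min_def max_def t)
    moreover have "p = sort_image (sort_image p)"
      using p by (subst sort_image_sort_image) (auto simp: ab inversions_def)
    ultimately show "p \<in> sort_image ` D" by blast
  next
    fix p assume "p \<in> sort_image ` D"
    then obtain a b where ab: "(a, b) \<in> D" "p = sort_image (a, b)" by auto
    have "t a \<noteq> t b" "g a \<noteq> g b" using ordered[OF ab(1)] inj by (auto simp: t_inj dest: injD)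
    then show "p \<in> inversions (g \<circ> t)"
      using ab unfolding D_def sort_image_def inversions_def
      by (auto simp: min_def max_def not_less order_le_less t)
  qed
  show ?finite unfolding image D_def using fin by simp
  have "card (inversions (g \<circ> t)) = card D"
    unfolding image by (rule card_image, rule inj_onI) (metis ordered sort_image_sort_image)
  also have "\<dots> = card (inversions g - inversions t) + card (inversions t - inversions g)"
    unfolding D_def by (rule card_Un_disjoint) (use fin in auto)
  finally show ?card .
qed

lemma inversions_transpose:
  fixes x y :: "'a::linorder"
  assumes "x < y"
  shows "inversions (transpose x y) = {(a, b). a < b \<and> (a = x \<and> b \<le> y \<or> b = y \<and> x \<le> a)}"
  using assms unfolding inversions_def by (auto simp: transpose_def)

definition inner_below :: "('a::linorder \<Rightarrow> 'b::linorder) \<Rightarrow> 'a \<Rightarrow> 'a \<Rightarrow> 'a set" where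
  "inner_below g x y = {j. x < j \<and> j < y \<and> g j < g x}"

definition inner_above :: "('a::linorder \<Rightarrow> 'b::linorder) \<Rightarrow> 'a \<Rightarrow> 'a \<Rightarrow> 'a set" where
  "inner_above g x y = {j. x < j \<and> j < y \<and> g y < g j}"

lemmas inner_defs = inner_below_def inner_above_def between_def

lemma mem_inversions_transpose:
  "x < y \<Longrightarrow> (a, b) \<in> inversions (transpose x y) \<longleftrightarrow>
    a < b \<and> (a = x \<and> (b < y \<or> b = y) \<or> b = y \<and> (x < a \<or> x = a))"
  unfolding inversions_transpose le_less by simp

lemma inversions_Int_transpose:
  assumes xy: "x < y" "g x < g y"
  shows "inversions g \<inter> inversions (transpose x y) = {x} \<times> inner_below g x y \<union> inner_above g x y \<times> {y}"
proof (rule set_eqI, clarify)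
  fix a b
  show "(a, b) \<in> inversions g \<inter> inversions (transpose x y) \<longleftrightarrow>
      (a, b) \<in> {x} \<times> inner_below g x y \<union> inner_above g x y \<times> {y}"
    unfolding Int_iff mem_inversions_transpose[OF xy(1)]
    using xy by (auto simp: inversions_def inner_defs)
qed

lemma inversions_transpose_Diff:
  fixes g :: "'a::linorder \<Rightarrow> 'b::linorder"
  assumes inj: "inj g" and xy: "x < y" "g x < g y"
  shows "inversions (transpose x y) - inversions g = insert (x, y)
    ({x} \<times> (between g x y \<union> inner_above g x y) \<union> (between g x y \<union> inner_below g x y) \<times> {y})"
proof (rule set_eqI, clarify)
  fix a b
  have inner: "j \<in> inner_below g x y \<or> j \<in> inner_above g x y \<or> j \<in> between g x y" if "x < j" "j < y" for j
    using that inj by (auto simp: inner_defs not_less order_le_less dest: injD)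
  show "(a, b) \<in> inversions (transpose x y) - inversions g \<longleftrightarrow> (a, b) \<in> insert (x, y)
      ({x} \<times> (between g x y \<union> inner_above g x y) \<union> (between g x y \<union> inner_below g x y) \<times> {y})"
    unfolding Diff_iff mem_inversions_transpose[OF xy(1)] using xy inner[of a] inner[of b]
    by (auto simp: inversions_def inner_defs)
qed

lemma inversions_comp_transpose:
  fixes g :: "'a::linorder \<Rightarrow> 'b::linorder"
  assumes inj: "inj g" and fin: "finite (inversions g)" "finite {x<..<y}"
    and xy: "x < y" "g x < g y"
  shows "card (inversions (g \<circ> transpose x y)) = card (inversions g) + 1 + 2 * card (between g x y)"
      (is ?card)
    and "finite (inversions (g \<circ> transpose x y))"
proof -
  let ?I = "inversions (transpose x y)" and ?B = "between g x y"
    and ?low = "inner_below g x y" and ?high = "inner_above g x y"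
  note common = inversions_Int_transpose[of x y g, OF xy]
    and added = inversions_transpose_Diff[OF inj xy]
  have fin': "finite ?low" "finite ?high" "finite ?B"
    by (auto intro: finite_subset[OF _ fin(2)] simp: inner_defs)
  have disjoint: "?B \<inter> ?high = {}" "?B \<inter> ?low = {}" by (auto simp: inner_defs)
  have cards: "card (inversions g \<inter> ?I) = card ?low + card ?high"
    "card (?I - inversions g) = Suc (card ?B + card ?high + (card ?B + card ?low))"
    unfolding common added using fin' disjoint
    by (subst card_Un_disjoint card_insert_disjoint;
        auto simp: inner_defs card_cartesian_product_singleton card_cartesian_product
          card_Un_disjoint[OF fin'(3,2) disjoint(1)] card_Un_disjoint[OF fin'(3,1) disjoint(2)])+
  have "?I = (?I - inversions g) \<union> (inversions g \<inter> ?I)" by blast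
  moreover have "finite (?I - inversions g)" "finite (inversions g \<inter> ?I)"
    unfolding added using fin(1) fin' by auto
  ultimately have "finite ?I" by (metis finite_UnI)
  note comp = inversions_comp_involution[OF inj transpose_involutory fin(1) this]
  show "finite (inversions (g \<circ> transpose x y))" by (rule comp)
  have "card (inversions g) = card (inversions g - ?I) + card (inversions g \<inter> ?I)"
    using card_Int_Diff[OF fin(1), of ?I] by simp
  then show ?card unfolding comp(1) using cards by linarith
qed

lemma inversion_bounds:
  assumes "w \<in> signed_perms n" "(a, b) \<in> inversions w"
  shows "- int n \<le> a" "b \<le> int n"
proof -
  have ab: "a < b" "w b < w a" using assms(2) by (auto simp: inversions_def)
  show "- int n \<le> a"
  proof (rule ccontr)
    assume "\<not> - int n \<le> a"
    then show False using signed_perms_fixes[OF assms(1), of a] signed_perms_le_max(2)[OF assms(1), of b] ab by auto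
  qed
  show "b \<le> int n"
  proof (rule ccontr)
    assume "\<not> b \<le> int n"
    then show False using signed_perms_fixes[OF assms(1), of b] signed_perms_le_max(1)[OF assms(1), of a] ab by auto
  qed
qed

lemma finite_inversions: assumes "signed_perm w" shows "finite (inversions w)"
proof -
  obtain n where n: "w \<in> signed_perms n" using assms by (auto simp: signed_perm_def)
  have "inversions w \<subseteq> {- int n..int n} \<times> {- int n..int n}"
  proof
    fix p assume p: "p \<in> inversions w"
    obtain a b where ab: "p = (a, b)" by (cases p)
    have "a < b" using p ab by (simp add: inversions_def)
    then show "p \<in> {- int n..int n} \<times> {- int n..int n}"
      using inversion_bounds[OF n p[unfolded ab]] ab by simp
  qed
  then show ?thesis by (rule finite_subset) simp
qed

lemma card_inversions_inv:
  assumes "signed_perm w" shows "card (inversions (inv w)) = card (inversions w)"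
proof (rule bij_betw_same_card[of "\<lambda>(a, b). (inv w b, inv w a)"])
  show "bij_betw (\<lambda>(a, b). (inv w b, inv w a)) (inversions (inv w)) (inversions w)"
    by (rule bij_betw_byWitness[where f' = "\<lambda>(a, b). (w b, w a)"])
       (auto simp: inversions_def signed_perm_inv_apply[OF assms] signed_perm_apply_inv[OF assms])
qed

lemma descent_imp_less: assumes "w \<in> signed_perms n" "descent w i" shows "i < n"
  using inversion_bounds(2)[OF assms(1), of "gen_left i" "gen_right i"] gen_left_less_gen_right[of i] assms(2)
  by (simp add: inversions_def gen_right_def)

text \<open>The position \<open>0\<close> always lies between \<open>-y\<close> and \<open>y\<close>.\<close>

definition covering :: "(int \<Rightarrow> int) \<Rightarrow> int \<Rightarrow> int \<Rightarrow> bool" where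
  "covering g x y \<longleftrightarrow> x < y \<and> g x < g y \<and> between g x y \<subseteq> (if y = - x then {0} else {})"

definition min_increment :: "int \<Rightarrow> int \<Rightarrow> nat" where
  "min_increment x y = (if y = - x then 3 else 2)"

lemma card_inversions_sign_change:
  assumes g: "signed_perm g" and y: "0 < y" "0 < g y"
  shows "card (inversions g) + 3 \<le> card (inversions (g \<circ> signed_transpose (- y) y))"
    "card (inversions (g \<circ> signed_transpose (- y) y)) = card (inversions g) + 3 \<longleftrightarrow> covering g (- y) y"
proof -
  have less: "- y < y" "g (- y) < g y" using y by (simp_all add: signed_perm_minus[OF g])
  have t: "signed_transpose (- y) y = transpose (- y) y"
    by (rule ext) (auto simp: signed_transpose_def transpose_def)
  have mem: "0 \<in> between g (- y) y"
    using y less by (simp add: between_def signed_perm_0[OF g] signed_perm_minus[OF g])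
  have fin: "finite (between g (- y) y)"
    by (rule finite_subset[of _ "{- y<..<y}"]) (auto simp: between_def)
  define e where "e = card (between g (- y) y - {0})"
  have "card (between g (- y) y) = Suc e"
    unfolding e_def by (rule card.remove[OF fin mem])
  moreover have "e = 0 \<longleftrightarrow> between g (- y) y \<subseteq> {0}" using fin by (auto simp: e_def)
  moreover have "card (inversions (g \<circ> transpose (- y) y))
      = card (inversions g) + 1 + 2 * card (between g (- y) y)"
    by (rule inversions_comp_transpose(1)[OF bij_is_inj[OF signed_perm_bij[OF g]]
          finite_inversions[OF g] _ less]) simp
  ultimately show "card (inversions g) + 3 \<le> card (inversions (g \<circ> signed_transpose (- y) y))"
    "card (inversions (g \<circ> signed_transpose (- y) y)) = card (inversions g) + 3 \<longleftrightarrow> covering g (- y) y"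
    using less unfolding t covering_def by simp_all
qed

lemma card_inversions_two_transpositions:
  assumes g: "signed_perm g" and xy: "x < y" "g x < g y" "x \<noteq> 0" "y \<noteq> 0" "y \<noteq> - x"
  shows "card (inversions g) + 2 \<le> card (inversions (g \<circ> signed_transpose x y))"
    "card (inversions (g \<circ> signed_transpose x y)) = card (inversions g) + 2 \<longleftrightarrow> covering g x y"
proof -
  let ?g = "g \<circ> transpose x y"
  have inj: "inj g" using signed_perm_bij[OF g] by (rule bij_is_inj)
  have minus: "g (- v) = - g v" for v by (rule signed_perm_minus[OF g])
  have t: "g \<circ> signed_transpose x y = ?g \<circ> transpose (- y) (- x)"
    using xy by (intro ext) (auto simp: signed_transpose_def transpose_def)
  have less: "- y < - x" "?g (- y) < ?g (- x)" using xy by (auto simp: transpose_def minus)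
  have fin: "finite (between h a b)" for h :: "int \<Rightarrow> int" and a b
    by (rule finite_subset[of _ "{a<..<b}"]) (auto simp: between_def)
  note first = inversions_comp_transpose[OF inj finite_inversions[OF g] _ xy(1,2)]
  have "inj ?g" using inj by (simp add: inj_compose)
  note second = inversions_comp_transpose(1)[OF this first(2) _ less]
  have "between ?g (- y) (- x) = {}" if empty: "between g x y = {}"
  proof (rule equals0I)
    fix j assume j: "j \<in> between ?g (- y) (- x)"
    have zero: "\<not> (x < 0 \<and> 0 < y \<and> g x < 0 \<and> 0 < g y)"
      using empty signed_perm_0[OF g] unfolding between_def by force
    have "?g (- y) = - g y" "?g (- x) = - g x" using xy by (auto simp: transpose_def minus)
    then have "- y < j" "j < - x" "- g y < ?g j" "?g j < - g x"
      using j unfolding between_def by auto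
    moreover have "?g x = g y" "?g y = g x" by simp_all
    moreover have "- j \<in> between g x y" if "j \<noteq> x" "j \<noteq> y"
      using calculation that by (auto simp: between_def minus transpose_def)
    ultimately show False using empty zero by (cases "j = x"; cases "j = y") auto
  qed
  moreover define e where "e = card (between g x y) + card (between ?g (- y) (- x))"
  ultimately have "e = 0 \<longleftrightarrow> between g x y = {}" using fin by auto
  moreover have "card (inversions (?g \<circ> transpose (- y) (- x))) = card (inversions g) + 2 + 2 * e"
    using first(1) second by (simp add: e_def del: o_apply)
  ultimately show "card (inversions g) + 2 \<le> card (inversions (g \<circ> signed_transpose x y))"
    "card (inversions (g \<circ> signed_transpose x y)) = card (inversions g) + 2 \<longleftrightarrow> covering g x y"
    using xy unfolding t covering_def by simp_all
qed

lemma card_inversions_signed_transpose: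
  assumes "signed_perm g" "x < y" "g x < g y" "x \<noteq> 0" "y \<noteq> 0"
  shows "card (inversions g) + min_increment x y \<le> card (inversions (g \<circ> signed_transpose x y))"
    and "card (inversions (g \<circ> signed_transpose x y)) = card (inversions g) + min_increment x y
      \<longleftrightarrow> covering g x y"
proof -
  have "0 < y \<and> 0 < g y \<and> x = - y" if "y = - x"
    using that assms signed_perm_minus[OF assms(1), of x] by auto
  then show "card (inversions g) + min_increment x y \<le> card (inversions (g \<circ> signed_transpose x y))"
    "card (inversions (g \<circ> signed_transpose x y)) = card (inversions g) + min_increment x y
      \<longleftrightarrow> covering g x y"
    using card_inversions_sign_change[OF assms(1), of y] card_inversions_two_transpositions[OF assms]
    by (auto simp: min_increment_def)
qed

lemma covering_adjacent:
  assumes "(g x, g y) = (gen_left i, gen_right i) \<or> (g x, g y) = (- gen_right i, - gen_left i)"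
    and g: "signed_perm g"
  shows "covering g x y \<longleftrightarrow> x < y"
proof -
  have "between g x y \<subseteq> (if y = - x then {0} else {})"
  proof
    fix j assume j: "j \<in> between g x y"
    then have "g j = 0 \<and> g y = - g x"
      using assms(1) between_gen_left_gen_right[of i "g j"] between_gen_left_gen_right[of i "- g j"]
      unfolding between_def by auto
    then show "j \<in> (if y = - x then {0} else {})"
      using signed_perm_eq_0_iff[OF g] signed_perm_eq_minus_iff[OF g] by simp
  qed
  then show ?thesis using assms(1) gen_left_less_gen_right[of i] by (auto simp: covering_def)
qed

lemma card_inversions_comp_cox_gen:
  assumes "signed_perm w" "\<not> descent w i"
  shows "card (inversions (w \<circ> cox_gen i)) = card (inversions w) + min_increment (gen_left i) (gen_right i)"
proof -
  have less: "w (gen_left i) < w (gen_right i)" using assms by (simp add: not_descent_iff)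
  have "between w (gen_left i) (gen_right i) \<subseteq> (if gen_right i = - gen_left i then {0} else {})"
    using between_gen_left_gen_right[of i] by (auto simp: between_def)
  then have "covering w (gen_left i) (gen_right i)"
    using less gen_left_less_gen_right by (simp add: covering_def)
  then show ?thesis
    unfolding cox_gen_eq
    using card_inversions_signed_transpose(2)[OF assms(1) gen_left_less_gen_right less] by simp
qed

lemma card_inversions_descent:
  assumes "signed_perm w" "descent w i"
  shows "card (inversions w) =
    card (inversions (w \<circ> cox_gen i)) + min_increment (gen_left i) (gen_right i)"
proof -
  have "\<not> descent (w \<circ> cox_gen i) i" using assms descent_comp_cox_gen by blast
  from card_inversions_comp_cox_gen[OF signed_perm_comp[OF assms(1) signed_perm_cox_gen] this]
  show ?thesis by (simp only: comp_cox_gen_cox_gen)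
qed

lemma covering_inv_iff:
  assumes w: "signed_perm w" and xy: "x < y" "x \<noteq> 0" "y \<noteq> 0"
  shows "inv w x < inv w y \<Longrightarrow>
      card (inversions w) + min_increment x y \<le> card (inversions (signed_transpose x y \<circ> w))"
    and "covering (inv w) x y \<longleftrightarrow> inv w x < inv w y \<and>
      card (inversions (signed_transpose x y \<circ> w)) = card (inversions w) + min_increment x y"
proof -
  let ?t = "signed_transpose x y"
  have "inv (?t \<circ> w) = inv w \<circ> ?t"
    using signed_perm_inv_comp[OF signed_perm_signed_transpose w] inv_signed_transpose xy by simp
  then have card: "card (inversions (inv w \<circ> ?t)) = card (inversions (?t \<circ> w))"
    using card_inversions_inv[OF signed_perm_comp[OF signed_perm_signed_transpose w]] xy by metis
  note transposed = card_inversions_signed_transpose[OF signed_perm_inv[OF w] xy(1) _ xy(2,3)]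
  show "inv w x < inv w y \<Longrightarrow>
      card (inversions w) + min_increment x y \<le> card (inversions (?t \<circ> w))"
    using transposed(1) unfolding card card_inversions_inv[OF w] .
  show "covering (inv w) x y \<longleftrightarrow> inv w x < inv w y \<and>
      card (inversions (?t \<circ> w)) = card (inversions w) + min_increment x y"
    using transposed(2) unfolding card card_inversions_inv[OF w] by (auto simp: covering_def)
qed

text \<open>Both implications compare numbers of inversions: multiplication by \<open>s\<^sub>i\<close> and by the reflection
  change them by fixed amounts at least, with equality for coverings.\<close>

lemma covering_descent_exchange:
  assumes w: "signed_perm w" and xy: "x < y" "x \<noteq> 0" "y \<noteq> 0"
    and ne: "signed_transpose x y \<circ> w \<noteq> w \<circ> cox_gen i"
  shows "covering (inv w) x y \<and> descent (signed_transpose x y \<circ> w) i \<longleftrightarrow>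
    descent w i \<and> covering (inv (w \<circ> cox_gen i)) x y"
proof -
  let ?s = "cox_gen i" and ?t = "signed_transpose x y"
  note ws = signed_perm_comp[OF w signed_perm_cox_gen[of i]]
  have tw: "signed_perm (?t \<circ> w)" by (intro signed_perm_comp signed_perm_signed_transpose w xy)
  have "?t \<circ> w = w \<circ> signed_transpose (inv w x) (inv w y)"
    by (simp add: signed_perm_comp_signed_transpose[OF w] signed_perm_apply_inv[OF w])
  then have "signed_transpose (inv w x) (inv w y) \<noteq> ?s" using ne by auto
  then have "?s (inv w x) < ?s (inv w y) \<longleftrightarrow> inv w x < inv w y"
    using xy signed_perm_eq_0_iff[OF signed_perm_inv[OF w]] by (intro cox_gen_less_iff) auto
  then have less: "inv (w \<circ> ?s) x < inv (w \<circ> ?s) y \<longleftrightarrow> inv w x < inv w y"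
    by (simp add: inv_comp_cox_gen[OF w])
  define N where "N v = card (inversions v)" for v :: "int \<Rightarrow> int"
  define e where "e = min_increment (gen_left i) (gen_right i)"
  have N_w: "if descent w i then N w = N (w \<circ> ?s) + e else N (w \<circ> ?s) = N w + e"
    using card_inversions_comp_cox_gen[OF w, of i] card_inversions_descent[OF w, of i]
    unfolding N_def e_def by meson
  have N_tw: "if descent (?t \<circ> w) i then N (?t \<circ> w) = N (?t \<circ> (w \<circ> ?s)) + e
      else N (?t \<circ> (w \<circ> ?s)) = N (?t \<circ> w) + e"
    using card_inversions_comp_cox_gen[OF tw, of i] card_inversions_descent[OF tw, of i]
    unfolding N_def e_def comp_assoc by meson
  note by_card = covering_inv_iff[OF w xy, folded N_def] covering_inv_iff[OF ws xy, folded N_def, unfolded less]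
  have count: "(m' = m + d) \<and> D' \<longleftrightarrow> D \<and> (l' = l + d)"
    if "if D then m = l + e else l = m + e" "if D' then m' = l' + e else l' = m' + e"
      "m + d \<le> m'" "l + d \<le> l'" for D D' and l l' m m' d :: nat
    using that min_increment_def[of "gen_left i" "gen_right i"]
    by (cases D; cases D') (auto simp: e_def split: if_splits)
  show ?thesis
  proof (cases "inv w x < inv w y")
    case True
    show ?thesis unfolding by_card(2,4)
      using True count[OF N_w N_tw by_card(1)[OF True] by_card(3)[OF True]] by blast
  qed (simp add: by_card(2,4))
qed

section \<open>Reduced words\<close>

lemma word_perm_Nil: "word_perm [] = id"
  by (simp add: word_perm_def)

lemma word_perm_Cons: "word_perm (i # a) = cox_gen i \<circ> word_perm a"
  by (simp add: word_perm_def)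

lemma word_perm_append: "word_perm (a @ b) = word_perm a \<circ> word_perm b"
  by (induction a) (simp_all add: word_perm_Nil word_perm_Cons comp_assoc)

lemma word_perm_snoc: "word_perm (a @ [i]) = word_perm a \<circ> cox_gen i"
  by (simp add: word_perm_append word_perm_Nil word_perm_Cons)

lemma signed_perms_word_perm: "set a \<subseteq> {..<n} \<Longrightarrow> word_perm a \<in> signed_perms n"
  by (induction a)
     (auto simp: word_perm_Nil word_perm_Cons signed_perms_id
       intro: signed_perms_comp signed_perms_cox_gen)

lemma signed_perm_word_perm: "signed_perm (word_perm a)"
  by (induction a)
     (auto simp only: word_perm_Nil word_perm_Cons
       intro: signed_perm_id signed_perm_comp signed_perm_cox_gen)

lemma word_perm_rev: "word_perm (rev a) = inv (word_perm a)"
proof (induction a)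
  case (Cons i a)
  then show ?case
    using signed_perm_inv_comp[OF signed_perm_cox_gen signed_perm_word_perm, of i a]
    by (simp only: rev.simps word_perm_Cons word_perm_snoc inv_cox_gen)
qed (simp add: word_perm_Nil)

lemma exchange:
  "descent (word_perm a) i \<Longrightarrow>
     \<exists>b. set b \<subseteq> set a \<and> length b < length a \<and> word_perm b = word_perm a \<circ> cox_gen i"
proof (induction a)
  case Nil
  then show ?case using gen_left_less_gen_right[of i] by (simp add: word_perm_Nil)
next
  case (Cons j a)
  let ?z = "word_perm a"
  note z = signed_perm_word_perm[of a]
  show ?case
  proof (cases "descent ?z i")
    case True
    then obtain b where "set b \<subseteq> set a" "length b < length a" "word_perm b = ?z \<circ> cox_gen i"
      using Cons.IH by blast
    then show ?thesis
      by (intro exI[of _ "j # b"]) (auto simp: word_perm_Cons comp_assoc)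
  next
    case False
    then have "signed_transpose (?z (gen_right i)) (?z (gen_left i)) = cox_gen j"
      using Cons.prems cox_gen_less_iff[of "?z (gen_right i)" "?z (gen_left i)" j]
      by (auto simp: word_perm_Cons signed_perm_eq_0_iff[OF z])
    then have "?z \<circ> cox_gen i = cox_gen j \<circ> ?z"
      by (simp add: comp_cox_gen[OF z] signed_transpose_commute)
    then have "word_perm (j # a) \<circ> cox_gen i = cox_gen j \<circ> cox_gen j \<circ> ?z"
      by (simp only: word_perm_Cons comp_assoc)
    then have "word_perm (j # a) \<circ> cox_gen i = ?z" by (simp add: cox_gen_involutory)
    then show ?thesis by (intro exI[of _ a]) auto
  qed
qed

lemma no_descent_imp_id:
  assumes "v \<in> signed_perms n" "\<And>i. \<not> descent v i"
  shows "v = id"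
proof -
  note v = signed_permI[OF assms(1)]
  have less: "v (int k) < v (int k + 1)" for k
    using assms(2)[of k, unfolded not_descent_iff[OF v]] signed_perm_minus[OF v, of 1] signed_perm_0[OF v]
    by (cases "k = 0") (auto simp: gen_left_def gen_right_def)
  have grows: "v (int k) + int m \<le> v (int k + int m)" for k m
  proof (induction m)
    case (Suc m)
    then show ?case using less[of "k + m"] by (simp add: algebra_simps)
  qed simp
  have nonneg: "v (int k) = int k" for k
    using grows[of 0 k] grows[of k n] signed_perms_fixes[OF assms(1), of "int k + int n"]
      signed_perm_0[OF v]
    by (cases "k = 0") auto
  show ?thesis
  proof
    fix x
    show "v x = id x"
      using nonneg[of "nat x"] nonneg[of "nat (- x)"] signed_perm_minus[OF v, of x]
      by (cases "0 \<le> x") auto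
  qed
qed

lemma word_exists: "v \<in> signed_perms n \<Longrightarrow> \<exists>a. set a \<subseteq> {..<n} \<and> word_perm a = v"
proof (induction "card (inversions v)" arbitrary: v rule: less_induct)
  case less
  show ?case
  proof (cases "\<exists>i. descent v i")
    case False
    then have "v = id" using no_descent_imp_id[OF less.prems] by blast
    then show ?thesis by (intro exI[of _ "[]"]) (simp add: word_perm_Nil)
  next
    case True
    then obtain i where i: "descent v i" by blast
    then have "i < n" by (rule descent_imp_less[OF less.prems])
    then have "v \<circ> cox_gen i \<in> signed_perms n"
      by (intro signed_perms_comp less.prems signed_perms_cox_gen)
    moreover have "card (inversions (v \<circ> cox_gen i)) < card (inversions v)"
      using card_inversions_descent[OF signed_permI[OF less.prems] i]
      by (simp add: min_increment_def split: if_splits)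
    ultimately obtain a where "set a \<subseteq> {..<n}" "word_perm a = v \<circ> cox_gen i"
      using less.hyps by blast
    then show ?thesis using \<open>i < n\<close>
      by (intro exI[of _ "a @ [i]"]) (simp add: word_perm_snoc comp_cox_gen_cox_gen)
  qed
qed

lemma cox_length_le: "set a \<subseteq> {..<n} \<Longrightarrow> cox_length n (word_perm a) \<le> length a"
  unfolding cox_length_def by (rule Least_le) blast

lemma reduced_word_exists: assumes "v \<in> signed_perms n" shows "\<exists>a. is_reduced_word n v a"
proof -
  have "\<exists>l a. set a \<subseteq> {..<n} \<and> word_perm a = v \<and> length a = l"
    using word_exists[OF assms] by blast
  from LeastI_ex[OF this] show ?thesis unfolding is_reduced_word_def cox_length_def by blast
qed

lemma is_reduced_word_Nil: "is_reduced_word n id []"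
  using cox_length_le[of "[]" n] by (simp add: is_reduced_word_def word_perm_Nil)

lemma is_reduced_word_imp_signed_perms: "is_reduced_word n v a \<Longrightarrow> v \<in> signed_perms n"
  using signed_perms_word_perm by (auto simp: is_reduced_word_def)

lemma is_reduced_word_snoc:
  assumes a: "is_reduced_word n v a" and nd: "\<not> descent v i" and i: "i < n"
  shows "is_reduced_word n (v \<circ> cox_gen i) (a @ [i])"
proof -
  have w: "word_perm (a @ [i]) = v \<circ> cox_gen i" and s: "set (a @ [i]) \<subseteq> {..<n}"
    and va: "word_perm a = v"
    using a i by (auto simp: is_reduced_word_def word_perm_snoc)
  have v: "signed_perm v" using va signed_perm_word_perm by blast
  have "v \<circ> cox_gen i \<in> signed_perms n" using signed_perms_word_perm[OF s] w by simp
  then obtain b where b: "is_reduced_word n (v \<circ> cox_gen i) b" using reduced_word_exists by blast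
  have "descent (word_perm b) i"
    using b nd descent_comp_cox_gen[OF v, of i] by (auto simp: is_reduced_word_def)
  then obtain c where c: "set c \<subseteq> set b" "length c < length b" "word_perm c = word_perm b \<circ> cox_gen i"
    using exchange by blast
  have "word_perm c = v" using c(3) b by (simp add: is_reduced_word_def comp_cox_gen_cox_gen)
  moreover have "set c \<subseteq> {..<n}" using c(1) b by (auto simp: is_reduced_word_def)
  ultimately have "length a < length b"
    using cox_length_le[of c n] c(2) a by (auto simp: is_reduced_word_def)
  moreover have "length b \<le> length (a @ [i])"
    using cox_length_le[OF s] w b by (simp add: is_reduced_word_def)
  ultimately show ?thesis using b w s by (auto simp: is_reduced_word_def)
qed

lemma is_reduced_word_butlast:
  assumes a: "is_reduced_word n v (a @ [i])"
  shows "is_reduced_word n (v \<circ> cox_gen i) a" "descent v i" "i < n"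
proof -
  have w: "word_perm a = v \<circ> cox_gen i" and s: "set a \<subseteq> {..<n}" and va: "v = word_perm (a @ [i])"
    and l: "length a < cox_length n v"
    using a by (auto simp: is_reduced_word_def word_perm_snoc comp_cox_gen_cox_gen)
  show i: "i < n" using a by (auto simp: is_reduced_word_def)
  have v: "signed_perm v" using va signed_perm_word_perm by blast
  show "descent v i"
  proof (rule ccontr)
    assume "\<not> descent v i"
    then have "descent (word_perm a) i" using w descent_comp_cox_gen[OF v, of i] by simp
    then obtain c where c: "set c \<subseteq> set a" "length c < length a" "word_perm c = word_perm a \<circ> cox_gen i"
      using exchange by blast
    then have "word_perm c = v" using w by (simp add: comp_cox_gen_cox_gen)
    then show False using cox_length_le[of c n] c s l by auto
  qed
  have "v \<circ> cox_gen i \<in> signed_perms n" using signed_perms_word_perm[OF s] w by simp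
  then obtain b where b: "is_reduced_word n (v \<circ> cox_gen i) b" using reduced_word_exists by blast
  have "word_perm (b @ [i]) = v"
    using b by (simp add: is_reduced_word_def word_perm_snoc comp_cox_gen_cox_gen)
  then have "cox_length n v \<le> length (b @ [i])"
    using cox_length_le[of "b @ [i]" n] b i by (auto simp: is_reduced_word_def)
  moreover have "length b \<le> length a"
    using b cox_length_le[OF s] w by (simp add: is_reduced_word_def)
  ultimately show "is_reduced_word n (v \<circ> cox_gen i) a"
    using a b w s by (auto simp: is_reduced_word_def)
qed

lemma is_reduced_word_snoc_descent:
  assumes "is_reduced_word n (v \<circ> cox_gen i) a" "descent v i" "i < n" "signed_perm v"
  shows "is_reduced_word n v (a @ [i])"
proof -
  have "\<not> descent (v \<circ> cox_gen i) i"
    using descent_comp_cox_gen[OF assms(4), of i] assms(2) by blast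
  from is_reduced_word_snoc[OF assms(1) this assms(3)]
  show ?thesis unfolding comp_cox_gen_cox_gen .
qed

lemma reduced_word_ending_in_descent:
  assumes "v \<in> signed_perms n" "descent v i"
  shows "\<exists>c. is_reduced_word n v (c @ [i])"
proof -
  note i = descent_imp_less[OF assms]
  obtain c where "is_reduced_word n (v \<circ> cox_gen i) c"
    using reduced_word_exists[OF signed_perms_comp[OF assms(1) signed_perms_cox_gen[OF i]]] by blast
  then show ?thesis using is_reduced_word_snoc_descent assms i signed_permI by blast
qed

subsection \<open>Braid relations\<close>

fun alternating :: "nat \<Rightarrow> nat \<Rightarrow> nat \<Rightarrow> nat list" where
  "alternating 0 i j = []"
| "alternating (Suc m) i j = alternating m j i @ [i]"

definition coxeter_order :: "nat \<Rightarrow> nat \<Rightarrow> nat" where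
  "coxeter_order i j = (if 1 < \<bar>int i - int j\<bar> then 2 else if i = 0 \<or> j = 0 then 4 else 3)"

fun alternating_descents :: "nat \<Rightarrow> nat \<Rightarrow> nat \<Rightarrow> (int \<Rightarrow> int) \<Rightarrow> bool" where
  "alternating_descents 0 i j v \<longleftrightarrow> True"
| "alternating_descents (Suc m) i j v \<longleftrightarrow> descent v i \<and> alternating_descents m j i (v \<circ> cox_gen i)"

lemma coxeter_order_commute: "coxeter_order i j = coxeter_order j i"
  unfolding coxeter_order_def abs_minus_commute[of "int j"] by auto

lemma alternating_word_cases:
  assumes "i \<noteq> j"
  obtains (far) "coxeter_order i j = 2" "1 < \<bar>int i - int j\<bar>"
    | (up) "coxeter_order i j = 3" "0 < i" "j = i + 1" | (down) "coxeter_order i j = 3" "0 < j" "i = j + 1"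
    | (first) "coxeter_order i j = 4" "i = 0" "j = 1" | (second) "coxeter_order i j = 4" "i = 1" "j = 0"
proof -
  consider "1 < \<bar>int i - int j\<bar>" | "0 < i" "j = i + 1" | "0 < j" "i = j + 1"
    | "i = 0" "j = 1" | "i = 1" "j = 0" using assms by linarith
  then show thesis
    by cases (rule that; simp add: coxeter_order_def; fail)+
qed

lemma alternating_numeral:
  "alternating 2 i j = [j, i]" "alternating 3 i j = [i, j, i]" "alternating 4 i j = [j, i, j, i]"
  by (simp_all add: eval_nat_numeral)

lemma alternating_descents_numeral:
  "alternating_descents 2 i j v \<longleftrightarrow> descent v i \<and> descent (v \<circ> cox_gen i) j"
  "alternating_descents 3 i j v \<longleftrightarrow>
     descent v i \<and> descent (v \<circ> cox_gen i) j \<and> descent (v \<circ> cox_gen i \<circ> cox_gen j) i"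
  "alternating_descents 4 i j v \<longleftrightarrow>
     descent v i \<and> descent (v \<circ> cox_gen i) j \<and> descent (v \<circ> cox_gen i \<circ> cox_gen j) i \<and>
     descent (v \<circ> cox_gen i \<circ> cox_gen j \<circ> cox_gen i) j"
  by (simp_all only: eval_nat_numeral BitM.simps alternating_descents.simps simp_thms)

lemma set_alternating: "set (alternating m i j) \<subseteq> {i, j}"
  by (induction m arbitrary: i j) auto

lemma is_reduced_word_append_alternating:
  "alternating_descents m i j v \<Longrightarrow> signed_perm v \<Longrightarrow> i < n \<Longrightarrow> j < n \<Longrightarrow>
    is_reduced_word n (v \<circ> word_perm (rev (alternating m i j))) c \<Longrightarrow>
    is_reduced_word n v (c @ alternating m i j)"
proof (induction m arbitrary: i j v)
  case 0
  then show ?case by (simp add: word_perm_Nil)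
next
  case (Suc m)
  have "is_reduced_word n (v \<circ> cox_gen i \<circ> word_perm (rev (alternating m j i))) c"
    using Suc.prems(5) by (simp only: alternating.simps rev_append rev.simps append.simps word_perm_Cons comp_assoc)
  moreover have "alternating_descents m j i (v \<circ> cox_gen i)"
    using Suc.prems(1) by (simp only: alternating_descents.simps)
  ultimately have "is_reduced_word n (v \<circ> cox_gen i) (c @ alternating m j i)"
    using Suc.IH[OF _ signed_perm_comp[OF Suc.prems(2) signed_perm_cox_gen] Suc.prems(4,3)] by blast
  then show ?case
    using is_reduced_word_snoc_descent[of n v i "c @ alternating m j i"] Suc.prems by simp
qed

lemma cox_gen_conj:
  "cox_gen i \<circ> signed_transpose x y \<circ> cox_gen i = signed_transpose (cox_gen i x) (cox_gen i y)"
  by (simp only: signed_perm_comp_signed_transpose[OF signed_perm_cox_gen] comp_assoc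
      cox_gen_involutory comp_id)

lemma cox_gen_commute:
  assumes "1 < \<bar>int i - int j\<bar>"
  shows "cox_gen i \<circ> cox_gen j = cox_gen j \<circ> cox_gen i"
proof -
  have "cox_gen i (gen_left j) = gen_left j" "cox_gen i (gen_right j) = gen_right j"
    using assms by (auto simp: cox_gen_apply gen_left_def gen_right_def)
  then show ?thesis
    using signed_perm_comp_signed_transpose[OF signed_perm_cox_gen, of i "gen_left j" "gen_right j"]
    by (simp only: cox_gen_eq[of j])
qed

lemma cox_gen_braid3:
  assumes "0 < i"
  shows "cox_gen i \<circ> cox_gen (i + 1) \<circ> cox_gen i = cox_gen (i + 1) \<circ> cox_gen i \<circ> cox_gen (i + 1)"
proof -
  have "cox_gen i (gen_left (i + 1)) = cox_gen (i + 1) (gen_left i)"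
    "cox_gen i (gen_right (i + 1)) = cox_gen (i + 1) (gen_right i)"
    using assms by (auto simp: cox_gen_apply gen_left_def gen_right_def)
  then show ?thesis
    using cox_gen_conj[of i "gen_left (i + 1)" "gen_right (i + 1)"]
      cox_gen_conj[of "i + 1" "gen_left i" "gen_right i"]
    by (simp only: cox_gen_eq[symmetric])
qed

lemma cox_gen_braid4:
  "cox_gen 0 \<circ> cox_gen 1 \<circ> cox_gen 0 \<circ> cox_gen 1 = cox_gen 1 \<circ> cox_gen 0 \<circ> cox_gen 1 \<circ> cox_gen 0"
proof -
  let ?r = "signed_transpose (- 1) 2"
  have "cox_gen 0 \<circ> cox_gen 1 \<circ> cox_gen 0 = signed_transpose (cox_gen 0 1) (cox_gen 0 2)"
    using cox_gen_conj[of 0 1 2]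
    by (simp only: cox_gen_eq[of 1]) (simp add: gen_left_def gen_right_def)
  also have "\<dots> = ?r" by (simp add: cox_gen_apply gen_left_def gen_right_def)
  finally have r: "cox_gen 0 \<circ> cox_gen 1 \<circ> cox_gen 0 = ?r" .
  have "cox_gen 1 \<circ> ?r = signed_transpose (- 2) 1 \<circ> cox_gen 1"
    by (simp only: signed_perm_comp_signed_transpose[OF signed_perm_cox_gen])
       (simp add: cox_gen_apply gen_left_def gen_right_def)
  also have "signed_transpose (- 2) 1 = ?r"
    using signed_transpose_uminus[of 2 "- 1"] signed_transpose_commute[of 2 "- 1"] by simp
  finally show ?thesis unfolding r by (metis r comp_assoc)
qed

lemma word_perm_alternating:
  assumes "i \<noteq> j"
  shows "word_perm (alternating (coxeter_order i j) i j) = word_perm (alternating (coxeter_order i j) j i)"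
proof -
  note words = alternating_numeral word_perm_Cons word_perm_Nil comp_id comp_assoc
  from assms show ?thesis
  proof (cases rule: alternating_word_cases)
    case far
    show ?thesis using cox_gen_commute[OF far(2)] by (simp only: far(1) words)
  next
    case up
    show ?thesis using cox_gen_braid3[OF up(2)] unfolding up(1) unfolding up(3)
      by (simp only: words)
  next
    case down
    show ?thesis using cox_gen_braid3[OF down(2)] unfolding down(1) unfolding down(3)
      by (simp only: words)
  next
    case first
    show ?thesis using cox_gen_braid4 unfolding first(1) unfolding first(2,3) by (simp only: words)
  next
    case second
    show ?thesis using cox_gen_braid4 unfolding second(1) unfolding second(2,3)
      by (simp only: words)
  qed
qed

lemma cox_gen_values:
  "0 < i \<Longrightarrow> cox_gen i (int i) = int i + 1"
  "0 < i \<Longrightarrow> cox_gen i (int i + 1) = int i"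
  "0 < i \<Longrightarrow> cox_gen i (int i + 2) = int i + 2"
  "0 < i \<Longrightarrow> cox_gen (i + 1) (int i) = int i"
  "cox_gen (i + 1) (int i + 1) = int i + 2"
  "cox_gen (i + 1) (int i + 2) = int i + 1"
  "cox_gen 0 (- 1) = 1" "cox_gen 0 1 = - 1" "cox_gen 0 2 = 2" "cox_gen 0 (- 2) = - 2"
  "cox_gen 1 (- 1) = - 2" "cox_gen 1 1 = 2" "cox_gen 1 2 = 1" "cox_gen 1 (- 2) = - 1"
  by (auto simp: cox_gen_apply gen_left_def gen_right_def)

lemma gen_values:
  "0 < i \<Longrightarrow> gen_left i = int i" "0 < i \<Longrightarrow> gen_right i = int i + 1"
  "gen_left (i + 1) = int i + 1" "gen_right (i + 1) = int i + 2"
  "gen_left 0 = - 1" "gen_right 0 = 1" "gen_left 1 = 1" "gen_right 1 = 2"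
  by (auto simp: gen_left_def gen_right_def)

lemma alternating_descents_coxeter_order:
  assumes "i \<noteq> j" and v: "signed_perm v" and desc: "descent v i" "descent v j"
  shows "alternating_descents (coxeter_order i j) i j v"
proof -
  note evals = alternating_descents_numeral comp_apply
  from assms(1) show ?thesis
  proof (cases rule: alternating_word_cases)
    case far
    have "cox_gen i (gen_left j) = gen_left j" "cox_gen i (gen_right j) = gen_right j"
      using far(2) by (auto simp: cox_gen_apply gen_left_def gen_right_def)
    then show ?thesis unfolding far(1) evals using desc by simp
  next
    case up
    show ?thesis
      using desc unfolding up(1) unfolding up(3) evals gen_values(1,2)[OF up(2)] gen_values(3,4)
        cox_gen_values(1-4)[OF up(2)] cox_gen_values(5,6) by simp
  next
    case down
    show ?thesis
      using desc unfolding down(1)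
        unfolding down(3) evals gen_values(1,2)[OF down(2)] gen_values(3,4)
        cox_gen_values(1-4)[OF down(2)] cox_gen_values(5,6) by simp
  next
    case first
    show ?thesis
      using desc signed_perm_minus[OF v, of 1] signed_perm_minus[OF v, of 2]
      unfolding first(1) unfolding first(2,3) evals gen_values(5-) cox_gen_values(7-) by simp
  next
    case second
    show ?thesis
      using desc signed_perm_minus[OF v, of 1] signed_perm_minus[OF v, of 2]
      unfolding second(1) unfolding second(2,3) evals gen_values(5-) cox_gen_values(7-) by simp
  qed
qed

lemma descent_word_perm_alternating:
  assumes "i \<noteq> j"
  shows "descent (word_perm (alternating (coxeter_order i j) i j)) i"
proof -
  note evals = alternating_numeral word_perm_Cons word_perm_Nil comp_apply id_apply
  from assms show ?thesis
  proof (cases rule: alternating_word_cases)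
    case far
    have "cox_gen j (gen_left i) = gen_left i" "cox_gen j (gen_right i) = gen_right i"
      using far(2) by (auto simp: cox_gen_apply gen_left_def gen_right_def)
    then show ?thesis
      unfolding far(1) evals cox_gen_gen_left cox_gen_gen_right
      by (simp add: gen_left_less_gen_right)
  next
    case up
    show ?thesis
      unfolding up(1) unfolding up(3) evals gen_values(1,2)[OF up(2)] cox_gen_values(1-4)[OF up(2)]
        cox_gen_values(5,6) by simp
  next
    case down
    show ?thesis
      unfolding down(1) unfolding down(3) evals gen_values(3,4) cox_gen_values(1-4)[OF down(2)]
        cox_gen_values(5,6) by simp
  next
    case first
    show ?thesis
      unfolding first(1) unfolding first(2,3) evals gen_values(5-) cox_gen_values(7-) by simp
  next
    case second
    show ?thesis
      unfolding second(1) unfolding second(2,3) evals gen_values(5-) cox_gen_values(7-) by simp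
  qed
qed

lemma is_reduced_word_alternating:
  assumes "i \<noteq> j" "i < n" "j < n"
  shows "is_reduced_word n (word_perm (alternating (coxeter_order i j) i j))
    (alternating (coxeter_order i j) i j)"
proof -
  let ?m = "coxeter_order i j"
  let ?v = "word_perm (alternating ?m i j)"
  note v = signed_perm_word_perm[of "alternating ?m i j"]
  have "descent ?v j"
    using descent_word_perm_alternating[of j i] assms(1) word_perm_alternating[of j i]
    by (simp add: coxeter_order_commute)
  then have "alternating_descents ?m i j ?v"
    using alternating_descents_coxeter_order[OF assms(1) v descent_word_perm_alternating[OF assms(1)]]
    by blast
  moreover have "?v \<circ> word_perm (rev (alternating ?m i j)) = id"
    unfolding word_perm_rev
    using signed_perm_bij[OF v] by (simp only: bij_is_surj surj_iff[symmetric])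
  ultimately show ?thesis
    using is_reduced_word_append_alternating[OF _ v assms(2,3), where m = ?m and c = "[]"] is_reduced_word_Nil[of n]
    by simp
qed

text \<open>Since \<open>i\<close> and \<open>j\<close> are both descents of \<open>v\<close>, the longest element of the group they generate
  splits off on the right.\<close>

lemma reduced_words_alternating_ends:
  assumes a: "is_reduced_word n v (a @ [i])" and b: "is_reduced_word n v (b @ [j])" and ij: "i \<noteq> j"
  obtains c where "is_reduced_word n v (c @ alternating (coxeter_order i j) i j)"
    "is_reduced_word n v (c @ alternating (coxeter_order i j) j i)"
proof -
  let ?m = "coxeter_order i j"
  have v: "v \<in> signed_perms n" using a by (rule is_reduced_word_imp_signed_perms)
  note last_a = is_reduced_word_butlast[OF a] and last_b = is_reduced_word_butlast[OF b]
  note alt_i = alternating_descents_coxeter_order[OF ij signed_permI[OF v] last_a(2) last_b(2)]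
  note alt_j = alternating_descents_coxeter_order[OF ij[symmetric] signed_permI[OF v] last_b(2) last_a(2),
    unfolded coxeter_order_commute[of j i]]
  have "set (rev (alternating ?m i j)) \<subseteq> {..<n}"
    using set_alternating[of ?m i j] last_a(3) last_b(3) by auto
  then obtain c where c: "is_reduced_word n (v \<circ> word_perm (rev (alternating ?m i j))) c"
    using reduced_word_exists[OF signed_perms_comp[OF v signed_perms_word_perm]] by blast
  have "is_reduced_word n v (c @ alternating ?m i j)"
    using is_reduced_word_append_alternating[OF alt_i signed_permI[OF v] last_a(3) last_b(3) c] .
  moreover have "is_reduced_word n v (c @ alternating ?m j i)"
    using is_reduced_word_append_alternating[OF alt_j signed_permI[OF v] last_b(3) last_a(3)] c
    by (simp only: word_perm_rev word_perm_alternating[OF ij])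
  ultimately show thesis by (rule that)
qed

section \<open>The regular representation\<close>

text \<open>A function \<open>f\<close> stands for the formal sum of the \<open>f(w) u\<^sub>w\<close>; then \<open>u_mult \<beta> i\<close> and
  \<open>left_mult \<beta> i\<close> are the multiplications by \<open>u\<^sub>i\<close>. Another ranking \<open>\<rho>\<close> of the values replaces
  \<open>id\<close> when the operators of the transition equation are moved past \<open>u_mult \<beta> i\<close>.\<close>

definition right_mult ::
    "(int \<Rightarrow> int) \<Rightarrow> 'a::comm_ring_1 \<Rightarrow> nat \<Rightarrow> ((int \<Rightarrow> int) \<Rightarrow> 'a) \<Rightarrow> (int \<Rightarrow> int) \<Rightarrow> 'a" where
  "right_mult \<rho> \<beta> i f w =
     (if signed_perm w
      then (if descent w i then f (w \<circ> cox_gen i) else 0) + \<beta> * (if descent (\<rho> \<circ> w) i then f w else 0)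
      else 0)"

abbreviation u_mult ::
    "'a::comm_ring_1 \<Rightarrow> nat \<Rightarrow> ((int \<Rightarrow> int) \<Rightarrow> 'a) \<Rightarrow> (int \<Rightarrow> int) \<Rightarrow> 'a" where
  "u_mult \<equiv> right_mult (\<lambda>v. v)"

definition left_mult ::
    "'a::comm_ring_1 \<Rightarrow> nat \<Rightarrow> ((int \<Rightarrow> int) \<Rightarrow> 'a) \<Rightarrow> (int \<Rightarrow> int) \<Rightarrow> 'a" where
  "left_mult \<beta> i f w =
     (if signed_perm w \<and> descent (inv w) i then f (cox_gen i \<circ> w) + \<beta> * f w else 0)"

definition delta :: "(int \<Rightarrow> int) \<Rightarrow> (int \<Rightarrow> int) \<Rightarrow> 'a::comm_ring_1" where
  "delta v w = (if w = v then 1 else 0)"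

lemma right_mult_add:
  "right_mult \<rho> \<beta> i (\<lambda>w. f w + g w) = (\<lambda>w. right_mult \<rho> \<beta> i f w + right_mult \<rho> \<beta> i g w)"
  by (rule ext) (simp add: right_mult_def algebra_simps)

lemma right_mult_scale: "right_mult \<rho> \<beta> i (\<lambda>w. c * f w) = (\<lambda>w. c * right_mult \<rho> \<beta> i f w)"
  by (rule ext) (simp add: right_mult_def algebra_simps)

lemma right_mult_0: "right_mult \<rho> \<beta> i (\<lambda>w. 0) = (\<lambda>w. 0)"
  by (rule ext) (simp add: right_mult_def)

lemma left_mult_0: "left_mult \<beta> i (\<lambda>w. 0) = (\<lambda>w. 0)"
  by (rule ext) (simp add: left_mult_def)

lemma left_mult_add:
  "left_mult \<beta> i (\<lambda>w. f w + g w) = (\<lambda>w. left_mult \<beta> i f w + left_mult \<beta> i g w)"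
  by (rule ext) (simp add: left_mult_def algebra_simps)

lemma left_mult_scale: "left_mult \<beta> i (\<lambda>w. c * f w) = (\<lambda>w. c * left_mult \<beta> i f w)"
  by (rule ext) (simp add: left_mult_def algebra_simps)

lemma u_mult_apply:
  "u_mult \<beta> i f w = (if signed_perm w \<and> descent w i then f (w \<circ> cox_gen i) + \<beta> * f w else 0)"
  by (simp add: right_mult_def)

lemma right_mult_right_mult:
  assumes "inj \<rho>"
  shows "right_mult \<rho> \<beta> i (right_mult \<rho> \<beta> i f) = (\<lambda>w. \<beta> * right_mult \<rho> \<beta> i f w)"
proof
  fix w
  show "right_mult \<rho> \<beta> i (right_mult \<rho> \<beta> i f) w = \<beta> * right_mult \<rho> \<beta> i f w"
  proof (cases "signed_perm w")
    case True
    note ws = signed_perm_comp[OF True signed_perm_cox_gen[of i]]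
    have "\<not> descent (w \<circ> cox_gen i) i" if "descent w i"
      using that descent_comp_cox_gen[OF True] by blast
    moreover have "\<rho> (w (gen_left i)) \<noteq> \<rho> (w (gen_right i))"
      using assms gen_left_less_gen_right[of i] signed_perm_eq_iff[OF True] by (auto dest: injD)
    then have "descent (\<rho> \<circ> (w \<circ> cox_gen i)) i \<longleftrightarrow> \<not> descent (\<rho> \<circ> w) i"
      unfolding comp_apply cox_gen_gen_left cox_gen_gen_right by auto
    ultimately show ?thesis
      unfolding right_mult_def comp_cox_gen_cox_gen using True ws
      by (cases "descent w i"; cases "descent (\<rho> \<circ> w) i") (simp_all add: algebra_simps del: comp_apply)
  qed (simp add: right_mult_def)
qed

lemma descent_inv_iff:
  assumes w: "signed_perm w" and comm: "cox_gen i \<circ> w = w \<circ> cox_gen j"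
  shows "descent (inv w) i \<longleftrightarrow> descent w j"
proof -
  have "signed_transpose (w (gen_left j)) (w (gen_right j)) \<circ> w = cox_gen i \<circ> w"
    using comm by (simp add: comp_cox_gen[OF w])
  then have "signed_transpose (w (gen_left j)) (w (gen_right j)) = cox_gen i"
    using fun_cong[of _ _ "inv w _"]
    by (metis (no_types) signed_perm_apply_inv[OF w] comp_apply ext)
  then have "(w (gen_left j), w (gen_right j)) \<in> {(gen_left i, gen_right i), (gen_right i, gen_left i),
      (- gen_left i, - gen_right i), (- gen_right i, - gen_left i)}"
    using gen_left_less_gen_right[of j]
    by (intro signed_transpose_eqD) (auto simp: signed_perm_eq_iff[OF w] cox_gen_eq)
  then show ?thesis
    using signed_perm_inv_apply[OF w] signed_perm_minus[OF signed_perm_inv[OF w]]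
      gen_left_less_gen_right[of i] gen_left_less_gen_right[of j]
    by (auto; metis less_le_not_le neg_less_iff_less order_less_imp_le)
qed

lemma descent_cox_gen_comp:
  assumes w: "signed_perm w" and "cox_gen i \<circ> w \<noteq> w \<circ> cox_gen j"
  shows "descent (cox_gen i \<circ> w) j \<longleftrightarrow> descent w j"
proof -
  have "signed_transpose (w (gen_right j)) (w (gen_left j)) \<noteq> cox_gen i"
    using assms comp_cox_gen[OF w, of j] by (metis signed_transpose_commute)
  then show ?thesis
    unfolding comp_apply by (intro cox_gen_less_iff) (auto simp: signed_perm_eq_0_iff[OF w])
qed

lemma left_mult_right_mult_commute:
  "left_mult \<beta> i (u_mult \<beta> j f) = u_mult \<beta> j (left_mult \<beta> i f)"
proof
  fix w
  let ?s = "cox_gen i" and ?t = "cox_gen j"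
  show "left_mult \<beta> i (u_mult \<beta> j f) w = u_mult \<beta> j (left_mult \<beta> i f) w"
  proof (cases "signed_perm w")
    case w: True
    note sw = signed_perm_comp[OF signed_perm_cox_gen[of i] w]
    note wt = signed_perm_comp[OF w signed_perm_cox_gen[of j]]
    have inv_sw: "inv (?s \<circ> w) = inv w \<circ> ?s"
      by (simp only: signed_perm_inv_comp[OF signed_perm_cox_gen w] inv_cox_gen)
    have inv_wt: "inv (w \<circ> ?t) = ?t \<circ> inv w" by (rule inv_comp_cox_gen[OF w])
    show ?thesis
    proof (cases "?s \<circ> w = w \<circ> ?t")
      case True
      have "\<not> descent (w \<circ> ?t) j" if "descent w j"
        using that descent_comp_cox_gen[OF w] by blast
      moreover have "\<not> descent (inv (w \<circ> ?t)) i" if "descent (inv w) i"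
        using that descent_comp_cox_gen[OF signed_perm_inv[OF w]] inv_sw unfolding True by metis
      ultimately show ?thesis
        unfolding left_mult_def u_mult_apply True
        using w wt descent_inv_iff[OF w True] by (auto simp: algebra_simps)
    next
      case False
      then have "?t \<circ> inv w \<noteq> inv w \<circ> ?s"
        using inv_sw inv_wt signed_perm_inv_inv[OF sw] signed_perm_inv_inv[OF wt] by metis
      then have "descent (inv (w \<circ> ?t)) i \<longleftrightarrow> descent (inv w) i"
        unfolding inv_wt by (rule descent_cox_gen_comp[OF signed_perm_inv[OF w]])
      then show ?thesis
        unfolding left_mult_def u_mult_apply descent_cox_gen_comp[OF w False] comp_assoc
        using w sw wt by (auto simp: algebra_simps)
    qed
  qed (simp add: left_mult_def u_mult_apply)
qed

lemma delta_cox_gen_mult: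
  "left_mult \<beta> i (delta id) = delta (cox_gen i)" "u_mult \<beta> i (delta id) = delta (cox_gen i)"
proof -
  have eq: "cox_gen i \<circ> w = id \<longleftrightarrow> w = cox_gen i" "w \<circ> cox_gen i = id \<longleftrightarrow> w = cox_gen i" for w
    by (metis comp_assoc comp_id id_comp cox_gen_involutory)+
  have desc: "descent (cox_gen i) i" "\<not> descent id i"
    using gen_left_less_gen_right[of i] by (simp_all add: cox_gen_gen_left cox_gen_gen_right)
  then have ne: "cox_gen i \<noteq> id" by metis
  show "left_mult \<beta> i (delta id) = delta (cox_gen i)"
  proof
    fix w
    show "left_mult \<beta> i (delta id) w = delta (cox_gen i) w"
      unfolding left_mult_def delta_def eq
      using desc ne signed_perm_cox_gen[of i] inv_cox_gen[of i] inv_id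
      by (cases "w = cox_gen i"; cases "w = id") simp_all
  qed
  show "u_mult \<beta> i (delta id) = delta (cox_gen i)"
  proof
    fix w
    show "u_mult \<beta> i (delta id) w = delta (cox_gen i) w"
      unfolding u_mult_apply delta_def eq using desc ne signed_perm_cox_gen[of i]
      by (cases "w = cox_gen i"; cases "w = id") simp_all
  qed
qed

definition word_coeffs :: "nat list \<Rightarrow> (int \<Rightarrow> int) \<Rightarrow> int poly" where
  "word_coeffs a = fold (u_mult beta) a (delta id)"

lemma word_coeffs_Nil: "word_coeffs [] = delta id"
  by (simp add: word_coeffs_def)

lemma word_coeffs_snoc: "word_coeffs (a @ [i]) = u_mult beta i (word_coeffs a)"
  by (simp add: word_coeffs_def)

lemma word_coeffs_Cons: "word_coeffs (i # a) = left_mult beta i (word_coeffs a)"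
proof (induction a rule: rev_induct)
  case Nil
  then show ?case by (simp add: word_coeffs_def delta_cox_gen_mult)
next
  case (snoc j a)
  have "word_coeffs (i # a @ [j]) = u_mult beta j (left_mult beta i (word_coeffs a))"
    using snoc word_coeffs_snoc[of "i # a" j] by simp
  then show ?case by (simp add: word_coeffs_snoc left_mult_right_mult_commute)
qed

lemma word_coeffs_reduced: "is_reduced_word n v a \<Longrightarrow> word_coeffs a = delta v"
proof (induction a arbitrary: v rule: rev_induct)
  case Nil
  then show ?case by (simp only: word_coeffs_Nil is_reduced_word_def word_perm_Nil)
next
  case (snoc i a)
  note last = is_reduced_word_butlast[OF snoc.prems]
  have v: "signed_perm v" by (rule signed_permI[OF is_reduced_word_imp_signed_perms[OF snoc.prems]])
  have eq: "w \<circ> cox_gen i = v \<circ> cox_gen i \<longleftrightarrow> w = v" for w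
    by (metis comp_cox_gen_cox_gen)
  have not_desc: "\<not> descent (v \<circ> cox_gen i) i" using descent_comp_cox_gen[OF v] last(2) by blast
  have "u_mult beta i (delta (v \<circ> cox_gen i)) w = delta v w" for w
  proof -
    have "v \<circ> cox_gen i \<noteq> v" using not_desc last(2) by metis
    then show ?thesis unfolding u_mult_apply delta_def eq using v last(2) not_desc
      by (cases "w = v"; cases "w = v \<circ> cox_gen i") simp_all
  qed
  then show ?case unfolding word_coeffs_snoc snoc.IH[OF last(1)] by blast
qed

lemma word_coeffs_alternating:
  assumes "i \<noteq> j"
  shows "word_coeffs (alternating (coxeter_order i j) i j) = word_coeffs (alternating (coxeter_order i j) j i)"
proof -
  let ?n = "Suc (max i j)"
  have "word_coeffs (alternating (coxeter_order i j) i j)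
      = delta (word_perm (alternating (coxeter_order i j) i j))"
    using assms by (intro word_coeffs_reduced[of ?n] is_reduced_word_alternating) auto
  also have "\<dots> = delta (word_perm (alternating (coxeter_order j i) j i))"
    using word_perm_alternating[OF assms] by (simp add: coxeter_order_commute)
  also have "\<dots> = word_coeffs (alternating (coxeter_order j i) j i)"
    using assms by (intro word_coeffs_reduced[of ?n, symmetric] is_reduced_word_alternating) auto
  finally show ?thesis by (simp add: coxeter_order_commute)
qed

section \<open>The basis of the algebra\<close>

lemma poly_mapping_keys_induct [case_names zero add single]:
  fixes P :: "('a \<Rightarrow>\<^sub>0 'b::comm_monoid_add) \<Rightarrow> bool"
  assumes "P 0" "\<And>f g. P f \<Longrightarrow> P g \<Longrightarrow> P (f + g)"
    and "\<And>a c. a \<in> Poly_Mapping.keys h \<Longrightarrow> P (Poly_Mapping.single a c)"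
  shows "P h"
proof -
  have "h = (\<Sum>a\<in>Poly_Mapping.keys h. Poly_Mapping.single a (Poly_Mapping.lookup h a))"
    by (rule poly_mapping_eqI) (simp add: lookup_sum lookup_single when_def in_keys_iff sum.delta)
  moreover have "P (\<Sum>a\<in>A. Poly_Mapping.single a (Poly_Mapping.lookup h a))"
    if "finite A" "A \<subseteq> Poly_Mapping.keys h" for A
    using that by induction (auto intro: assms)
  ultimately show ?thesis by (metis finite_keys order_refl)
qed

definition u_monomial :: "nat list \<Rightarrow> free_alg" where
  "u_monomial a = Poly_Mapping.single (Word a) 1"

lemma u_monomial_Nil: "u_monomial [] = 1"
  by (simp add: u_monomial_def flip: zero_u_word_def)

lemma u_monomial_append: "u_monomial (a @ b) = u_monomial a * u_monomial b"
  by (simp add: u_monomial_def mult_single plus_u_word_def)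

lemma u_monomial_singleton: "u_monomial [i] = u_gen i"
  by (simp add: u_monomial_def u_gen_def)

lemma u_monomial_Cons: "u_monomial (i # a) = u_gen i * u_monomial a"
  using u_monomial_append[of "[i]" a] by (simp add: u_monomial_singleton)

lemma single_eq_scalar_u_monomial: "Poly_Mapping.single a c = scalar c * u_monomial (letters a)"
  by (simp add: scalar_def u_monomial_def mult_single zero_u_word_def plus_u_word_def)

lemma scalar_add: "scalar (c + d) = scalar c + scalar d"
  by (simp add: scalar_def single_add)

lemma scalar_mult: "scalar (c * d) = scalar c * scalar d"
  by (simp add: scalar_def mult_single)

lemma scalar_0: "scalar 0 = 0" and scalar_1: "scalar 1 = 1"
  by (simp_all add: scalar_def)

lemma scalar_central: "h * scalar c = scalar c * h"
proof (induction h rule: poly_mapping_keys_induct)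
  case (single a d)
  then show ?case by (simp add: scalar_def mult_single mult.commute)
qed (simp_all add: algebra_simps)

subsection \<open>Coefficients of elements of the free algebra\<close>

definition expansion :: "free_alg \<Rightarrow> (int \<Rightarrow> int) \<Rightarrow> int poly" where
  "expansion h w = (\<Sum>a\<in>Poly_Mapping.keys h. Poly_Mapping.lookup h a * word_coeffs (letters a) w)"

lemma expansion_superset:
  assumes "finite A" "Poly_Mapping.keys h \<subseteq> A"
  shows "expansion h w = (\<Sum>a\<in>A. Poly_Mapping.lookup h a * word_coeffs (letters a) w)"
  unfolding expansion_def by (rule sum.mono_neutral_left) (use assms in \<open>auto simp: in_keys_iff\<close>)

lemma expansion_add: "expansion (h + h') = (\<lambda>w. expansion h w + expansion h' w)"
proof
  fix w
  let ?A = "Poly_Mapping.keys h \<union> Poly_Mapping.keys h'"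
  show "expansion (h + h') w = expansion h w + expansion h' w"
    using Poly_Mapping.keys_add[of h h']
    by (simp add: expansion_superset[of ?A] lookup_add algebra_simps sum.distrib)
qed

lemma expansion_single: "expansion (Poly_Mapping.single a c) = (\<lambda>w. c * word_coeffs (letters a) w)"
  by (rule ext) (subst expansion_superset[of "{a}"], auto)

lemma expansion_0: "expansion 0 = (\<lambda>w. 0)"
  by (rule ext) (simp add: expansion_def)

lemma expansion_sum: "expansion (\<Sum>v\<in>A. h v) = (\<lambda>w. \<Sum>v\<in>A. expansion (h v) w)"
  by (induction A rule: infinite_finite_induct) (simp_all add: expansion_0 expansion_add)

lemma expansion_u_monomial: "expansion (u_monomial a) = word_coeffs a"
  by (simp add: u_monomial_def expansion_single)

lemma expansion_scalar_mult: "expansion (scalar c * h) = (\<lambda>w. c * expansion h w)"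
proof (induction h rule: poly_mapping_keys_induct)
  case (single a d)
  then show ?case by (simp add: scalar_def mult_single expansion_single mult.assoc)
qed (simp_all add: expansion_0 expansion_add algebra_simps)

lemma expansion_diff: "expansion (h - h') = (\<lambda>w. expansion h w - expansion h' w)"
proof
  fix w
  have "expansion (h - h' + h') w = expansion (h - h') w + expansion h' w"
    by (simp only: expansion_add)
  then show "expansion (h - h') w = expansion h w - expansion h' w" by simp
qed

lemma expansion_mult_u_gen: "expansion (h * u_gen i) = u_mult beta i (expansion h)"
proof (induction h rule: poly_mapping_keys_induct)
  case (single a c)
  show ?case
    by (simp add: u_gen_def mult_single expansion_single plus_u_word_def word_coeffs_snoc right_mult_scale)
next
  case zero
  show ?case by (simp add: expansion_0 right_mult_0)
qed (simp add: algebra_simps expansion_add right_mult_add)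

lemma expansion_u_gen_mult: "expansion (u_gen i * h) = left_mult beta i (expansion h)"
proof (induction h rule: poly_mapping_keys_induct)
  case (single a c)
  show ?case
    by (simp add: u_gen_def mult_single expansion_single plus_u_word_def word_coeffs_Cons left_mult_scale)
next
  case zero
  show ?case by (simp add: expansion_0 left_mult_0)
qed (simp add: algebra_simps expansion_add left_mult_add)

lemma expansion_mult_eq_0_right:
  assumes "expansion h = (\<lambda>w. 0)" shows "expansion (h * g) = (\<lambda>w. 0)"
proof (induction g rule: poly_mapping_keys_induct)
  case (single a c)
  have "expansion (h * u_monomial b) = (\<lambda>w. 0)" for b
  proof (induction b rule: rev_induct)
    case (snoc i b)
    then show ?case
      by (simp add: u_monomial_append u_monomial_singleton expansion_mult_u_gen right_mult_0 flip: mult.assoc)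
  qed (simp add: assms u_monomial_Nil)
  moreover have "h * Poly_Mapping.single a c = scalar c * (h * u_monomial (letters a))"
    by (simp add: single_eq_scalar_u_monomial scalar_central flip: mult.assoc)
  ultimately show ?case by (simp add: expansion_scalar_mult)
qed (simp_all add: expansion_0 expansion_add algebra_simps)

lemma expansion_mult_eq_0_left:
  assumes "expansion h = (\<lambda>w. 0)" shows "expansion (f * h) = (\<lambda>w. 0)"
proof (induction f rule: poly_mapping_keys_induct)
  case (single a c)
  have "expansion (u_monomial b * h) = (\<lambda>w. 0)" for b
    by (induction b) (simp_all add: assms u_monomial_Nil u_monomial_Cons mult.assoc expansion_u_gen_mult left_mult_0)
  then show ?case by (simp add: single_eq_scalar_u_monomial mult.assoc expansion_scalar_mult)
qed (simp_all add: expansion_0 expansion_add algebra_simps)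

lemma relators_cases:
  assumes "r \<in> relators n"
  obtains (square) i where "i < n" "r = u_gen i * u_gen i - scalar beta * u_gen i"
    | (braid) i j where "i \<noteq> j" "r = u_monomial (alternating (coxeter_order i j) i j)
        - u_monomial (alternating (coxeter_order i j) j i)"
proof -
  consider i where "i < n" "r = u_gen i * u_gen i - scalar beta * u_gen i"
    | "1 < n" "r = u_gen 1 * u_gen 0 * u_gen 1 * u_gen 0 - u_gen 0 * u_gen 1 * u_gen 0 * u_gen 1"
    | i where "0 < i" "r = u_gen i * u_gen (i + 1) * u_gen i - u_gen (i + 1) * u_gen i * u_gen (i + 1)"
    | i j where "r = u_gen i * u_gen j - u_gen j * u_gen i" "1 < \<bar>int i - int j\<bar>"
    using assms unfolding relators_def by (auto split: if_splits)
  then show thesis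
  proof cases
    case 1
    then show ?thesis by (rule square)
  next
    case 2
    then show ?thesis
      by (intro braid[of 0 1])
         (simp_all add: coxeter_order_def alternating_numeral u_monomial_Cons u_monomial_Nil mult.assoc)
  next
    case 3
    then show ?thesis
      by (intro braid[of i "i + 1"])
         (simp_all add: coxeter_order_def alternating_numeral u_monomial_Cons u_monomial_Nil mult.assoc)
  next
    case 4
    then show ?thesis
      by (intro braid[of j i])
         (auto simp: coxeter_order_def alternating_numeral u_monomial_Cons u_monomial_Nil)
  qed
qed

lemma expansion_relator: assumes "r \<in> relators n" shows "expansion r = (\<lambda>w. 0)"
  using assms
proof (cases rule: relators_cases)
  case (square i)
  have "expansion (u_gen i) = word_coeffs [i]"
    by (simp add: expansion_u_monomial flip: u_monomial_singleton)
  then have "expansion (u_gen i * u_gen i) = (\<lambda>w. beta * expansion (u_gen i) w)"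
    using right_mult_right_mult[OF inj_on_id2, of beta i "delta id"]
    by (simp only: expansion_mult_u_gen word_coeffs_def fold.simps comp_apply id_apply)
  then show ?thesis by (simp only: square(2) expansion_diff expansion_scalar_mult diff_self)
next
  case (braid i j)
  then show ?thesis
    by (simp only: expansion_diff expansion_u_monomial word_coeffs_alternating[OF braid(1)] diff_self)
qed

lemma expansion_relation_ideal: "h \<in> relation_ideal n \<Longrightarrow> expansion h = (\<lambda>w. 0)"
proof (induction rule: relation_ideal.induct)
  case (mult r p q)
  show ?case by (intro expansion_mult_eq_0_right expansion_mult_eq_0_left expansion_relator[OF mult(1)])
qed (simp_all add: expansion_0 expansion_add)

subsection \<open>Matsumoto's theorem\<close>

lemma free_alg_on_0: "0 \<in> free_alg_on n"
  by (simp add: free_alg_on_def)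

lemma free_alg_on_u_monomial: "set a \<subseteq> {..<n} \<Longrightarrow> u_monomial a \<in> free_alg_on n"
  by (auto simp: free_alg_on_def u_monomial_def)

lemma free_alg_on_1: "1 \<in> free_alg_on n"
  using free_alg_on_u_monomial[of "[]" n] by (simp add: u_monomial_Nil)

lemma free_alg_on_u_gen: "i < n \<Longrightarrow> u_gen i \<in> free_alg_on n"
  using free_alg_on_u_monomial[of "[i]" n] by (simp add: u_monomial_singleton)

lemma free_alg_on_scalar: "scalar c \<in> free_alg_on n"
  by (auto simp: free_alg_on_def scalar_def zero_u_word_def split: if_splits)

lemma free_alg_on_add: "f \<in> free_alg_on n \<Longrightarrow> g \<in> free_alg_on n \<Longrightarrow> f + g \<in> free_alg_on n"
  using Poly_Mapping.keys_add[of f g] by (fastforce simp: free_alg_on_def)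

lemma free_alg_on_mult: "f \<in> free_alg_on n \<Longrightarrow> g \<in> free_alg_on n \<Longrightarrow> f * g \<in> free_alg_on n"
  using Poly_Mapping.keys_mult[of f g] by (fastforce simp: free_alg_on_def plus_u_word_def)

lemma relation_ideal_mult:
  assumes "h \<in> relation_ideal n" "f \<in> free_alg_on n" "g \<in> free_alg_on n"
  shows "f * h * g \<in> relation_ideal n"
  using assms(1)
proof induction
  case zero
  then show ?case by (simp add: relation_ideal.zero)
next
  case (add h h')
  then show ?case using relation_ideal.add by (simp add: algebra_simps)
next
  case (mult r p q)
  have "(f * p) * r * (q * g) \<in> relation_ideal n"
    by (intro relation_ideal.mult mult free_alg_on_mult assms)
  then show ?case by (simp add: mult.assoc)
qed

lemma relation_ideal_uminus: "h \<in> relation_ideal n \<Longrightarrow> - h \<in> relation_ideal n"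
proof -
  assume "h \<in> relation_ideal n"
  then have "scalar (-1) * h * 1 \<in> relation_ideal n"
    by (intro relation_ideal_mult free_alg_on_scalar free_alg_on_1)
  moreover have "scalar (-1) = - 1"
    by (simp add: scalar_def single_uminus flip: single_one)
  ultimately show ?thesis by simp
qed

definition u_equiv :: "nat \<Rightarrow> free_alg \<Rightarrow> free_alg \<Rightarrow> bool" where
  "u_equiv n f g \<longleftrightarrow> f - g \<in> relation_ideal n"

lemma u_equiv_refl: "u_equiv n f f"
  by (simp add: u_equiv_def relation_ideal.zero)

lemma u_equiv_sym: "u_equiv n f g \<Longrightarrow> u_equiv n g f"
  using relation_ideal_uminus by (fastforce simp: u_equiv_def)

lemma u_equiv_trans [trans]: "u_equiv n f g \<Longrightarrow> u_equiv n g h \<Longrightarrow> u_equiv n f h"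
  using relation_ideal.add by (fastforce simp: u_equiv_def)

lemma u_equiv_add: "u_equiv n f g \<Longrightarrow> u_equiv n f' g' \<Longrightarrow> u_equiv n (f + f') (g + g')"
  using relation_ideal.add[of "f - g" n "f' - g'"] by (simp add: u_equiv_def algebra_simps)

lemma u_equiv_mult_right: "u_equiv n f g \<Longrightarrow> q \<in> free_alg_on n \<Longrightarrow> u_equiv n (f * q) (g * q)"
  using relation_ideal_mult[of "f - g" n 1 q] by (simp add: u_equiv_def algebra_simps free_alg_on_1)

lemma u_equiv_mult_left: "u_equiv n f g \<Longrightarrow> p \<in> free_alg_on n \<Longrightarrow> u_equiv n (p * f) (p * g)"
  using relation_ideal_mult[of "f - g" n p 1] by (simp add: u_equiv_def algebra_simps free_alg_on_1)

lemma u_equiv_relator: "f - g \<in> relators n \<Longrightarrow> u_equiv n f g"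
  using relation_ideal.mult[of "f - g" n 1 1] by (simp add: u_equiv_def free_alg_on_1)

lemma u_equiv_square: "i < n \<Longrightarrow> u_equiv n (u_gen i * u_gen i) (scalar beta * u_gen i)"
  by (rule u_equiv_relator) (auto simp: relators_def)

lemma u_equiv_alternating:
  assumes "i \<noteq> j" "i < n" "j < n"
  shows "u_equiv n (u_monomial (alternating (coxeter_order i j) i j))
    (u_monomial (alternating (coxeter_order i j) j i))"
proof -
  note words = alternating_numeral u_monomial_Cons u_monomial_Nil mult.assoc[symmetric] mult_1_right
  from assms(1) show ?thesis
  proof (cases rule: alternating_word_cases)
    case far
    then have "1 < \<bar>int j - int i\<bar>" by linarith
    then show ?thesis unfolding far(1) words
      by (intro u_equiv_relator) (use assms in \<open>auto simp: relators_def\<close>)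
  next
    case up
    show ?thesis unfolding up(1) words unfolding up(3)
      by (intro u_equiv_relator) (use assms up in \<open>auto simp: relators_def\<close>)
  next
    case down
    show ?thesis unfolding down(1) words unfolding down(3)
      by (intro u_equiv_sym[OF u_equiv_relator]) (use assms down in \<open>auto simp: relators_def\<close>)
  next
    case first
    show ?thesis unfolding first(1) words unfolding first(2,3)
      by (intro u_equiv_relator) (use assms first in \<open>auto simp: relators_def\<close>)
  next
    case second
    show ?thesis unfolding second(1) words unfolding second(2,3)
      by (intro u_equiv_sym[OF u_equiv_relator]) (use assms second in \<open>auto simp: relators_def\<close>)
  qed
qed

lemma u_equiv_snoc:
  assumes "u_equiv n (u_monomial a) (u_monomial b)" "i < n"
  shows "u_equiv n (u_monomial (a @ [i])) (u_monomial (b @ [i]))"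
  unfolding u_monomial_append
  using assms free_alg_on_u_monomial[of "[i]" n] by (intro u_equiv_mult_right) auto

lemma u_equiv_reduced_words:
  "is_reduced_word n v a \<Longrightarrow> is_reduced_word n v b \<Longrightarrow> u_equiv n (u_monomial a) (u_monomial b)"
proof (induction "length a" arbitrary: v a b)
  case 0
  then show ?case by (simp add: is_reduced_word_def u_equiv_refl)
next
  case (Suc l)
  have same_last: "u_equiv n (u_monomial (d @ [k])) (u_monomial (c @ [k]))"
    if d: "is_reduced_word n v (d @ [k])" and c: "is_reduced_word n v (c @ [k])" for c d k
  proof -
    have "length d = l" using d Suc.prems(1) Suc.hyps(2) by (simp add: is_reduced_word_def)
    then have "u_equiv n (u_monomial d) (u_monomial c)"
      using Suc.hyps(1) is_reduced_word_butlast(1)[OF d] is_reduced_word_butlast(1)[OF c] by blast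
    then show ?thesis using is_reduced_word_butlast(3)[OF d] by (rule u_equiv_snoc)
  qed
  have "length b = Suc l" using Suc.prems Suc.hyps(2) by (simp add: is_reduced_word_def)
  then obtain b' j where b: "b = b' @ [j]" by (cases b rule: rev_cases) auto
  obtain a' i where a: "a = a' @ [i]" using Suc.hyps(2) by (cases a rule: rev_cases) auto
  note last_a = is_reduced_word_butlast[OF Suc.prems(1)[unfolded a]]
  note last_b = is_reduced_word_butlast[OF Suc.prems(2)[unfolded b]]
  show ?case
  proof (cases "i = j")
    case True
    then show ?thesis using same_last Suc.prems a b by simp
  next
    case False
    let ?m = "coxeter_order i j"
    obtain c where c_i: "is_reduced_word n v (c @ alternating ?m i j)"
      and c_j: "is_reduced_word n v (c @ alternating ?m j i)"
      using reduced_words_alternating_ends[OF Suc.prems[unfolded a b] False] .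
    obtain k where m: "?m = Suc k" by (rule that[of "?m - 1"]) (simp add: coxeter_order_def)
    have "u_equiv n (u_monomial a) (u_monomial (c @ alternating ?m i j))"
      using same_last[of a' i "c @ alternating k j i"] Suc.prems(1) c_i by (simp add: a m)
    also have "u_equiv n \<dots> (u_monomial (c @ alternating ?m j i))"
      unfolding u_monomial_append using c_i
      by (intro u_equiv_mult_left u_equiv_alternating False last_a last_b free_alg_on_u_monomial)
        (simp add: is_reduced_word_def)
    also have "u_equiv n \<dots> (u_monomial b)"
      using same_last[of "c @ alternating k i j" j b'] Suc.prems(2) c_j by (simp add: b m)
    finally show ?thesis .
  qed
qed

lemma u_perm_eq: "u_perm n v = u_monomial (SOME a. is_reduced_word n v a)"
proof -
  have "prod_list (map u_gen a) = u_monomial a" for a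
    by (induction a) (simp_all add: u_monomial_Nil u_monomial_Cons)
  then show ?thesis by (simp add: u_perm_def)
qed

lemma u_equiv_u_perm:
  assumes "is_reduced_word n v a" shows "u_equiv n (u_monomial a) (u_perm n v)"
  unfolding u_perm_eq by (rule u_equiv_reduced_words[OF assms someI[of "is_reduced_word n v", OF assms]])

lemma expansion_u_perm:
  assumes "v \<in> signed_perms n" shows "expansion (u_perm n v) = delta v"
proof -
  obtain a where "is_reduced_word n v a" using reduced_word_exists[OF assms] by blast
  then have "is_reduced_word n v (SOME a. is_reduced_word n v a)" by (rule someI)
  then show ?thesis by (simp add: u_perm_eq expansion_u_monomial word_coeffs_reduced)
qed

lemma u_perm_mult_u_gen:
  assumes v: "v \<in> signed_perms n" and i: "i < n"
  shows "u_equiv n (u_perm n v * u_gen i)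
    (if descent v i then scalar beta * u_perm n v else u_perm n (v \<circ> cox_gen i))"
proof (cases "descent v i")
  case False
  obtain b where b: "is_reduced_word n v b" using reduced_word_exists[OF v] by blast
  have "u_equiv n (u_perm n v * u_gen i) (u_monomial b * u_gen i)"
    by (intro u_equiv_mult_right u_equiv_sym[OF u_equiv_u_perm[OF b]] free_alg_on_u_gen i)
  also have "u_equiv n (u_monomial b * u_gen i) (u_perm n (v \<circ> cox_gen i))"
    using u_equiv_u_perm[OF is_reduced_word_snoc[OF b False i]]
    by (simp only: u_monomial_append u_monomial_singleton)
  finally show ?thesis using False by (simp only: if_False)
next
  case True
  obtain c where c: "is_reduced_word n v (c @ [i])"
    using reduced_word_ending_in_descent[OF v True] by blast
  have c_mem: "u_monomial c \<in> free_alg_on n"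
    using c by (intro free_alg_on_u_monomial) (auto simp: is_reduced_word_def)
  note last = u_monomial_append u_monomial_singleton
  have "u_equiv n (u_perm n v * u_gen i) (u_monomial (c @ [i]) * u_gen i)"
    by (intro u_equiv_mult_right u_equiv_sym[OF u_equiv_u_perm[OF c]] free_alg_on_u_gen i)
  also have "u_monomial (c @ [i]) * u_gen i = u_monomial c * (u_gen i * u_gen i)"
    by (simp only: last mult.assoc)
  also have "u_equiv n \<dots> (u_monomial c * (scalar beta * u_gen i))"
    by (intro u_equiv_mult_left u_equiv_square i c_mem)
  also have "\<dots> = scalar beta * u_monomial (c @ [i])"
    by (simp only: last mult.assoc[symmetric] scalar_central)
  also have "u_equiv n \<dots> (scalar beta * u_perm n v)"
    by (intro u_equiv_mult_left u_equiv_u_perm c free_alg_on_scalar)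
  finally show ?thesis using True by (simp only: if_True)
qed

lemma u_equiv_multiple_of_u_perm:
  "set a \<subseteq> {..<n} \<Longrightarrow> \<exists>c. \<exists>v\<in>signed_perms n. u_equiv n (u_monomial a) (scalar c * u_perm n v)"
proof (induction a rule: rev_induct)
  case Nil
  have "u_equiv n (u_monomial []) (scalar 1 * u_perm n id)"
    using u_equiv_u_perm[OF is_reduced_word_Nil] by (simp only: scalar_1 mult_1_left)
  then show ?case using signed_perms_id by blast
next
  case (snoc i a)
  then obtain c v where v: "v \<in> signed_perms n" and a: "u_equiv n (u_monomial a) (scalar c * u_perm n v)"
    by auto
  have i: "i < n" using snoc.prems by simp
  have "u_equiv n (u_monomial (a @ [i])) (scalar c * u_perm n v * u_gen i)"
    unfolding u_monomial_append u_monomial_singleton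
    by (intro u_equiv_mult_right a free_alg_on_u_gen i)
  also have "u_equiv n \<dots>
      (scalar c * (if descent v i then scalar beta * u_perm n v else u_perm n (v \<circ> cox_gen i)))"
    unfolding mult.assoc by (intro u_equiv_mult_left u_perm_mult_u_gen v i free_alg_on_scalar)
  finally have step: "u_equiv n (u_monomial (a @ [i]))
      (scalar c * (if descent v i then scalar beta * u_perm n v else u_perm n (v \<circ> cox_gen i)))" .
  show ?case
  proof (cases "descent v i")
    case True
    then have "u_equiv n (u_monomial (a @ [i])) (scalar (c * beta) * u_perm n v)"
      using step by (simp only: if_True scalar_mult mult.assoc)
    then show ?thesis using v by blast
  next
    case False
    then show ?thesis
      using step signed_perms_comp[OF v signed_perms_cox_gen[OF i]] by (auto simp only: if_False)
  qed
qed

definition u_combination :: "nat \<Rightarrow> ((int \<Rightarrow> int) \<Rightarrow> int poly) \<Rightarrow> free_alg" where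
  "u_combination n c = (\<Sum>v\<in>signed_perms n. scalar (c v) * u_perm n v)"

lemma u_combination_add: "u_combination n (\<lambda>v. c v + d v) = u_combination n c + u_combination n d"
  by (simp add: u_combination_def scalar_add ring_distribs sum.distrib)

lemma u_combination_0: "u_combination n (\<lambda>v. 0) = 0"
  by (simp add: u_combination_def scalar_0)

lemma u_combination_single:
  assumes "v \<in> signed_perms n"
  shows "u_combination n (\<lambda>u. if u = v then x else 0) = scalar x * u_perm n v"
proof -
  have "u_combination n (\<lambda>u. if u = v then x else 0)
      = (\<Sum>u\<in>signed_perms n. if u = v then scalar x * u_perm n v else 0)"
    unfolding u_combination_def by (rule sum.cong) (simp_all add: scalar_0)
  then show ?thesis using assms finite_signed_perms by (simp add: sum.delta)
qed

lemma expansion_u_combination: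
  assumes "w \<in> signed_perms n" shows "expansion (u_combination n c) w = c w"
proof -
  have "expansion (u_combination n c) w = (\<Sum>v\<in>signed_perms n. c v * delta v w)"
    by (simp add: u_combination_def expansion_sum expansion_scalar_mult expansion_u_perm)
  also have "\<dots> = (\<Sum>v\<in>signed_perms n. if w = v then c v else 0)"
    by (rule sum.cong) (simp_all add: delta_def)
  finally show ?thesis using assms finite_signed_perms by (simp add: sum.delta')
qed

lemma u_equiv_u_combination:
  assumes "h \<in> free_alg_on n"
  shows "\<exists>c. (\<forall>v. v \<notin> signed_perms n \<longrightarrow> c v = 0) \<and> u_equiv n h (u_combination n c)"
proof (induction h rule: poly_mapping_keys_induct)
  case zero
  show ?case
    by (intro exI[of _ "\<lambda>v. 0"]) (simp add: u_combination_0 u_equiv_refl)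
next
  case (add f g)
  then obtain c d where "\<forall>v. v \<notin> signed_perms n \<longrightarrow> c v = 0" "u_equiv n f (u_combination n c)"
    "\<forall>v. v \<notin> signed_perms n \<longrightarrow> d v = 0" "u_equiv n g (u_combination n d)" by blast
  then show ?case
    by (intro exI[of _ "\<lambda>v. c v + d v"]) (simp add: u_combination_add u_equiv_add)
next
  case (single a x)
  then have "set (letters a) \<subseteq> {..<n}" using assms by (auto simp: free_alg_on_def)
  then obtain y v where v: "v \<in> signed_perms n" "u_equiv n (u_monomial (letters a)) (scalar y * u_perm n v)"
    using u_equiv_multiple_of_u_perm by blast
  have "u_equiv n (Poly_Mapping.single a x) (scalar (x * y) * u_perm n v)"
    unfolding single_eq_scalar_u_monomial scalar_mult mult.assoc
    by (intro u_equiv_mult_left v free_alg_on_scalar)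
  then show ?case
    using v(1) by (intro exI[of _ "\<lambda>u. if u = v then x * y else 0"]) (auto simp: u_combination_single)
qed

lemma u_coeff_eq_expansion:
  assumes "h \<in> free_alg_on n" "w \<in> signed_perms n"
  shows "u_coeff n h w = expansion h w"
proof -
  let ?expands = "\<lambda>c. (\<forall>v. v \<notin> signed_perms n \<longrightarrow> c v = 0) \<and>
    h - (\<Sum>v\<in>signed_perms n. scalar (c v) * u_perm n v) \<in> relation_ideal n"
  have unique: "c v = expansion h v" if "?expands c" "v \<in> signed_perms n" for c v
  proof -
    have "expansion (h - u_combination n c) = (\<lambda>v. 0)"
      using that(1) by (intro expansion_relation_ideal[of _ n]) (simp add: u_combination_def)
    then have "expansion h v = expansion (u_combination n c) v"
      unfolding expansion_diff by (metis eq_iff_diff_eq_0)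
    then show ?thesis using expansion_u_combination[OF that(2)] by simp
  qed
  obtain c where c: "?expands c"
    using u_equiv_u_combination[OF assms(1)] unfolding u_equiv_def u_combination_def by blast
  have "d = c" if "?expands d" for d
    using unique[OF c] unique[OF that] that c by (intro ext) metis
  then have "u_coeff n h = c" unfolding u_coeff_def using c by (intro the_equality)
  then show ?thesis using unique[OF c assms(2)] by simp
qed

section \<open>The generating function\<close>

definition one_plus ::
    "(nat \<Rightarrow> ('b \<Rightarrow> 'a::comm_ring_1) \<Rightarrow> 'b \<Rightarrow> 'a) \<Rightarrow> 'a \<Rightarrow> nat \<Rightarrow> ('b \<Rightarrow> 'a) \<Rightarrow> 'b \<Rightarrow> 'a" where
  "one_plus D x i f w = f w + x * D i f w"

definition palindromic_factor ::
    "(nat \<Rightarrow> ('b \<Rightarrow> 'a::comm_ring_1) \<Rightarrow> 'b \<Rightarrow> 'a) \<Rightarrow> 'a \<Rightarrow> nat \<Rightarrow> ('b \<Rightarrow> 'a) \<Rightarrow> 'b \<Rightarrow> 'a" where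
  "palindromic_factor D x n = fold (one_plus D x) (rev [0..<n] @ [0..<n])"

lemma palindromic_factor_0: "palindromic_factor D x 0 f = f"
  by (simp add: palindromic_factor_def)

lemma palindromic_factor_Suc:
  "palindromic_factor D x (Suc n) f = one_plus D x n (palindromic_factor D x n (one_plus D x n f))"
  by (simp add: palindromic_factor_def)

type_synonym x_polynomial = "monomial \<Rightarrow>\<^sub>0 int poly"

definition beta_x :: x_polynomial where "beta_x = Poly_Mapping.single 0 beta"
definition x_var :: "nat \<Rightarrow> x_polynomial" where
  "x_var i = Poly_Mapping.single (Poly_Mapping.single i 1) 1"

text \<open>The product restricted to \<open>x\<^sub>1, \<dots>, x\<^sub>N\<close>, as a function of the group element.\<close>

definition gen_fun :: "nat \<Rightarrow> nat \<Rightarrow> (int \<Rightarrow> int) \<Rightarrow> x_polynomial" where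
  "gen_fun n N = fold (\<lambda>i. palindromic_factor (u_mult beta_x) (x_var i) n) [1..<Suc N] (delta id)"

lemma gen_fun_0: "gen_fun n 0 = delta id"
  by (simp add: gen_fun_def)

lemma gen_fun_Suc:
  "gen_fun n (Suc N) = palindromic_factor (u_mult beta_x) (x_var (Suc N)) n (gen_fun n N)"
  by (simp add: gen_fun_def)

lemma lookup_mult_single_add:
  fixes H :: "monomial \<Rightarrow>\<^sub>0 'b::semiring_0"
  shows "Poly_Mapping.lookup (H * Poly_Mapping.single k u) (m + k) = Poly_Mapping.lookup H m * u"
  by (induction H rule: poly_mapping_keys_induct)
     (auto simp: mult_single lookup_single lookup_add ring_distribs when_def)

lemma lookup_mult_single_eq_0:
  fixes H :: "monomial \<Rightarrow>\<^sub>0 'b::semiring_0"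
  assumes "\<nexists>m'. m = m' + k"
  shows "Poly_Mapping.lookup (H * Poly_Mapping.single k u) m = 0"
  using assms
  by (induction H rule: poly_mapping_keys_induct)
     (auto simp: mult_single lookup_single lookup_add ring_distribs when_def)

lemma lookup_beta_x_mult: "Poly_Mapping.lookup (beta_x * g) m = beta * Poly_Mapping.lookup g m"
  using lookup_mult_single_add[of g 0 beta m] by (simp only: beta_x_def mult.commute add_0_right)

definition represents :: "nat \<Rightarrow> (monomial \<Rightarrow>\<^sub>0 free_alg) \<Rightarrow> ((int \<Rightarrow> int) \<Rightarrow> x_polynomial) \<Rightarrow> bool" where
  "represents n H f \<longleftrightarrow> (\<forall>m. Poly_Mapping.lookup H m \<in> free_alg_on n \<and>
     (\<forall>w. Poly_Mapping.lookup (f w) m = expansion (Poly_Mapping.lookup H m) w))"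

lemma represents_1: "represents n 1 (delta id)"
proof -
  have "expansion 1 = delta id"
    using expansion_u_monomial[of "[]"] by (simp only: u_monomial_Nil word_coeffs_Nil)
  then show ?thesis
    by (auto simp: represents_def delta_def lookup_one when_def expansion_0 free_alg_on_1 free_alg_on_0)
qed

lemma represents_add:
  "represents n H f \<Longrightarrow> represents n K g \<Longrightarrow> represents n (H + K) (\<lambda>w. f w + g w)"
  by (simp add: represents_def lookup_add expansion_add free_alg_on_add)

lemma represents_u_mult:
  assumes "represents n H f" "a < n"
  shows "represents n (H * Poly_Mapping.single (Poly_Mapping.single i 1) (u_gen a))
    (\<lambda>w. x_var i * u_mult beta_x a f w)"
  unfolding represents_def
proof (intro allI conjI)
  fix m w
  let ?k = "Poly_Mapping.single i (1::nat)"
  let ?H = "H * Poly_Mapping.single ?k (u_gen a)"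
  have "Poly_Mapping.lookup ?H m \<in> free_alg_on n \<and>
      Poly_Mapping.lookup (u_mult beta_x a f w * Poly_Mapping.single ?k 1) m =
        expansion (Poly_Mapping.lookup ?H m) w"
  proof (cases "\<exists>m'. m = m' + ?k")
    case True
    then obtain m' where m: "m = m' + ?k" by blast
    have "Poly_Mapping.lookup (u_mult beta_x a f w) m' = expansion (Poly_Mapping.lookup H m' * u_gen a) w"
      using assms(1)
      by (simp add: represents_def u_mult_apply lookup_add lookup_beta_x_mult expansion_mult_u_gen
          del: mult_pCons_left)
    then show ?thesis
      unfolding m lookup_mult_single_add mult_1_right
      using assms by (simp add: represents_def free_alg_on_mult free_alg_on_u_gen)
  next
    case False
    then show ?thesis by (simp add: lookup_mult_single_eq_0 expansion_0 free_alg_on_0)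
  qed
  then show "Poly_Mapping.lookup ?H m \<in> free_alg_on n"
    "Poly_Mapping.lookup (x_var i * u_mult beta_x a f w) m = expansion (Poly_Mapping.lookup ?H m) w"
    by (simp_all add: x_var_def mult.commute)
qed

lemma represents_x_factor:
  assumes "represents n H f"
  shows "represents n (H * x_factor n i) (palindromic_factor (u_mult beta_x) (x_var i) n f)"
proof -
  let ?step = "\<lambda>a. 1 + Poly_Mapping.single (Poly_Mapping.single i 1) (u_gen a)"
  have "represents n (H * prod_list (map ?step as)) (fold (one_plus (u_mult beta_x) (x_var i)) as f)"
    if "set as \<subseteq> {..<n}" for as
    using assms that
  proof (induction as arbitrary: H f)
    case (Cons a as)
    have "represents n (H * ?step a) (one_plus (u_mult beta_x) (x_var i) a f)"
      using represents_add[OF Cons.prems(1) represents_u_mult[OF Cons.prems(1), of a i]] Cons.prems(2)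
      by (simp add: one_plus_def[abs_def] distrib_left)
    then show ?case using Cons.IH Cons.prems(2) by (simp add: mult.assoc[symmetric])
  qed simp
  then show ?thesis
    unfolding x_factor_def palindromic_factor_def
    by (metis (no_types, lifting) Un_least set_append set_rev set_upt lessThan_atLeast0 order_refl)
qed

lemma partial_product_Suc: "partial_product n (Suc N) = partial_product n N * x_factor n (Suc N)"
  by (simp add: partial_product_def)

lemma represents_gen_fun: "represents n (partial_product n N) (gen_fun n N)"
proof (induction N)
  case 0
  then show ?case using represents_1 by (simp add: partial_product_def gen_fun_0)
next
  case (Suc N)
  then show ?case using represents_x_factor by (simp add: partial_product_Suc gen_fun_Suc)
qed

lemma lookup_mult_x_factor:
  assumes "Poly_Mapping.lookup m i = 0"
  shows "Poly_Mapping.lookup (H * x_factor n i) m = Poly_Mapping.lookup H m"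
proof -
  let ?step = "\<lambda>a. 1 + Poly_Mapping.single (Poly_Mapping.single i 1) (u_gen a)"
  have "\<nexists>m'. m = m' + Poly_Mapping.single i 1" using assms by (auto simp: lookup_add)
  then have step: "Poly_Mapping.lookup (H * ?step a) m = Poly_Mapping.lookup H m" for H a
    by (simp add: distrib_left lookup_add lookup_mult_single_eq_0)
  have "Poly_Mapping.lookup (H * prod_list (map ?step as)) m = Poly_Mapping.lookup H m" for as
  proof (induction as arbitrary: H)
    case (Cons a as)
    show ?case using Cons.IH[of "H * ?step a"] step[of H a] by (simp add: mult.assoc)
  qed simp
  then show ?thesis by (simp only: x_factor_def)
qed

lemma lookup_partial_product_stable:
  assumes "\<forall>i\<in>Poly_Mapping.keys m. i \<le> N" "N \<le> M"
  shows "Poly_Mapping.lookup (partial_product n M) m = Poly_Mapping.lookup (partial_product n N) m"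
  using assms(2)
proof (induction M rule: dec_induct)
  case (step M)
  have "Poly_Mapping.lookup m (Suc M) = 0"
    using assms(1) step.hyps by (metis in_keys_iff not_less_eq_eq le_trans)
  then show ?case using step by (simp add: partial_product_Suc lookup_mult_x_factor)
qed simp

lemma product_coeff_eq:
  assumes "\<forall>i\<in>Poly_Mapping.keys m. i \<le> N"
  shows "product_coeff n m = Poly_Mapping.lookup (partial_product n N) m"
proof -
  have ev: "\<forall>\<^sub>F M in sequentially. Poly_Mapping.lookup (partial_product n M) m
      = Poly_Mapping.lookup (partial_product n N) m"
    unfolding eventually_sequentially using lookup_partial_product_stable[OF assms] by blast
  show ?thesis unfolding product_coeff_def
  proof (rule the_equality)
    fix h
    assume "\<forall>\<^sub>F M in sequentially. Poly_Mapping.lookup (partial_product n M) m = h"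
    with ev have "\<forall>\<^sub>F M in sequentially. h = Poly_Mapping.lookup (partial_product n N) m"
      by eventually_elim simp
    then show "h = Poly_Mapping.lookup (partial_product n N) m" by simp
  qed (rule ev)
qed

lemma GC_eq_lookup_gen_fun:
  assumes "w \<in> signed_perms n" "\<forall>i\<in>Poly_Mapping.keys m. i \<le> N"
  shows "GC n w m = Poly_Mapping.lookup (gen_fun n N w) m"
  using represents_gen_fun[of n N] u_coeff_eq_expansion[OF _ assms(1)]
  by (simp add: GC_def product_coeff_eq[OF assms(2)] represents_def)

subsection \<open>Independence of the rank\<close>

definition local_on :: "'b set \<Rightarrow> (('b \<Rightarrow> 'a) \<Rightarrow> 'b \<Rightarrow> 'a) \<Rightarrow> bool" where
  "local_on A F \<longleftrightarrow> (\<forall>f g. (\<forall>v\<in>A. f v = g v) \<longrightarrow> (\<forall>w\<in>A. F f w = F g w))"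

lemma local_onD: "local_on A F \<Longrightarrow> (\<And>v. v \<in> A \<Longrightarrow> f v = g v) \<Longrightarrow> w \<in> A \<Longrightarrow> F f w = F g w"
  unfolding local_on_def by blast

lemma local_on_fold: "(\<And>i. local_on A (F i)) \<Longrightarrow> local_on A (fold F is)"
proof (induction "is")
  case (Cons i "is")
  then show ?case unfolding local_on_def fold.simps comp_apply by blast
qed (simp add: local_on_def)

lemma local_on_right_mult:
  fixes \<beta> :: "'a::comm_ring_1"
  shows "local_on (signed_perms n) (right_mult \<rho> \<beta> i)"
  unfolding local_on_def
proof (intro allI ballI impI)
  fix f g :: "(int \<Rightarrow> int) \<Rightarrow> 'a" and w
  assume eq: "\<forall>v\<in>signed_perms n. f v = g v" and w: "w \<in> signed_perms n"
  have "w \<circ> cox_gen i \<in> signed_perms n" if "descent w i"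
    by (rule signed_perms_comp[OF w signed_perms_cox_gen[OF descent_imp_less[OF w that]]])
  then show "right_mult \<rho> \<beta> i f w = right_mult \<rho> \<beta> i g w"
    using eq w by (simp add: right_mult_def del: o_apply)
qed

lemma local_on_one_plus: "local_on A (D i) \<Longrightarrow> local_on A (one_plus D x i)"
  unfolding local_on_def one_plus_def by metis

lemma local_on_palindromic_factor:
  "(\<And>i. local_on A (D i)) \<Longrightarrow> local_on A (palindromic_factor D x n)"
  unfolding palindromic_factor_def by (intro local_on_fold local_on_one_plus)

lemma palindromic_factor_u_mult_stable:
  assumes "n \<le> m" "w \<in> signed_perms n"
  shows "palindromic_factor (u_mult \<beta>) x m f w = palindromic_factor (u_mult \<beta>) x n f w"
  using assms(1)
proof (induction m arbitrary: f rule: dec_induct)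
  case (step m)
  have trivial: "one_plus (u_mult \<beta>) x m f v = f v" if "v \<in> signed_perms n" for f v
    using descent_imp_less[OF that, of m] step.hyps by (auto simp: one_plus_def u_mult_apply)
  show ?case
    unfolding palindromic_factor_Suc trivial[OF assms(2)] step.IH
    by (rule local_onD[OF local_on_palindromic_factor[OF local_on_right_mult] trivial assms(2)])
qed simp

lemma gen_fun_stable:
  assumes "n \<le> m" shows "w \<in> signed_perms n \<Longrightarrow> gen_fun m N w = gen_fun n N w"
proof (induction N arbitrary: w)
  case (Suc N)
  have "gen_fun m (Suc N) w = palindromic_factor (u_mult beta_x) (x_var (Suc N)) n (gen_fun m N) w"
    unfolding gen_fun_Suc by (rule palindromic_factor_u_mult_stable[OF assms Suc.prems])
  also have "\<dots> = gen_fun n (Suc N) w"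
    unfolding gen_fun_Suc
    by (rule local_onD[OF local_on_palindromic_factor[OF local_on_right_mult] Suc.IH Suc.prems])
  finally show ?case .
qed (simp add: gen_fun_0)

section \<open>The transition equation\<close>

definition reflection_op ::
    "'a::comm_ring_1 \<Rightarrow> int \<Rightarrow> int \<Rightarrow> ((int \<Rightarrow> int) \<Rightarrow> 'a) \<Rightarrow> (int \<Rightarrow> int) \<Rightarrow> 'a" where
  "reflection_op \<beta> x y f w =
     (if signed_perm w
      then f w + \<beta> * (if covering (inv w) x y then f (signed_transpose x y \<circ> w) else 0)
      else 0)"

definition reflection_ops ::
    "'a::comm_ring_1 \<Rightarrow> (int \<times> int) list \<Rightarrow> ((int \<Rightarrow> int) \<Rightarrow> 'a) \<Rightarrow> (int \<Rightarrow> int) \<Rightarrow> 'a" where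
  "reflection_ops \<beta> ps = foldr (\<lambda>(x, y). reflection_op \<beta> x y) ps"

lemma reflection_ops_simps:
  "reflection_ops \<beta> [] f = f"
  "reflection_ops \<beta> ((x, y) # ps) f = reflection_op \<beta> x y (reflection_ops \<beta> ps f)"
  "reflection_ops \<beta> (ps @ qs) f = reflection_ops \<beta> ps (reflection_ops \<beta> qs f)"
  by (simp_all add: reflection_ops_def)

lemma reflection_op_linear:
  "reflection_op \<beta> x y (\<lambda>w. f w + c * g w) = (\<lambda>w. reflection_op \<beta> x y f w + c * reflection_op \<beta> x y g w)"
  by (rule ext) (simp add: reflection_op_def algebra_simps)

lemma reflection_ops_linear:
  "reflection_ops \<beta> ps (\<lambda>w. f w + c * g w) =
    (\<lambda>w. reflection_ops \<beta> ps f w + c * reflection_ops \<beta> ps g w)"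
  by (induction ps) (auto simp: reflection_ops_simps reflection_op_linear)

lemma reflection_ops_delta_id:
  assumes "\<forall>(x, y)\<in>set ps. x < y \<and> x \<noteq> 0 \<and> y \<noteq> 0"
  shows "reflection_ops \<beta> ps (delta id) = delta id"
proof -
  have "reflection_op \<beta> x y (delta id) = delta id" if xy: "x < y" "x \<noteq> 0" "y \<noteq> 0" for x y
  proof
    fix w
    have "\<not> covering (inv w) x y" if "signed_transpose x y \<circ> w = id"
    proof -
      have "w = signed_transpose x y"
        using that signed_transpose_involutory[OF xy(2,3)] by (metis comp_assoc comp_id id_comp)
      then show ?thesis using xy
        by (simp add: covering_def inv_signed_transpose signed_transpose_values)
    qed
    then show "reflection_op \<beta> x y (delta id) w = delta id w"
      using signed_perm_id by (auto simp: reflection_op_def delta_def)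
  qed
  then show ?thesis using assms by (induction ps) (auto simp: reflection_ops_simps)
qed

subsection \<open>Moving a reflection operator past a multiplication\<close>

lemma reflection_eq_comp_cox_genD:
  assumes w: "signed_perm w" and eq: "signed_transpose x y \<circ> w = w \<circ> cox_gen i"
  shows "(w (gen_left i), w (gen_right i)) \<in> {(x, y), (y, x), (- x, - y), (- y, - x)}"
proof (rule signed_transpose_eqD)
  have "signed_transpose (w (gen_left i)) (w (gen_right i)) \<circ> w = signed_transpose x y \<circ> w"
    using eq by (simp add: comp_cox_gen[OF w])
  then show "signed_transpose (w (gen_left i)) (w (gen_right i)) = signed_transpose x y"
    by (metis comp_assoc comp_id signed_perm_bij[OF w] bij_is_surj surj_iff)
  show "w (gen_left i) \<noteq> w (gen_right i)"
    using gen_left_less_gen_right[of i] by (simp add: signed_perm_eq_iff[OF w])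
qed

lemma covering_iff_not_descent:
  assumes w: "signed_perm w" and xy: "x < y" "x \<noteq> 0" "y \<noteq> 0"
    and eq: "signed_transpose x y \<circ> w = w \<circ> cox_gen i"
  shows "covering (inv w) x y \<longleftrightarrow> \<not> descent w i"
proof -
  note inv_w = signed_perm_inv_eq_iff[OF w] signed_perm_minus[OF w]
  from reflection_eq_comp_cox_genD[OF w eq]
  consider "w (gen_left i) = x" "w (gen_right i) = y" | "w (gen_left i) = - y" "w (gen_right i) = - x"
    | "w (gen_left i) = y" "w (gen_right i) = x" | "w (gen_left i) = - x" "w (gen_right i) = - y"
    by auto
  then show ?thesis
  proof cases
    case 1
    then have "inv w x = gen_left i" "inv w y = gen_right i" by (simp_all add: inv_w)
    then have "covering (inv w) x y"
      using covering_adjacent[of "inv w" x y i] signed_perm_inv[OF w] xy(1) by simp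
    then show ?thesis using 1 xy(1) by simp
  next
    case 2
    then have "inv w x = - gen_right i" "inv w y = - gen_left i" by (simp_all add: inv_w)
    then have "covering (inv w) x y"
      using covering_adjacent[of "inv w" x y i] signed_perm_inv[OF w] xy(1) by simp
    then show ?thesis using 2 xy(1) by simp
  next
    case 3
    then have "inv w x = gen_right i" "inv w y = gen_left i" by (simp_all add: inv_w)
    then show ?thesis using 3 xy(1) gen_left_less_gen_right[of i] by (simp add: covering_def)
  next
    case 4
    then have "inv w x = - gen_left i" "inv w y = - gen_right i" by (simp_all add: inv_w)
    then show ?thesis using 4 xy(1) gen_left_less_gen_right[of i] by (simp add: covering_def)
  qed
qed

text \<open>The rankings \<open>\<rho>\<close> and \<open>\<rho>'\<close> differ by an exchange of the neighbours \<open>x\<close> and \<open>y\<close>, and of \<open>-x\<close>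
  and \<open>-y\<close>.\<close>

locale adjacent_exchange =
  fixes \<rho> \<rho>' :: "int \<Rightarrow> int" and x y :: int
  assumes xy: "x < y" "x \<noteq> 0" "y \<noteq> 0" and ranks: "\<rho> x < \<rho> y" "\<rho> (- y) < \<rho> (- x)"
    and exchanged: "\<And>u v. \<rho>' u < \<rho>' v \<longleftrightarrow> \<rho> (signed_transpose x y u) < \<rho> (signed_transpose x y v)"
    and unchanged: "\<And>u v. u \<noteq> 0 \<Longrightarrow> v \<noteq> 0 \<Longrightarrow> (u, v) \<notin> {(x, y), (y, x), (- x, - y), (- y, - x)} \<Longrightarrow>
      \<rho>' u < \<rho>' v \<longleftrightarrow> \<rho> u < \<rho> v"
begin

abbreviation "t \<equiv> signed_transpose x y"

lemma descent_exchanged: "descent (\<rho>' \<circ> w) i \<longleftrightarrow> descent (\<rho> \<circ> (t \<circ> w)) i"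
  by (simp add: exchanged)

lemma descent_rank_iff:
  assumes w: "signed_perm w" and eq: "t \<circ> w = w \<circ> cox_gen i"
  shows "descent (\<rho> \<circ> w) i \<longleftrightarrow> descent w i"
  using reflection_eq_comp_cox_genD[OF w eq] ranks xy(1) by auto

lemma reflection_op_right_mult_equal:
  assumes w: "signed_perm w" and eq: "t \<circ> w = w \<circ> cox_gen i"
  shows "reflection_op \<beta> x y (right_mult \<rho> \<beta> i f) w = right_mult \<rho>' \<beta> i (reflection_op \<beta> x y f) w"
proof -
  let ?s = "cox_gen i"
  note ws = signed_perm_comp[OF w signed_perm_cox_gen[of i]]
  have t_ws: "t \<circ> (w \<circ> ?s) = w"
    using eq by (simp only: comp_assoc[symmetric] comp_cox_gen_cox_gen)
  then have eq': "t \<circ> (w \<circ> ?s) = w \<circ> ?s \<circ> ?s" by (simp only: comp_cox_gen_cox_gen)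
  have desc: "descent (w \<circ> ?s) i \<longleftrightarrow> \<not> descent w i" by (rule descent_comp_cox_gen[OF w])
  have desc': "descent (\<rho>' \<circ> w) i \<longleftrightarrow> \<not> descent w i"
    unfolding descent_exchanged eq descent_rank_iff[OF ws eq'] desc ..
  show ?thesis
    unfolding reflection_op_def right_mult_def eq t_ws comp_cox_gen_cox_gen
      covering_iff_not_descent[OF w xy eq] covering_iff_not_descent[OF ws xy eq'] desc desc'
      descent_rank_iff[OF w eq] descent_rank_iff[OF ws eq']
    using w ws by (cases "descent w i") (simp_all add: algebra_simps del: o_apply)
qed

lemma reflection_op_right_mult_unequal:
  assumes w: "signed_perm w" and ne: "t \<circ> w \<noteq> w \<circ> cox_gen i"
  shows "reflection_op \<beta> x y (right_mult \<rho> \<beta> i f) w = right_mult \<rho>' \<beta> i (reflection_op \<beta> x y f) w"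
proof -
  let ?s = "cox_gen i"
  note ws = signed_perm_comp[OF w signed_perm_cox_gen[of i]]
  note tw = signed_perm_comp[OF signed_perm_signed_transpose[OF xy(2,3)] w]
  have "signed_transpose (w (gen_right i)) (w (gen_left i)) \<noteq> t"
    using ne comp_cox_gen[OF w, of i] by (metis signed_transpose_commute)
  then have "(w (gen_right i), w (gen_left i)) \<notin> {(x, y), (y, x), (- x, - y), (- y, - x)}"
    using signed_transpose_commute[of x y] signed_transpose_uminus[OF xy(2,3)] signed_transpose_uminus[OF xy(3,2)]
    by auto
  then have same: "descent (\<rho>' \<circ> w) i \<longleftrightarrow> descent (\<rho> \<circ> w) i"
    unfolding comp_apply by (intro unchanged) (auto simp: signed_perm_eq_0_iff[OF w])
  have other: "descent (\<rho> \<circ> (t \<circ> w)) i \<longleftrightarrow> descent (\<rho> \<circ> w) i"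
    using descent_exchanged[of w i] same by blast
  show ?thesis
    unfolding reflection_op_def right_mult_def same other comp_assoc
    using w ws tw covering_descent_exchange[OF w xy ne]
    by (cases "descent w i"; cases "descent (t \<circ> w) i"; cases "covering (inv w) x y")
      (simp_all add: algebra_simps comp_assoc del: o_apply)
qed

lemma reflection_op_right_mult:
  "reflection_op \<beta> x y (right_mult \<rho> \<beta> i f) = right_mult \<rho>' \<beta> i (reflection_op \<beta> x y f)"
proof
  fix w
  show "reflection_op \<beta> x y (right_mult \<rho> \<beta> i f) w = right_mult \<rho>' \<beta> i (reflection_op \<beta> x y f) w"
  proof (cases "signed_perm w")
    case True
    then show ?thesis
      using reflection_op_right_mult_equal reflection_op_right_mult_unequal by blast
  qed (simp add: reflection_op_def right_mult_def)
qed

end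

text \<open>Ranks are doubled to make room for the value \<open>k\<close> at an odd rank \<open>c\<close> between its new
  neighbours.\<close>

definition value_rank :: "int \<Rightarrow> int \<Rightarrow> int \<Rightarrow> int" where
  "value_rank k c v = (if v = k then c else if v = - k then - c else 2 * v)"

lemma inj_value_rank:
  assumes "0 < k" "odd c" shows "inj (value_rank k c)"
proof (rule injI)
  fix u v assume "value_rank k c u = value_rank k c v"
  then show "u = v"
    using assms by (auto simp: value_rank_def split: if_splits) presburger+
qed

lemma value_rank_less_iff:
  assumes e: "e = 1 \<or> e = - 1" and t: "t \<noteq> 0"
    and "(u, v) \<notin> {(k, t), (t, k), (- k, - t), (- t, - k)}"
  shows "value_rank k (2 * t + e) u < value_rank k (2 * t + e) v \<longleftrightarrow>
    (if u = k then t else if u = - k then - t else u) < (if v = k then t else if v = - k then - t else v)"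
proof -
  have rank_k: "2 * t + e < 2 * z \<longleftrightarrow> t < z" "2 * z < 2 * t + e \<longleftrightarrow> z < t" if "z \<noteq> t" for z
    using e that by auto
  have rank_minus_k: "- (2 * t + e) < 2 * z \<longleftrightarrow> - t < z" "2 * z < - (2 * t + e) \<longleftrightarrow> z < - t"
    if "z \<noteq> - t" for z
    using e that by auto
  have both: "2 * t + e < - (2 * t + e) \<longleftrightarrow> t < - t" "- (2 * t + e) < 2 * t + e \<longleftrightarrow> - t < t"
    using e t by auto
  consider "u = k" | "u = - k" "u \<noteq> k" | "u \<noteq> k" "u \<noteq> - k" by blast
  then show ?thesis
    using assms(3) rank_k[of u] rank_k[of v] rank_minus_k[of u] rank_minus_k[of v] both
    unfolding value_rank_def by cases (cases "v = k"; cases "v = - k"; simp)+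
qed

lemma value_rank_exchange:
  assumes k: "k \<noteq> 0" "t \<notin> {0, k, - k}" and e: "e = 1 \<or> e = - 1"
  shows "value_rank k (2 * t + e) u < value_rank k (2 * t + e) v \<longleftrightarrow>
    value_rank k (2 * t - e) (signed_transpose k t u) < value_rank k (2 * t - e) (signed_transpose k t v)"
proof -
  let ?t = "signed_transpose k t"
  have t_values: "?t k = t" "?t t = k" "?t (- k) = - t" "?t (- t) = - k"
    using k by (simp_all add: signed_transpose_values)
  have rank_values: "value_rank k c t = 2 * t" "value_rank k c k = c" "value_rank k c (- k) = - c"
    "value_rank k c (- t) = - (2 * t)" for c
    using k by (simp_all add: value_rank_def minus_equation_iff equation_minus_iff)
  have sign: "2 * t + e < 2 * t \<longleftrightarrow> 2 * t < 2 * t - e" "2 * t < 2 * t + e \<longleftrightarrow> 2 * t - e < 2 * t"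
    by linarith+
  consider (bad) "u = k \<and> v = t \<or> u = t \<and> v = k \<or> u = - k \<and> v = - t \<or> u = - t \<and> v = - k"
    | (good) "(u, v) \<notin> {(k, t), (t, k), (- k, - t), (- t, - k)}" by blast
  then show ?thesis
  proof cases
    case bad
    then show ?thesis
      by (elim disjE conjE) (simp_all only: t_values rank_values neg_less_iff_less sign)
  next
    case good
    have place: "(if ?t w = k then t else if ?t w = - k then - t else ?t w) =
        (if w = k then t else if w = - k then - t else w)" for w
      unfolding signed_transpose_def using k
      by (cases "w = k"; cases "w = t"; cases "w = - k"; cases "w = - t") simp_all
    have t_t: "?t (?t w) = w" for w
      using k fun_cong[OF signed_transpose_involutory[of k t], of w] by simp
    have "(?t u, ?t v) \<notin> {(k, t), (t, k), (- k, - t), (- t, - k)}"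
    proof
      assume "(?t u, ?t v) \<in> {(k, t), (t, k), (- k, - t), (- t, - k)}"
      then have "(?t (?t u), ?t (?t v)) \<in> {(?t k, ?t t), (?t t, ?t k), (?t (- k), ?t (- t)), (?t (- t), ?t (- k))}"
        by (elim insertE emptyE) simp_all
      then show False using good unfolding t_t t_values by blast
    qed
    moreover have "2 * t - e = 2 * t + - e" "- e = 1 \<or> - e = - 1" "t \<noteq> 0" using e k(2) by auto
    ultimately show ?thesis
      using value_rank_less_iff[OF e _ good] value_rank_less_iff[of "- e" t "?t u" "?t v" k]
      by (simp only: place not_False_eq_True simp_thms)
  qed
qed

lemma value_rank_unchanged:
  assumes "t \<noteq> 0" and e: "e = 1 \<or> e = - 1"
    and uv: "(u, v) \<notin> {(k, t), (t, k), (- k, - t), (- t, - k)}"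
  shows "value_rank k (2 * t + e) u < value_rank k (2 * t + e) v \<longleftrightarrow>
    value_rank k (2 * t - e) u < value_rank k (2 * t - e) v"
proof -
  have "- e = 1 \<or> - e = - 1" using e by auto
  then show ?thesis
    using value_rank_less_iff[OF e assms(1) uv] value_rank_less_iff[OF _ assms(1) uv, of "- e"]
    by simp
qed

lemma adjacent_exchange_up:
  assumes "0 < k" "k < t"
  shows "adjacent_exchange (value_rank k (2 * t - 1)) (value_rank k (2 * t + 1)) k t"
proof
  show "value_rank k (2 * t + 1) u < value_rank k (2 * t + 1) v \<longleftrightarrow>
      value_rank k (2 * t - 1) (signed_transpose k t u) < value_rank k (2 * t - 1) (signed_transpose k t v)" for u v
    by (rule value_rank_exchange) (use assms in auto)
  show "value_rank k (2 * t + 1) u < value_rank k (2 * t + 1) v \<longleftrightarrow>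
      value_rank k (2 * t - 1) u < value_rank k (2 * t - 1) v"
    if "(u, v) \<notin> {(k, t), (t, k), (- k, - t), (- t, - k)}" for u v
    using value_rank_unchanged[of t 1 u v k] that assms by simp
qed (use assms in \<open>auto simp: value_rank_def\<close>)

lemma adjacent_exchange_down:
  assumes "0 < k" "t < k" "t \<noteq> 0" "t \<noteq> - k"
  shows "adjacent_exchange (value_rank k (2 * t + 1)) (value_rank k (2 * t - 1)) t k"
proof
  show "value_rank k (2 * t - 1) u < value_rank k (2 * t - 1) v \<longleftrightarrow>
      value_rank k (2 * t + 1) (signed_transpose t k u) < value_rank k (2 * t + 1) (signed_transpose t k v)" for u v
    using value_rank_exchange[of k t "- 1" u v] assms
    by (simp add: signed_transpose_commute[of t k])
  show "value_rank k (2 * t - 1) u < value_rank k (2 * t - 1) v \<longleftrightarrow>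
      value_rank k (2 * t + 1) u < value_rank k (2 * t + 1) v"
    if "(u, v) \<notin> {(t, k), (k, t), (- t, - k), (- k, - t)}" for u v
    using value_rank_unchanged[of t "- 1" u v k] that assms by auto
qed (use assms in \<open>auto simp: value_rank_def\<close>)

lemma adjacent_exchange_sign:
  assumes "0 < k"
  shows "adjacent_exchange (value_rank k 1) (value_rank k (- 1)) (- k) k"
proof
  show "value_rank k (- 1) u < value_rank k (- 1) v \<longleftrightarrow>
      value_rank k 1 (signed_transpose (- k) k u) < value_rank k 1 (signed_transpose (- k) k v)" for u v
    using assms by (auto simp: value_rank_def signed_transpose_def)
  show "value_rank k (- 1) u < value_rank k (- 1) v \<longleftrightarrow> value_rank k 1 u < value_rank k 1 v"
    if "(u, v) \<notin> {(- k, k), (k, - k), (- (- k), - k), (- k, - (- k))}" "u \<noteq> 0" "v \<noteq> 0" for u v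
    using that assms by (auto simp: value_rank_def)
qed (use assms in \<open>auto simp: value_rank_def\<close>)

lemma right_mult_cong:
  assumes "\<And>u v. u \<noteq> 0 \<Longrightarrow> v \<noteq> 0 \<Longrightarrow> \<rho> u < \<rho> v \<longleftrightarrow> \<rho>' u < \<rho>' v"
  shows "right_mult \<rho> \<beta> i f = right_mult \<rho>' \<beta> i f"
proof
  fix w
  show "right_mult \<rho> \<beta> i f w = right_mult \<rho>' \<beta> i f w"
    using assms[of "w (gen_right i)" "w (gen_left i)"]
    by (simp add: right_mult_def signed_perm_eq_0_iff)
qed

lemma right_mult_value_rank_top:
  assumes "0 < k" "c = 2 * k - 1 \<or> c = 2 * k + 1"
  shows "right_mult (value_rank k c) \<beta> i f = u_mult \<beta> i f"
  by (rule right_mult_cong) (use assms in \<open>auto simp: value_rank_def\<close>)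

lemma right_mult_value_rank_bottom:
  assumes "0 < k"
  shows "right_mult (value_rank k (- 2 * k + 1)) \<beta> i f = right_mult (value_rank k (- 2 * k - 1)) \<beta> i f"
  by (rule right_mult_cong) (use assms in \<open>auto simp: value_rank_def\<close>)

definition moves_rank :: "'a::comm_ring_1 \<Rightarrow> int \<Rightarrow> int \<Rightarrow> (int \<times> int) list \<Rightarrow> int \<Rightarrow> bool" where
  "moves_rank \<beta> k c ps c' \<longleftrightarrow> (\<forall>i f. reflection_ops \<beta> ps (right_mult (value_rank k c) \<beta> i f) =
     right_mult (value_rank k c') \<beta> i (reflection_ops \<beta> ps f))"

lemma moves_rank_append:
  "moves_rank \<beta> k c' ps c'' \<Longrightarrow> moves_rank \<beta> k c qs c' \<Longrightarrow> moves_rank \<beta> k c (ps @ qs) c''"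
  by (simp add: moves_rank_def reflection_ops_simps)

lemma moves_rank_Nil: "moves_rank \<beta> k c [] c"
  by (simp add: moves_rank_def reflection_ops_simps)

lemma moves_rank_single:
  "adjacent_exchange (value_rank k c) (value_rank k c') x y \<Longrightarrow> moves_rank \<beta> k c [(x, y)] c'"
  by (simp add: moves_rank_def reflection_ops_simps adjacent_exchange.reflection_op_right_mult)

definition right_reflections :: "int \<Rightarrow> nat \<Rightarrow> (int \<times> int) list" where
  "right_reflections k m = map (\<lambda>t. (k, t)) (rev [k + 1..int m])"

definition left_ends :: "int \<Rightarrow> nat \<Rightarrow> int list" where
  "left_ends k m = [- int m..- k - 1] @ [- k + 1..- 1] @ [- k] @ [1..k - 1]"

definition left_reflections :: "int \<Rightarrow> nat \<Rightarrow> (int \<times> int) list" where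
  "left_reflections k m = map (\<lambda>t. (t, k)) (left_ends k m)"

lemma set_left_ends: "0 < k \<Longrightarrow> k \<le> int m \<Longrightarrow> set (left_ends k m) = {- int m..k - 1} - {0}"
  by (auto simp: left_ends_def)

lemma moves_rank_right_reflections:
  assumes "0 < k" "k \<le> int m"
  shows "moves_rank \<beta> k (2 * k + 1) (right_reflections k m) (2 * int m + 1)"
proof -
  have "moves_rank \<beta> k (2 * k + 1) (map (\<lambda>t. (k, t)) (rev [k + 1..k + int n])) (2 * (k + int n) + 1)" for n
  proof (induction n)
    case 0
    show ?case by (simp add: moves_rank_Nil)
  next
    case (Suc n)
    let ?t = "k + int (Suc n)"
    have "moves_rank \<beta> k (2 * (k + int n) + 1) [(k, ?t)] (2 * ?t + 1)"
      using adjacent_exchange_up[of k ?t] assms(1)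
      by (intro moves_rank_single) (simp add: algebra_simps)
    then have "moves_rank \<beta> k (2 * k + 1) ([(k, ?t)] @ map (\<lambda>t. (k, t)) (rev [k + 1..k + int n])) (2 * ?t + 1)"
      using Suc by (rule moves_rank_append)
    moreover have "[k + 1..?t] = [k + 1..k + int n] @ [?t]"
      using upto_rec2[of "k + 1" ?t] by simp
    ultimately show ?case by simp
  qed
  from this[of "nat (int m - k)"] show ?thesis using assms(2) by (simp add: right_reflections_def)
qed

lemma moves_rank_down:
  assumes "0 < k" "a \<le> b + 1" "\<And>t. a \<le> t \<Longrightarrow> t \<le> b \<Longrightarrow> t < k \<and> t \<noteq> 0 \<and> t \<noteq> - k"
  shows "moves_rank \<beta> k (2 * b + 1) (map (\<lambda>t. (t, k)) [a..b]) (2 * a - 1)"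
  using assms(2,3)
proof (induction "nat (b - a + 1)" arbitrary: a)
  case 0
  then have a: "a = b + 1" by simp
  show ?case using moves_rank_Nil[of \<beta> k "2 * b + 1"] by (simp add: a add.commute)
next
  case (Suc n)
  have a: "a \<le> b" using Suc.hyps(2) by simp
  have "moves_rank \<beta> k (2 * b + 1) (map (\<lambda>t. (t, k)) [a + 1..b]) (2 * (a + 1) - 1)"
    using Suc.hyps(2) Suc.prems a by (intro Suc.hyps(1)) auto
  moreover have "moves_rank \<beta> k (2 * (a + 1) - 1) [(a, k)] (2 * a - 1)"
    using adjacent_exchange_down[of k a] Suc.prems(2)[of a] a assms(1)
    by (intro moves_rank_single) (simp add: algebra_simps)
  ultimately have "moves_rank \<beta> k (2 * b + 1) ([(a, k)] @ map (\<lambda>t. (t, k)) [a + 1..b]) (2 * a - 1)"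
    by (intro moves_rank_append)
  then show ?case using a by (simp add: upto_rec1)
qed

lemma moves_rank_left_reflections:
  fixes \<beta> :: "'a::comm_ring_1"
  assumes "0 < k" "k \<le> int m"
  shows "moves_rank \<beta> k (2 * k - 1) (left_reflections k m) (- 2 * int m - 1)"
proof -
  have positive: "moves_rank \<beta> k (2 * k - 1) (map (\<lambda>t. (t, k)) [1..k - 1]) 1"
    using moves_rank_down[of k 1 "k - 1" \<beta>] assms by (simp add: algebra_simps)
  have sign: "moves_rank \<beta> k 1 [(- k, k)] (- 1)"
    by (intro moves_rank_single adjacent_exchange_sign assms)
  have small: "moves_rank \<beta> k (- 1) (map (\<lambda>t. (t, k)) [- k + 1..- 1]) (- 2 * k + 1)"
    using moves_rank_down[of k "- k + 1" "- 1" \<beta>] assms by (simp add: algebra_simps)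
  have ranks: "2 * (- k - 1) + 1 = - 2 * k - 1" "2 * - int m - 1 = - 2 * int m - 1" by simp_all
  have "moves_rank \<beta> k (- 2 * k - 1) (map (\<lambda>t. (t, k)) [- int m..- k - 1]) (- 2 * int m - 1)"
    by (rule moves_rank_down[of k "- int m" "- k - 1" \<beta>, unfolded ranks]) (use assms in auto)
  then have large: "moves_rank \<beta> k (- 2 * k + 1) (map (\<lambda>t. (t, k)) [- int m..- k - 1]) (- 2 * int m - 1)"
    using right_mult_value_rank_bottom[OF assms(1)] unfolding moves_rank_def by metis
  have "moves_rank \<beta> k (2 * k - 1) (map (\<lambda>t. (t, k)) [- int m..- k - 1] @
      map (\<lambda>t. (t, k)) [- k + 1..- 1] @ [(- k, k)] @ map (\<lambda>t. (t, k)) [1..k - 1]) (- 2 * int m - 1)"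
    by (intro moves_rank_append[OF large] moves_rank_append[OF small] moves_rank_append[OF sign] positive)
  then show ?thesis by (simp add: left_reflections_def left_ends_def)
qed

lemma reflection_ops_palindromic_factor:
  assumes "moves_rank \<beta> k c ps c'" "0 < k" "c = 2 * k - 1 \<or> c = 2 * k + 1"
  shows "reflection_ops \<beta> ps (palindromic_factor (u_mult \<beta>) x n f) =
    palindromic_factor (right_mult (value_rank k c') \<beta>) x n (reflection_ops \<beta> ps f)"
proof -
  have step: "reflection_ops \<beta> ps (one_plus (u_mult \<beta>) x i f) =
      one_plus (right_mult (value_rank k c') \<beta>) x i (reflection_ops \<beta> ps f)" for i f
    using assms(1)
    unfolding one_plus_def[abs_def] reflection_ops_linear moves_rank_def
      right_mult_value_rank_top[OF assms(2,3)] by simp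
  have "reflection_ops \<beta> ps (fold (one_plus (u_mult \<beta>) x) L f) =
      fold (one_plus (right_mult (value_rank k c') \<beta>) x) L (reflection_ops \<beta> ps f)" for L
    by (induction L arbitrary: f) (simp_all add: step)
  then show ?thesis by (simp only: palindromic_factor_def)
qed

subsection \<open>Comparison of the two families of reflections\<close>

lemma descent_extreme_ranks:
  assumes w: "w \<in> signed_perms m" and i: "i < m" and k: "0 < k" "k \<le> int m"
  shows "inv w k \<in> {gen_left i, - gen_right i} \<Longrightarrow>
      descent (value_rank k (2 * int m + 1) \<circ> w) i \<and> \<not> descent (value_rank k (- 2 * int m - 1) \<circ> w) i"
    and "inv w k \<in> {gen_right i, - gen_left i} \<Longrightarrow>
      \<not> descent (value_rank k (2 * int m + 1) \<circ> w) i \<and> descent (value_rank k (- 2 * int m - 1) \<circ> w) i"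
    and "inv w k \<notin> {gen_left i, gen_right i, - gen_left i, - gen_right i} \<Longrightarrow>
      descent (value_rank k (2 * int m + 1) \<circ> w) i \<longleftrightarrow> descent (value_rank k (- 2 * int m - 1) \<circ> w) i"
proof -
  note sp = signed_permI[OF w]
  define a b where "a = w (gen_left i)" and "b = w (gen_right i)"
  have ne: "a \<noteq> b"
    using signed_perm_eq_iff[OF sp] gen_left_less_gen_right[of i] by (auto simp: a_def b_def)
  have le: "\<bar>a\<bar> \<le> int m" "\<bar>b\<bar> \<le> int m"
    unfolding a_def b_def
    by (rule signed_perms_abs_le[OF w], use i in \<open>simp add: gen_left_def gen_right_def\<close>)+
  have inv: "inv w k = gen_left i \<longleftrightarrow> a = k" "inv w k = gen_right i \<longleftrightarrow> b = k"
    "inv w k = - gen_left i \<longleftrightarrow> a = - k" "inv w k = - gen_right i \<longleftrightarrow> b = - k"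
    by (auto simp: signed_perm_inv_eq_iff[OF sp] signed_perm_minus[OF sp] a_def b_def)
  show "inv w k \<in> {gen_left i, - gen_right i} \<Longrightarrow>
      descent (value_rank k (2 * int m + 1) \<circ> w) i \<and> \<not> descent (value_rank k (- 2 * int m - 1) \<circ> w) i"
    "inv w k \<in> {gen_right i, - gen_left i} \<Longrightarrow>
      \<not> descent (value_rank k (2 * int m + 1) \<circ> w) i \<and> descent (value_rank k (- 2 * int m - 1) \<circ> w) i"
    "inv w k \<notin> {gen_left i, gen_right i, - gen_left i, - gen_right i} \<Longrightarrow>
      descent (value_rank k (2 * int m + 1) \<circ> w) i \<longleftrightarrow> descent (value_rank k (- 2 * int m - 1) \<circ> w) i"
    unfolding insert_iff inv comp_apply a_def[symmetric] b_def[symmetric]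
    using ne le k by (auto simp: value_rank_def)
qed

locale extreme_ranks =
  fixes m :: nat and k :: int and \<beta> :: "'a::comm_ring_1"
  assumes k: "0 < k" "k \<le> int m"
begin

abbreviation "mult_top \<equiv> right_mult (value_rank k (2 * int m + 1)) \<beta>"
abbreviation "mult_bottom \<equiv> right_mult (value_rank k (- 2 * int m - 1)) \<beta>"

lemma weighted_one_plus:
  assumes w: "w \<in> signed_perms m" and i: "i < m"
    and y: "y (gen_right i) = (1 + \<beta> * x) * y (gen_left i)" "y (- gen_left i) = (1 + \<beta> * x) * y (- gen_right i)"
  shows "y (inv w k) * one_plus mult_top x i f w =
    one_plus mult_bottom x i (\<lambda>v. y (cox_gen i (inv v k)) * f v) w"
proof -
  note sp = signed_permI[OF w]
  have inv_ws: "inv (w \<circ> cox_gen i) k = cox_gen i (inv w k)" by (simp add: inv_comp_cox_gen[OF sp])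
  have minus: "cox_gen i (- v) = - cox_gen i v" for v
    by (rule signed_perm_minus[OF signed_perm_cox_gen])
  note unfold = one_plus_def right_mult_def inv_ws cox_gen_cox_gen
  consider "inv w k \<in> {gen_left i, - gen_right i}" | "inv w k \<in> {gen_right i, - gen_left i}"
    | "inv w k \<notin> {gen_left i, gen_right i, - gen_left i, - gen_right i}" by blast
  then show ?thesis
  proof cases
    case 1
    then have "y (cox_gen i (inv w k)) = (1 + \<beta> * x) * y (inv w k)"
      using y by (auto simp: minus cox_gen_gen_left cox_gen_gen_right)
    then show ?thesis
      unfolding unfold using descent_extreme_ranks(1)[OF w i k 1] sp
      by (simp add: algebra_simps del: o_apply)
  next
    case 2
    then have "y (inv w k) = (1 + \<beta> * x) * y (cox_gen i (inv w k))"
      using y by (auto simp: minus cox_gen_gen_left cox_gen_gen_right)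
    then show ?thesis
      unfolding unfold using descent_extreme_ranks(2)[OF w i k 2] sp
      by (simp add: algebra_simps del: o_apply)
  next
    case 3
    then have "cox_gen i (inv w k) = inv w k" by (auto simp: cox_gen_apply)
    then show ?thesis
      unfolding unfold using descent_extreme_ranks(3)[OF w i k 3] sp
      by (simp add: algebra_simps del: o_apply)
  qed
qed

lemma one_plus_one_plus:
  assumes "odd c"
  shows "one_plus (right_mult (value_rank k c) \<beta>) x i (one_plus (right_mult (value_rank k c) \<beta>) x i f) =
    one_plus (right_mult (value_rank k c) \<beta>) (x + x + \<beta> * x * x) i f"
proof
  fix w
  note square = right_mult_right_mult[OF inj_value_rank[OF k(1) assms], of \<beta> i f]
  have "one_plus (right_mult (value_rank k c) \<beta>) x i f = (\<lambda>w. f w + x * right_mult (value_rank k c) \<beta> i f w)"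
    by (rule ext) (simp add: one_plus_def)
  then show "one_plus (right_mult (value_rank k c) \<beta>) x i (one_plus (right_mult (value_rank k c) \<beta>) x i f) w =
      one_plus (right_mult (value_rank k c) \<beta>) (x + x + \<beta> * x * x) i f w"
    by (simp add: one_plus_def right_mult_add right_mult_scale square algebra_simps)
qed

text \<open>The weight records the equivariant parameter of the value at position \<open>k\<close>. All parameters
  are \<open>0\<close> except one, which the factors of the generating function move from \<open>n\<close> to \<open>- n\<close>.\<close>

definition weight :: "'a \<Rightarrow> int \<Rightarrow> int \<Rightarrow> 'a" where
  "weight x p v = (if v = p then (1 + \<beta> * x) * (1 + \<beta> * x) else if v = - p then 1 else 1 + \<beta> * x)"

lemma weight_cox_gen: "weight x p (cox_gen i v) = weight x (cox_gen i p) v"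
proof -
  have "cox_gen i v = u \<longleftrightarrow> v = cox_gen i u" for u using cox_gen_cox_gen by metis
  then show ?thesis by (simp add: weight_def signed_perm_minus[OF signed_perm_cox_gen])
qed

lemma weighted_one_plus_weight:
  assumes "w \<in> signed_perms m" "i < m" "0 < i" "p = int i + 1 \<or> p = - int i"
  shows "weight x p (inv w k) * one_plus mult_top x i f w =
    one_plus mult_bottom x i (\<lambda>v. weight x (cox_gen i p) (inv v k) * f v) w"
  unfolding weight_cox_gen[symmetric]
  by (rule weighted_one_plus[OF assms(1,2)])
     (use assms(3,4) in \<open>auto simp: weight_def gen_left_def gen_right_def\<close>)

lemma weighted_palindromic_factor:
  "1 \<le> n \<Longrightarrow> n \<le> m \<Longrightarrow> w \<in> signed_perms m \<Longrightarrow>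
    weight x (int n) (inv w k) * palindromic_factor mult_top x n f w =
    palindromic_factor mult_bottom x n (\<lambda>v. weight x (- int n) (inv v k) * f v) w"
proof (induction n arbitrary: f w rule: nat_induct_at_least)
  case base
  let ?x = "x + x + \<beta> * x * x"
  have "weight x 1 (inv w k) * one_plus mult_top ?x 0 f w =
      one_plus mult_bottom ?x 0 (\<lambda>v. weight x 1 (cox_gen 0 (inv v k)) * f v) w"
    using base.prems
    by (intro weighted_one_plus) (simp_all add: gen_left_def gen_right_def weight_def algebra_simps)
  then show ?case
    by (simp add: palindromic_factor_Suc palindromic_factor_0 one_plus_one_plus weight_cox_gen cox_gen_values)
next
  case (Suc n)
  have n: "n < m" "0 < n" using Suc by auto
  have moved: "cox_gen n (int n + 1) = int n" "cox_gen n (- int n) = - int n - 1"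
    using n by (auto simp: cox_gen_apply gen_left_def gen_right_def)
  let ?g = "palindromic_factor mult_top x n (one_plus mult_top x n f)"
  have local: "local_on (signed_perms m) (one_plus mult_bottom x n)"
    "local_on (signed_perms m) (palindromic_factor mult_bottom x n)"
    by (intro local_on_one_plus local_on_palindromic_factor local_on_right_mult)+
  have "weight x (int n + 1) (inv w k) * one_plus mult_top x n ?g w
      = one_plus mult_bottom x n (\<lambda>v. weight x (int n) (inv v k) * ?g v) w"
    using weighted_one_plus_weight[OF Suc.prems(2) n, of "int n + 1" x ?g] by (simp add: moved)
  also have "\<dots> = one_plus mult_bottom x n (palindromic_factor mult_bottom x n
      (\<lambda>v. weight x (- int n) (inv v k) * one_plus mult_top x n f v)) w"
    by (rule local_onD[OF local(1) _ Suc.prems(2)]) (use Suc.IH n in simp)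
  also have "\<dots> = one_plus mult_bottom x n (palindromic_factor mult_bottom x n
      (one_plus mult_bottom x n (\<lambda>v. weight x (- int n - 1) (inv v k) * f v))) w"
  proof (rule local_onD[OF local(1) local_onD[OF local(2)] Suc.prems(2)])
    fix v assume "v \<in> signed_perms m"
    then show "weight x (- int n) (inv v k) * one_plus mult_top x n f v
        = one_plus mult_bottom x n (\<lambda>v. weight x (- int n - 1) (inv v k) * f v) v"
      using weighted_one_plus_weight[of v n "- int n" x f] n by (simp add: moved)
  qed
  finally have step: "weight x (int n + 1) (inv w k) * one_plus mult_top x n ?g w
      = one_plus mult_bottom x n (palindromic_factor mult_bottom x n
          (one_plus mult_bottom x n (\<lambda>v. weight x (- int n - 1) (inv v k) * f v))) w" .
  have "int (Suc n) = int n + 1" "- int (Suc n) = - int n - 1" by simp_all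
  then show ?case using step by (simp only: palindromic_factor_Suc)
qed

end

lemma palindromic_factor_extreme_ranks:
  fixes \<beta> :: "'a::idom"
  assumes kq: "0 < k" "k \<le> int q" and x: "1 + \<beta> * x \<noteq> 0" and w: "w \<in> signed_perms q"
  shows "palindromic_factor (right_mult (value_rank k (2 * int (Suc q) + 1)) \<beta>) x (Suc q) f w =
    palindromic_factor (right_mult (value_rank k (- 2 * int (Suc q) - 1)) \<beta>) x (Suc q) f w"
proof -
  interpret extreme_ranks "Suc q" k \<beta> by unfold_locales (use kq in auto)
  have weight: "weight x p (inv v k) = 1 + \<beta> * x"
    if "v \<in> signed_perms q" "\<bar>p\<bar> = int (Suc q)" for v p
    using signed_perms_abs_le[OF signed_perms_inv[OF that(1)], of k] kq that(2)
    by (auto simp: weight_def abs_if split: if_splits)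
  have "(1 + \<beta> * x) * palindromic_factor mult_top x (Suc q) f w =
      weight x (int (Suc q)) (inv w k) * palindromic_factor mult_top x (Suc q) f w"
    using weight[OF w, of "int (Suc q)"] by simp
  also have "\<dots> = palindromic_factor mult_bottom x (Suc q) (\<lambda>v. weight x (- int (Suc q)) (inv v k) * f v) w"
    using signed_perms_mono[OF _ w, of "Suc q"] by (intro weighted_palindromic_factor) auto
  also have "\<dots> = palindromic_factor mult_bottom x (Suc q) (\<lambda>v. (1 + \<beta> * x) * f v) w"
    by (rule local_onD[OF local_on_palindromic_factor[OF local_on_right_mult] _ w]) (use weight in simp)
  also have "\<dots> = (1 + \<beta> * x) * palindromic_factor mult_bottom x (Suc q) f w"
  proof -
    have "one_plus mult_bottom x i (\<lambda>v. c * h v) = (\<lambda>v. c * one_plus mult_bottom x i h v)" for c h i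
      by (rule ext) (simp add: one_plus_def right_mult_scale algebra_simps)
    then have "fold (one_plus mult_bottom x) L (\<lambda>v. c * h v) = (\<lambda>v. c * fold (one_plus mult_bottom x) L h v)" for c L h
      by (induction L arbitrary: h) simp_all
    then show ?thesis by (simp only: palindromic_factor_def)
  qed
  finally show ?thesis using x by simp
qed

definition satisfies_transition ::
    "'a::comm_ring_1 \<Rightarrow> int \<Rightarrow> nat \<Rightarrow> ((int \<Rightarrow> int) \<Rightarrow> 'a) \<Rightarrow> bool" where
  "satisfies_transition \<beta> k q f \<longleftrightarrow>
     (\<forall>w\<in>signed_perms q. reflection_ops \<beta> (right_reflections k (Suc q)) f w =
        reflection_ops \<beta> (left_reflections k (Suc q)) f w)"

lemma satisfies_transition_delta_id:
  assumes "0 < k" "k \<le> int q" shows "satisfies_transition \<beta> k q (delta id)"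
proof -
  have "\<forall>(x, y)\<in>set (right_reflections k (Suc q)). x < y \<and> x \<noteq> 0 \<and> y \<noteq> 0"
    "\<forall>(x, y)\<in>set (left_reflections k (Suc q)). x < y \<and> x \<noteq> 0 \<and> y \<noteq> 0"
    using assms set_left_ends[of k "Suc q"]
    by (auto simp: right_reflections_def left_reflections_def)
  then show ?thesis by (simp add: satisfies_transition_def reflection_ops_delta_id)
qed

lemma satisfies_transition_palindromic_factor:
  fixes \<beta> :: "'a::idom"
  assumes k: "0 < k" "k \<le> int q" and x: "1 + \<beta> * x \<noteq> 0" and f: "satisfies_transition \<beta> k q f"
  shows "satisfies_transition \<beta> k q (palindromic_factor (u_mult \<beta>) x (Suc q) f)"
  unfolding satisfies_transition_def
proof
  fix w
  assume w: "w \<in> signed_perms q"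
  let ?R = "right_reflections k (Suc q)" and ?L = "left_reflections k (Suc q)" and ?m = "int (Suc q)"
  let ?factor = "\<lambda>c. palindromic_factor (right_mult (value_rank k c) \<beta>) x (Suc q)"
  have km: "k \<le> ?m" using k by simp
  have "reflection_ops \<beta> ?R (palindromic_factor (u_mult \<beta>) x (Suc q) f) w
      = ?factor (2 * ?m + 1) (reflection_ops \<beta> ?R f) w"
    by (subst reflection_ops_palindromic_factor[OF moves_rank_right_reflections[OF k(1) km] k(1)]) simp_all
  also have "\<dots> = ?factor (- 2 * ?m - 1) (reflection_ops \<beta> ?R f) w"
    by (rule palindromic_factor_extreme_ranks[OF k x w])
  also have "\<dots> = ?factor (- 2 * ?m - 1) (reflection_ops \<beta> ?L f) w"
    by (rule local_onD[OF local_on_palindromic_factor[OF local_on_right_mult] _ w])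
       (use f in \<open>simp add: satisfies_transition_def\<close>)
  also have "\<dots> = reflection_ops \<beta> ?L (palindromic_factor (u_mult \<beta>) x (Suc q) f) w"
    by (subst reflection_ops_palindromic_factor[OF moves_rank_left_reflections[OF k(1) km] k(1)]) simp_all
  finally show "reflection_ops \<beta> ?R (palindromic_factor (u_mult \<beta>) x (Suc q) f) w
      = reflection_ops \<beta> ?L (palindromic_factor (u_mult \<beta>) x (Suc q) f) w" .
qed

lemma satisfies_transition_gen_fun:
  assumes "0 < k" "k \<le> int q" shows "satisfies_transition beta_x k q (gen_fun (Suc q) N)"
proof (induction N)
  case 0
  then show ?case using satisfies_transition_delta_id[OF assms] by (simp add: gen_fun_0)
next
  case (Suc N)
  have "Poly_Mapping.lookup (1 + beta_x * x_var (Suc N)) 0 \<noteq> 0"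
    by (simp add: lookup_add lookup_beta_x_mult x_var_def lookup_single when_def single_zero)
       (metis One_nat_def lookup_single_eq lookup_zero zero_neq_one)
  then have "1 + beta_x * x_var (Suc N) \<noteq> 0" by (metis lookup_zero)
  then show ?case
    unfolding gen_fun_Suc by (rule satisfies_transition_palindromic_factor[OF assms _ Suc])
qed

section \<open>Reduction of vexillary permutations\<close>

text \<open>Apart from a complete bipartite set of inversions between positive entries, the bi-infinite
  sequence \<open>\<dots> g(-1) g(0) g(1) \<dots>\<close> avoids the pattern 2143: the inversions \<open>(p, q)\<close> and
  \<open>(- q', - p')\<close> form this pattern iff \<open>0 < p + p'\<close> and \<open>0 < g q + g q'\<close>.\<close>

definition vexillary_inversions :: "(int \<Rightarrow> int) \<Rightarrow> bool" where
  "vexillary_inversions g \<longleftrightarrow>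
     (\<forall>(p, q)\<in>inversions g. \<forall>(p', q')\<in>inversions g. 0 < p + p' \<and> 0 < g q + g q' \<longrightarrow>
        0 < p \<and> 0 < g q \<and> p < q' \<and> g q' < g p)"

lemma vexillary_inversionsI:
  assumes "\<And>p q p' q'. p < q \<Longrightarrow> g q < g p \<Longrightarrow> p' < q' \<Longrightarrow> g q' < g p' \<Longrightarrow> 0 < p + p' \<Longrightarrow>
    0 < g q + g q' \<Longrightarrow> 0 < p \<and> 0 < g q \<and> p < q' \<and> g q' < g p"
  shows "vexillary_inversions g"
  unfolding vexillary_inversions_def inversions_def using assms by clarify blast

lemma vexillary_inversionsD:
  assumes "vexillary_inversions g" "p < q" "g q < g p" "p' < q'" "g q' < g p'" "0 < p + p'" "0 < g q + g q'"
  shows "0 < p" "0 < g q" "p < q'" "g q' < g p"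
proof -
  have "(p, q) \<in> inversions g" "(p', q') \<in> inversions g"
    using assms(2-5) by (simp_all add: inversions_def)
  then have "0 < p \<and> 0 < g q \<and> p < q' \<and> g q' < g p"
    using assms(1,6,7) unfolding vexillary_inversions_def by blast
  then show "0 < p" "0 < g q" "p < q'" "g q' < g p" by blast+
qed

lemma vexillary_inversions_inv:
  assumes "signed_perm g" "vexillary_inversions g" shows "vexillary_inversions (inv g)"
proof (rule vexillary_inversionsI)
  fix p q p' q'
  assume h: "p < q" "inv g q < inv g p" "p' < q'" "inv g q' < inv g p'" "0 < p + p'" "0 < inv g q + inv g q'"
  note apply_inv = signed_perm_apply_inv[OF assms(1)]
  have "0 < inv g q \<and> 0 < g (inv g p) \<and> inv g q < inv g p' \<and> g (inv g p') < g (inv g q)"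
    using vexillary_inversionsD[OF assms(2), of "inv g q" "inv g p" "inv g q'" "inv g p'"] h
    by (simp add: apply_inv)
  moreover have "inv g q' < inv g p" "g (inv g p) < g (inv g q')"
    using vexillary_inversionsD(3,4)[OF assms(2), of "inv g q'" "inv g p'" "inv g q" "inv g p"] h
    by (simp_all add: apply_inv add.commute)
  ultimately show "0 < p \<and> 0 < inv g q \<and> p < q' \<and> inv g q' < inv g p"
    by (simp add: apply_inv)
qed

lemma vexillary_inversions_no_negative_before:
  assumes "signed_perm g" "vexillary_inversions g" "0 < l" "g l < 0" "l < p" "p < q" "g q < g p" "0 < g q"
  shows False
proof (cases "0 < g q + g l")
  case True
  then show ?thesis
    using vexillary_inversionsD(1)[OF assms(2), of "- l" l p q] assms signed_perm_minus[OF assms(1)]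
    by simp
next
  case False
  have "g l \<noteq> - g q" using signed_perm_eq_minus_iff[OF assms(1)] assms by auto
  then have "g q < g (- l)" using False signed_perm_minus[OF assms(1)] by simp
  then show ?thesis
    using vexillary_inversionsD(1)[OF assms(2), of "- l" q p q] assms by simp
qed

definition lower_after :: "int \<Rightarrow> (int \<Rightarrow> int) \<Rightarrow> int set" where
  "lower_after r h = {j. r < j \<and> h j < h r}"

lemma finite_lower_after: assumes "h \<in> signed_perms m" shows "finite (lower_after r h)"
proof (rule finite_subset)
  show "lower_after r h \<subseteq> {r<..int m}"
    using inversion_bounds(2)[OF assms] by (auto simp: lower_after_def inversions_def)
qed simp

definition same_gen_fun :: "nat \<Rightarrow> (int \<Rightarrow> int) \<Rightarrow> (int \<Rightarrow> int) \<Rightarrow> bool" where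
  "same_gen_fun m g h \<longleftrightarrow> (\<forall>N. gen_fun m N (inv g) = gen_fun m N (inv h))"

lemma same_gen_fun_mono:
  assumes "same_gen_fun n g h" "n \<le> m" "g \<in> signed_perms n" "h \<in> signed_perms n"
  shows "same_gen_fun m g h"
  using assms gen_fun_stable[OF assms(2)] signed_perms_inv by (simp add: same_gen_fun_def)

definition transition_step :: "nat \<Rightarrow> int \<Rightarrow> (int \<Rightarrow> int) \<Rightarrow> (int \<Rightarrow> int) \<Rightarrow> bool" where
  "transition_step n r g h \<longleftrightarrow> h \<in> signed_perms (Suc n) \<and> vexillary_inversions h \<and>
     strict_mono_on {r<..} h \<and> card (lower_after r h) < card (lower_after r g) \<and>
     same_gen_fun (Suc n) g h"

subsection \<open>Evaluation of the transition equation\<close>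

lemma reflection_ops_no_covering:
  assumes "signed_perm w" "\<forall>(x, y)\<in>set ps. \<not> covering (inv w) x y"
  shows "reflection_ops \<beta> ps f w = f w"
  using assms(2)
proof (induction ps)
  case (Cons p ps)
  then show ?case using assms(1) by (cases p) (simp add: reflection_ops_simps reflection_op_def)
qed (simp add: reflection_ops_simps)

lemma reflection_ops_one_covering:
  assumes g: "signed_perm g" and xy: "x \<noteq> 0" "y \<noteq> 0" "covering g x y"
    and other: "\<forall>(x', y')\<in>set ps \<union> set qs. \<not> covering g x' y'"
    and later: "\<forall>(x', y')\<in>set qs. \<not> covering (g \<circ> signed_transpose x y) x' y'"
  shows "reflection_ops \<beta> (ps @ (x, y) # qs) f (inv g) =
    f (inv g) + \<beta> * f (inv (g \<circ> signed_transpose x y))"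
proof -
  let ?g = "g \<circ> signed_transpose x y"
  note inv_g = signed_perm_inv[OF g] and inv_inv_g = signed_perm_inv_inv[OF g]
  have g': "signed_perm ?g"
    by (rule signed_perm_comp[OF g signed_perm_signed_transpose[OF xy(1,2)]])
  have "inv ?g = signed_transpose x y \<circ> inv g"
    by (simp only: signed_perm_inv_comp[OF g signed_perm_signed_transpose[OF xy(1,2)]] inv_signed_transpose[OF xy(1,2)])
  moreover have "reflection_ops \<beta> qs f (inv ?g) = f (inv ?g)" "reflection_ops \<beta> qs f (inv g) = f (inv g)"
    using reflection_ops_no_covering[OF signed_perm_inv[OF g'], of qs \<beta> f, unfolded signed_perm_inv_inv[OF g']]
      reflection_ops_no_covering[OF inv_g, of qs \<beta> f, unfolded inv_inv_g] other later by blast+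
  moreover have "reflection_ops \<beta> ps f' (inv g) = f' (inv g)" for f'
    using other by (intro reflection_ops_no_covering[OF inv_g]) (auto simp: inv_inv_g)
  ultimately show ?thesis
    using xy(3) inv_g by (simp only: reflection_ops_simps reflection_op_def inv_inv_g if_True)
qed

definition left_end_key :: "int \<Rightarrow> int \<Rightarrow> int" where
  "left_end_key k t = (if t = - k then 0 else t)"

lemma sorted_left_ends:
  assumes "0 < k" shows "sorted_wrt (\<lambda>t t'. left_end_key k t < left_end_key k t') (left_ends k m)"
proof -
  have "sorted_wrt (\<lambda>t t'. left_end_key k t < left_end_key k t') [a..b]" if "- k \<notin> {a..b}" for a b
    by (rule sorted_wrt_mono_rel[OF _ sorted_wrt_upto]) (use that in \<open>auto simp: left_end_key_def\<close>)
  then show ?thesis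
    using assms by (auto simp: left_ends_def sorted_wrt_append left_end_key_def)
qed

lemma beta_x_nonzero: "beta_x \<noteq> 0"
proof
  assume "beta_x = 0"
  then have "Poly_Mapping.lookup beta_x 0 = 0" by simp
  then show False by (simp add: beta_x_def)
qed

locale last_descent =
  fixes g :: "int \<Rightarrow> int" and n :: nat and r s :: int
  assumes g: "g \<in> signed_perms n" and vex: "vexillary_inversions g" and r: "0 < r"
    and increasing: "strict_mono_on {r<..} g"
    and s: "r < s" "g s < g r" and after_s: "\<And>j. s < j \<Longrightarrow> g r < g j"
begin

lemma signed_perm_g: "signed_perm g" by (rule signed_permI[OF g])

lemma g_minus: "g (- x) = - g x" by (rule signed_perm_minus[OF signed_perm_g])
lemma g_eq_iff: "g x = g y \<longleftrightarrow> x = y" by (rule signed_perm_eq_iff[OF signed_perm_g])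

lemma g_less: "r < x \<Longrightarrow> x < y \<Longrightarrow> g x < g y"
  using strict_mono_onD[OF increasing, of x y] by simp

lemma s_le: "s \<le> int n"
  using inversion_bounds(2)[OF g, of r s] s by (simp add: inversions_def)

lemma g_s_nonzero: "g s \<noteq> 0"
  using signed_perm_eq_0_iff[OF signed_perm_g, of s] r s(1) by simp

definition base :: "int \<Rightarrow> int" where "base = g \<circ> signed_transpose r s"

lemma base: "base \<in> signed_perms n"
  unfolding base_def
  by (rule signed_perms_comp[OF g signed_perms_signed_transpose]) (use r s(1) s_le in auto)

lemma signed_perm_base: "signed_perm base" by (rule signed_permI[OF base])

lemma base_minus: "base (- x) = - base x" by (rule signed_perm_minus[OF signed_perm_base])
lemma base_eq_iff: "base x = base y \<longleftrightarrow> x = y" by (rule signed_perm_eq_iff[OF signed_perm_base])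
lemma base_0: "base 0 = 0" by (rule signed_perm_0[OF signed_perm_base])

lemma base_r: "base r = g s" and base_s: "base s = g r"
  and base_minus_r: "base (- r) = - g s" and base_minus_s: "base (- s) = - g r"
  and base_other: "x \<noteq> r \<Longrightarrow> x \<noteq> s \<Longrightarrow> x \<noteq> - r \<Longrightarrow> x \<noteq> - s \<Longrightarrow> base x = g x"
  unfolding base_minus by (simp_all add: base_def signed_transpose_values)

lemma base_less: assumes "r < x" "x < y" shows "base x < base y"
proof -
  consider "x = s" | "y = s" | "x \<noteq> s" "y \<noteq> s" by blast
  then show ?thesis
  proof cases
    case 1
    then have "base y = g y" using base_other[of y] assms r s(1) by auto
    then show ?thesis using 1 base_s after_s[of y] assms by simp
  next
    case 2
    then have "base x = g x" using base_other[of x] assms r s(1) by auto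
    then show ?thesis using 2 base_s g_less[of x s] assms s(2) by simp
  next
    case 3
    then show ?thesis using base_other[of x] base_other[of y] assms r s(1) g_less by auto
  qed
qed

lemma lower_after_r_le: "r < x \<Longrightarrow> g x < g r \<Longrightarrow> g x \<le> g s"
  using after_s[of x] g_less[of x s] by (cases "x < s"; cases "x = s") auto

lemma positive_before_r: "0 < l \<Longrightarrow> l < r \<Longrightarrow> 0 < g s \<Longrightarrow> 0 < g l"
  using vexillary_inversions_no_negative_before[OF signed_perm_g vex, of l r s] s
    signed_perm_eq_0_iff[OF signed_perm_g, of l]
  by (metis less_irrefl linorder_neqE)

lemma inversion_of_base:
  assumes "- r < p" "p < q" "base q < base p"
  shows "\<exists>q'. p < q' \<and> g q' < g p \<and> g q' = base q \<and> (q' = q \<or> q = s \<and> q' = r \<or> q = r \<and> q' = s)"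
proof -
  have ne: "p \<noteq> - r" "p \<noteq> - s" "q \<noteq> - r" "q \<noteq> - s" using assms r s(1) by auto
  consider (right_r) "q = r" | (right_s) "q = s" | (left_r) "p = r" "q \<noteq> s" | (left_s) "p = s"
    | (other) "q \<noteq> r" "q \<noteq> s" "p \<noteq> r" "p \<noteq> s" by blast
  then show ?thesis
  proof cases
    case right_r
    then have "base p = g p" using base_other[of p] ne assms s(1) by auto
    then show ?thesis using right_r assms base_r s(1) by (intro exI[of _ s]) auto
  next
    case right_s
    have "p < r"
      using base_less[of p q] assms right_s base_r base_s s(2)
      by (cases "p < r"; cases "p = r") auto
    then have "base p = g p" using base_other[of p] ne s(1) by auto
    then show ?thesis using right_s assms base_s \<open>p < r\<close> by (intro exI[of _ r]) auto
  next
    case left_r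
    then have "base q = g q" using base_other[of q] ne assms by auto
    then show ?thesis using left_r assms base_r s(2) by (intro exI[of _ q]) auto
  next
    case left_s
    then show ?thesis using base_less[of p q] assms s(1) by auto
  next
    case other
    then show ?thesis using base_other[of p] base_other[of q] ne assms by (intro exI[of _ q]) auto
  qed
qed

lemma no_left_inversion_below:
  assumes j: "j < j'" "j' < r" "j \<noteq> - r" "j' \<noteq> - r" and below: "base j' < base j" "base j < g s"
    and sign: "j < 0 \<Longrightarrow> \<not> (base j < 0 \<and> 0 < g s)" and minus_s: "j = - s \<Longrightarrow> g s < 0"
  shows False
proof -
  consider (first) "j = - s" | (second) "j' = - s" | (other) "j \<noteq> - s" "j' \<noteq> - s" by blast
  then show ?thesis
  proof cases
    case other
    then have eq: "base j = g j" "base j' = g j'" using base_other j s(1) by auto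
    have "0 < - j' \<and> 0 < g (- j)" "0 < g s"
      using vexillary_inversionsD(1,2)[OF vex, of "- j'" "- j" r s]
        vexillary_inversionsD(2)[OF vex, of r s "- j'" "- j"] j below eq s by (auto simp: g_minus)
    then show False using sign j eq by (auto simp: g_minus)
  next
    case first
    have neg: "g s < 0" using minus_s[OF first] .
    then have pos: "0 < g r" "- g r < g s" using first below base_minus_s by auto
    have below': "base j' < - g r" using first below base_minus_s by simp
    have j': "base j' = g j'" using base_other[of j'] j first s(1) by auto
    show False
    proof (cases "- r < j'")
      case True
      then show False
        using vexillary_inversionsD(2)[OF vex, of r s "- j'" r] j s below' j' pos neg
        by (auto simp: g_minus)
    next
      case False
      then have "g (- j') < g s" using g_less[of "- j'" s] j first by auto
      then show False using below' j' pos neg by (simp add: g_minus)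
    qed
  next
    case second
    then have "g r < g (- j)" using after_s[of "- j"] j by simp
    moreover have "base j = g j" using base_other[of j] second j s(1) r by auto
    ultimately show False using below second base_minus_s by (simp add: g_minus)
  qed
qed

lemma card_lower_after_less:
  assumes "\<And>j. r < j \<Longrightarrow> h j < h r \<Longrightarrow> g j < g r \<and> j \<noteq> s"
  shows "card (lower_after r h) < card (lower_after r g)"
proof (rule psubset_card_mono[OF finite_lower_after[OF g]])
  show "lower_after r h \<subset> lower_after r g" using assms s(1,2) by (auto simp: lower_after_def)
qed

lemma covering_right_end: assumes "r < t" shows "covering base r t \<longleftrightarrow> t = s"
proof
  have "j \<notin> between base r s" for j
  proof
    assume j: "j \<in> between base r s"
    then have "base j = g j" using base_other[of j] r by (simp add: between_def)
    then show False using j g_less[of j s] base_r by (simp add: between_def)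
  qed
  then show "covering base r t" if "t = s"
    using that s r base_r base_s by (auto simp: covering_def)
next
  assume cover: "covering base r t"
  then have "base r < base t" "s \<notin> between base r t"
    using r s(1) assms by (auto simp: covering_def split: if_splits)
  then have "\<not> s < t" using base_r base_s s base_less[of s t] by (auto simp: between_def)
  moreover have "\<not> t < s"
  proof
    assume "t < s"
    then have "base t = g t" "g t < g s" using base_other[of t] g_less[of t s] assms r by auto
    then show False using \<open>base r < base t\<close> base_r by simp
  qed
  ultimately show "t = s" by simp
qed

lemma reflection_ops_right:
  "reflection_ops \<beta> (right_reflections r (Suc n)) f (inv base) = f (inv base) + \<beta> * f (inv g)"
proof -
  let ?ps = "map (\<lambda>t. (r, t)) (rev [s + 1..int (Suc n)])" and ?qs = "map (\<lambda>t. (r, t)) (rev [r + 1..s - 1])"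
  have g_eq: "base \<circ> signed_transpose r s = g"
    unfolding base_def using signed_transpose_involutory[of r s] r s(1) by (simp add: comp_assoc)
  have "[r + 1..int (Suc n)] = [r + 1..s - 1] @ s # [s + 1..int (Suc n)]"
    using upto_split3[of "r + 1" s "int (Suc n)"] s(1) s_le by simp
  then have split: "right_reflections r (Suc n) = ?ps @ (r, s) # ?qs"
    by (simp add: right_reflections_def)
  have "\<not> covering g r t" if "r < t" "t < s" for t
    using that s g_less[of t s] by (auto simp: covering_def)
  then have "reflection_ops \<beta> (?ps @ (r, s) # ?qs) f (inv base) =
      f (inv base) + \<beta> * f (inv (base \<circ> signed_transpose r s))"
    using covering_right_end r s(1)
    by (intro reflection_ops_one_covering[OF signed_perm_base]) (auto simp: g_eq)
  then show ?thesis by (simp only: split g_eq)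
qed

lemma gen_fun_transition:
  assumes i: "i \<in> set (left_ends r (Suc n))"
    and unique: "\<And>t. t < r \<Longrightarrow> t \<noteq> 0 \<Longrightarrow> covering base t r \<longleftrightarrow> t = i"
    and later: "\<And>t. t < r \<Longrightarrow> t \<noteq> 0 \<Longrightarrow> left_end_key r i < left_end_key r t \<Longrightarrow>
      \<not> covering (base \<circ> signed_transpose i r) t r"
  shows "gen_fun (Suc n) N (inv g) = gen_fun (Suc n) N (inv (base \<circ> signed_transpose i r))"
proof -
  let ?F = "gen_fun (Suc n) N"
  have r_le: "r \<le> int (Suc n)" "r \<le> int n" using s_le s(1) by auto
  have ends: "t \<in> set (left_ends r (Suc n)) \<longleftrightarrow> - int (Suc n) \<le> t \<and> t < r \<and> t \<noteq> 0" for t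
    using set_left_ends[OF r r_le(1)] by auto
  obtain ts us where split: "left_ends r (Suc n) = ts @ i # us" using split_list[OF i] by blast
  have sorted: "left_end_key r i < left_end_key r t" if "t \<in> set us" for t
    using sorted_left_ends[OF r, of "Suc n"] that unfolding split sorted_wrt_append by simp
  have distinct: "t \<noteq> i" if "t \<in> set ts \<union> set us" for t
    using sorted_left_ends[OF r, of "Suc n"] that unfolding split sorted_wrt_append by force
  have mem: "t < r \<and> t \<noteq> 0" if "t \<in> set ts \<union> set us" for t using that ends[of t] split by auto
  have "reflection_ops beta_x (left_reflections r (Suc n)) ?F (inv base) =
      ?F (inv base) + beta_x * ?F (inv (base \<circ> signed_transpose i r))"
    unfolding left_reflections_def split map_append list.map
    by (rule reflection_ops_one_covering[OF signed_perm_base])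
       (use ends[of i] i r unique[of i] unique later sorted distinct mem in auto)
  moreover have "reflection_ops beta_x (right_reflections r (Suc n)) ?F (inv base) =
      reflection_ops beta_x (left_reflections r (Suc n)) ?F (inv base)"
    using satisfies_transition_gen_fun[OF r r_le(2), of N] signed_perms_inv[OF base]
    unfolding satisfies_transition_def by blast
  ultimately have "beta_x * ?F (inv g) = beta_x * ?F (inv (base \<circ> signed_transpose i r))"
    by (simp add: reflection_ops_right)
  then show ?thesis using beta_x_nonzero by simp
qed

lemma gen_fun_transition_step:
  assumes "h = base \<circ> signed_transpose i r" "i \<noteq> 0" "- int (Suc n) \<le> i" "i < r"
    and "\<And>t. t < r \<Longrightarrow> t \<noteq> 0 \<Longrightarrow> covering base t r \<longleftrightarrow> t = i"
    and "\<And>t. t < r \<Longrightarrow> t \<noteq> 0 \<Longrightarrow> left_end_key r i < left_end_key r t \<Longrightarrow> \<not> covering h t r"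
    and "vexillary_inversions h" "strict_mono_on {r<..} h"
    and "\<And>j. r < j \<Longrightarrow> h j < h r \<Longrightarrow> g j < g r \<and> j \<noteq> s"
  shows "transition_step n r g h"
proof -
  have "h \<in> signed_perms (Suc n)"
    unfolding assms(1)
    by (rule signed_perms_comp[OF signed_perms_mono[OF _ base] signed_perms_signed_transpose])
       (use assms(2-4) r s s_le in auto)
  moreover have "same_gen_fun (Suc n) g h"
    unfolding same_gen_fun_def assms(1)
    by (intro allI, rule gen_fun_transition) (use assms set_left_ends[OF r, of "Suc n"] s s_le in auto)
  ultimately show ?thesis
    unfolding transition_step_def using assms(7,8) card_lower_after_less[of h] assms(9) by blast
qed

end

subsection \<open>Exchanging two positions\<close>

locale left_swap = last_descent +
  fixes i :: int
  assumes i: "i < r" "i \<noteq> - r" "i \<noteq> 0" "- int (Suc n) \<le> i"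
    and base_i_less: "base i < g s" and sign: "0 < base i \<longleftrightarrow> 0 < g s"
    and maximal: "\<And>j. j < r \<Longrightarrow> \<not> (base i < base j \<and> base j < g s)"
begin

definition swapped :: "int \<Rightarrow> int" where "swapped = base \<circ> signed_transpose i r"

lemma base_i_nonzero: "base i \<noteq> 0" using signed_perm_eq_0_iff[OF signed_perm_base] i by simp

lemma sign_negative: "base i < 0 \<longleftrightarrow> g s < 0" using sign base_i_nonzero g_s_nonzero by auto

lemma signed_perm_swapped: "signed_perm swapped"
  unfolding swapped_def
  by (rule signed_perm_comp[OF signed_perm_base signed_perm_signed_transpose]) (use i r in auto)

lemma swapped_minus:
  "swapped (- x) = - swapped x" by (rule signed_perm_minus[OF signed_perm_swapped])

lemma swapped_r: "swapped r = base i" and swapped_i: "swapped i = g s"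
  and swapped_minus_r: "swapped (- r) = - base i" and swapped_minus_i: "swapped (- i) = - g s"
  and swapped_other: "x \<noteq> r \<Longrightarrow> x \<noteq> i \<Longrightarrow> x \<noteq> - r \<Longrightarrow> x \<noteq> - i \<Longrightarrow> swapped x = base x"
  unfolding swapped_minus by (simp_all add: swapped_def signed_transpose_values base_r)

lemma above_base_i: "j < r \<Longrightarrow> base i < base j \<Longrightarrow> g s < base j"
  using maximal[of j] base_eq_iff[of j r] base_r by (metis linorder_neqE order_less_irrefl)

lemma below_g_s: "j < r \<Longrightarrow> base j < g s \<Longrightarrow> j \<noteq> i \<Longrightarrow> base j < base i"
  using maximal[of j] base_eq_iff[of j i] by (metis linorder_neqE)

lemma above_minus_g_s: "- r < j \<Longrightarrow> - g s < base j \<Longrightarrow> j \<noteq> - i \<Longrightarrow> - base i < base j"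
  using below_g_s[of "- j"] by (auto simp: base_minus)

lemma below_minus_base_i: "- r < j \<Longrightarrow> base j < - base i \<Longrightarrow> base j < - g s"
  using above_base_i[of "- j"] by (auto simp: base_minus)

lemma i_positive: assumes "0 < base i" shows "0 < i"
proof (rule ccontr)
  assume "\<not> 0 < i"
  then have neg: "i < 0" using i by simp
  have pos: "0 < g s" using sign assms by simp
  have "i \<noteq> - s" using assms base_minus_s pos s(2) by auto
  then have g_i: "g i = base i" using base_other[of i] i s(1) neg r by auto
  have "0 < g (- i)"
  proof (cases "- r < i")
    case True
    then show ?thesis using positive_before_r[of "- i"] neg pos by simp
  next
    case False
    then show ?thesis
      using vexillary_inversionsD(2)[OF vex, of r "- i" r s] s r i g_i base_i_less assms pos
      by (auto simp: g_minus)
  qed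
  then show False using g_i assms by (simp add: g_minus)
qed

lemma covering_i: "covering base i r"
  using i base_i_less maximal base_r by (auto simp: covering_def between_def)

lemma coveringD:
  assumes "covering base t r" "t \<noteq> - r"
  shows "base t < g s" "t < j \<Longrightarrow> j < r \<Longrightarrow> \<not> (base t < base j \<and> base j < g s)"
  using assms base_r unfolding covering_def between_def by auto

lemma covering_unique: assumes t: "t < r" "t \<noteq> 0" "covering base t r" shows "t = i"
proof (rule ccontr)
  assume ne: "t \<noteq> i"
  show False
  proof (cases "t = - r")
    case True
    then have pos: "0 < g s" using t(3) base_r base_minus_r by (simp add: covering_def)
    then have "0 < base i" "0 < i" using sign i_positive by auto
    then have "i \<in> between base (- r) r"
      using i base_i_less pos base_r base_minus_r by (simp add: between_def)
    then show False using t(3) True i(3) by (auto simp: covering_def)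
  next
    case False
    obtain j j' where j: "j < j'" "j' < r" "j \<noteq> - r" "j' \<noteq> - r" "covering base j r" "covering base j' r"
      using ne t False i covering_i by (metis linorder_neqE)
    note cover = coveringD[OF j(5,3)] and cover' = coveringD(1)[OF j(6,4)]
    have "base j' \<noteq> base j" using base_eq_iff j(1) by simp
    then have less: "base j' < base j" using cover(2)[OF j(1,2)] cover' by linarith
    have "\<not> (base j < 0 \<and> 0 < g s)" if "j < 0" using cover(2)[of 0] that r base_0 by simp
    moreover have "g s < 0" if "j = - s"
      using cover(2)[of "- r"] that r s base_minus_r base_minus_s g_s_nonzero by auto
    ultimately show False using no_left_inversion_below[OF j(1-4) less cover(1)] by blast
  qed
qed

lemma not_covering_later:
  assumes t: "t < r" "t \<noteq> 0" "left_end_key r i < left_end_key r t"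
  shows "\<not> covering swapped t r"
proof
  assume "covering swapped t r"
  then have less: "swapped t < base i" by (simp add: covering_def swapped_r)
  show False
  proof (cases "t = - r")
    case True
    then have "0 < base i" using less swapped_minus_r by simp
    then show False using i_positive t(3) True i(2) by (simp add: left_end_key_def)
  next
    case False
    then have it: "i < t" using t(3) i(2) by (simp add: left_end_key_def)
    show False
    proof (cases "t = - i")
      case True
      then have "\<not> 0 < base i" using it i_positive by auto
      then show False using less swapped_minus_i True sign_negative base_i_nonzero by auto
    next
      case ne: False
      then have "base t < base i" using less swapped_other[of t] t False it by simp
      moreover have "\<not> (base i < 0 \<and> 0 < g s)" using sign_negative by auto
      moreover have "g s < 0" if "i = - s" using that base_minus_s sign s(2) g_s_nonzero by auto
      ultimately show False
        using no_left_inversion_below[of i t] it t(1) i(2) False base_i_less by blast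
    qed
  qed
qed

lemma swapped_less: assumes "r < x" "x < y" shows "swapped x < swapped y"
proof -
  have other: "swapped z = base z" if "r < z" "z \<noteq> - i" for z
    using swapped_other[of z] that i r by auto
  consider "x = - i" | "y = - i" | "x \<noteq> - i" "y \<noteq> - i" by blast
  then show ?thesis
  proof cases
    case 1
    then have "- base i < base y" using base_less[OF assms] by (simp add: base_minus)
    then show ?thesis using 1 swapped_minus_i other[of y] assms base_i_less by simp
  next
    case 2
    then have "base x < - base i" using base_less[OF assms] by (simp add: base_minus)
    then show ?thesis using 2 swapped_minus_i other[of x] assms below_minus_base_i[of x] r by simp
  next
    case 3
    then show ?thesis using other assms base_less by simp
  qed
qed

lemma swapped_lower_after:
  assumes j: "r < j" "swapped j < swapped r" shows "g j < g r \<and> j \<noteq> s"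
proof (cases "j = - i")
  case True
  then have "- g s < base i" using j swapped_minus_i swapped_r by simp
  then have "0 < base i" using sign sign_negative g_s_nonzero base_i_nonzero by auto
  then show ?thesis using i_positive True j r by simp
next
  case False
  then have eq: "swapped j = base j" using swapped_other[of j] j i r by auto
  then have "j \<noteq> s" using j swapped_r base_s base_i_less s(2) by auto
  then show ?thesis using eq base_other[of j] j r swapped_r base_i_less s by auto
qed

subsection \<open>Inversions after the exchange\<close>

text \<open>Every inversion of \<open>swapped\<close> with a left end beyond \<open>- r\<close> comes from an inversion of \<open>g\<close>
  further to the right and with a larger lower value.\<close>

definition dominated :: "int \<Rightarrow> int \<Rightarrow> bool" where
  "dominated p q \<longleftrightarrow> (\<exists>P Q. P < Q \<and> g Q < g P \<and> swapped q \<le> g Q \<and> (0 < g Q \<longrightarrow> 0 < swapped q) \<and>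
     (P = p \<or> p = i \<and> P = r))"

lemma dominatedI:
  assumes "- r < P" "P < Q" "base Q < base P" "swapped q \<le> base Q" "0 < base Q \<longrightarrow> 0 < swapped q"
    and "P = p \<or> p = i \<and> P = r"
  shows "dominated p q"
  unfolding dominated_def using inversion_of_base[OF assms(1-3)] assms(4-6) by metis

lemma dominated_right_minus_i:
  assumes p: "- r < p" "p < - i" "- g s < swapped p" shows "dominated p (- i)"
proof -
  have "- base i < base p"
  proof -
    consider "p = r" | "p = i" | "p \<noteq> r" "p \<noteq> i" by blast
    then show ?thesis
    proof cases
      case 1
      then show ?thesis using p swapped_r base_r sign sign_negative g_s_nonzero base_i_nonzero
        by auto
    next
      case 2
      then show ?thesis using p swapped_i sign base_i_nonzero by auto
    next
      case 3
      then have "swapped p = base p" using swapped_other[of p] p by auto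
      then show ?thesis using p above_minus_g_s[of p] by simp
    qed
  qed
  then show ?thesis
    using p swapped_minus_i base_i_less sign_negative g_s_nonzero base_i_nonzero
    by (intro dominatedI[of p "- i"]) (auto simp: base_minus)
qed

lemma dominated_left_minus_i:
  assumes q: "- r < - i" "- i < q" "swapped q < - g s" shows "dominated (- i) q"
proof -
  consider "q = r" | "q = i" | "q \<noteq> r" "q \<noteq> i" by blast
  then show ?thesis
  proof cases
    case 1
    then have "base i < - g s" using q swapped_r by simp
    then have "g s < 0" "base i < 0" using sign_negative sign g_s_nonzero base_i_nonzero by auto
    then show ?thesis
      using q 1 swapped_r base_r base_i_less
      by (intro dominatedI[of "- i" q]) (auto simp: base_minus)
  next
    case 2
    then have "g s < 0" using q swapped_i by simp
    then show ?thesis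
      using q 2 swapped_i base_r i(1) sign_negative
      by (intro dominatedI[of "- i" r]) (auto simp: base_minus)
  next
    case 3
    then have "swapped q = base q" using swapped_other[of q] q by auto
    then show ?thesis using q base_i_less by (intro dominatedI[of "- i" q]) (auto simp: base_minus)
  qed
qed

lemma dominated_right_r:
  assumes p: "- r < p" "p < r" "base i < swapped p" "p \<noteq> - i" shows "dominated p r"
proof (cases "p = i")
  case True
  then show ?thesis
    unfolding dominated_def
    using swapped_r s base_i_less sign by (intro exI[of _ r] exI[of _ s]) auto
next
  case False
  then have "swapped p = base p" using swapped_other[of p] p by auto
  then have "g s < base p" using above_base_i[of p] p by simp
  then show ?thesis
    using p swapped_r base_r base_i_less sign by (intro dominatedI[of p r]) auto
qed

lemma dominated_left_i:
  assumes q: "- r < i" "i < q" "swapped q < g s" "q \<noteq> r" "q \<noteq> - i" shows "dominated i q"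
proof -
  have eq: "swapped q = base q" using swapped_other[of q] q by auto
  then have less: "base q < g s" using q by simp
  show ?thesis
  proof (cases "q < r")
    case True
    then have "base q < base i" using below_g_s[of q] less q by simp
    then show ?thesis using q eq by (intro dominatedI[of i q]) auto
  next
    case False
    then show ?thesis using q eq less base_r r by (intro dominatedI[of r q]) auto
  qed
qed

lemma dominated_inversion:
  assumes p: "- r < p" "p < q" "swapped q < swapped p" shows "dominated p q"
proof -
  consider (right_minus_i) "q = - i" | (left_minus_i) "p = - i" | (right_r) "q = r" "p \<noteq> - i"
    | (left_r) "p = r" "q \<noteq> - i" | (left_i) "p = i" "q \<noteq> r" "q \<noteq> - i" | (right_i) "q = i" "p \<noteq> - i"
    | (other) "q \<noteq> - i" "p \<noteq> - i" "q \<noteq> r" "p \<noteq> r" "p \<noteq> i" "q \<noteq> i" by blast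
  then show ?thesis
  proof cases
    case right_minus_i
    then show ?thesis using dominated_right_minus_i[of p] p swapped_minus_i by simp
  next
    case left_minus_i
    then show ?thesis using dominated_left_minus_i[of q] p swapped_minus_i by simp
  next
    case right_r
    then show ?thesis using dominated_right_r[of p] p swapped_r by simp
  next
    case left_r
    then have "swapped q = base q" using swapped_other[of q] p i by auto
    then show ?thesis
      using left_r p swapped_r base_r base_i_less r by (intro dominatedI[of r q]) auto
  next
    case left_i
    then show ?thesis using dominated_left_i[of q] p swapped_i by simp
  next
    case right_i
    then have "swapped p = base p" using swapped_other[of p] p i by auto
    then show ?thesis
      using right_i p swapped_i base_r i by (intro dominatedI[of p r]) auto
  next
    case other
    then have "swapped p = base p" "swapped q = base q" using swapped_other p by auto
    then show ?thesis using p by (intro dominatedI[of p q]) auto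
  qed
qed

lemma inversion_le_r: assumes "p < q" "swapped q < swapped p" shows "p \<le> r"
  using swapped_less[of p q] assms by force

lemma inversions_positive:
  assumes pq: "p < q" "swapped q < swapped p" and pq': "p' < q'" "swapped q' < swapped p'"
    and pos: "0 < p + p'" "0 < swapped q + swapped q'"
  shows "0 < p" "0 < swapped q"
proof -
  have "- r < p" "- r < p'" using inversion_le_r[OF pq] inversion_le_r[OF pq'] pos(1) by auto
  then obtain P Q P' Q' where
    PQ: "P < Q" "g Q < g P" "swapped q \<le> g Q" "0 < g Q \<longrightarrow> 0 < swapped q" "P = p \<or> p = i \<and> P = r" and
    PQ': "P' < Q'" "g Q' < g P'" "swapped q' \<le> g Q'" "P' = p' \<or> p' = i \<and> P' = r"
    using dominated_inversion[OF _ pq] dominated_inversion[OF _ pq'] unfolding dominated_def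
    by blast
  have "p \<le> P" "p' \<le> P'" using PQ(5) PQ'(4) i by auto
  then have "0 < P" "0 < g Q"
    using vexillary_inversionsD(1,2)[OF vex PQ(1,2) PQ'(1,2)] pos PQ(3) PQ'(3) by auto
  then show "0 < swapped q" using PQ(4) by simp
  then show "0 < p"
    using PQ(5) \<open>0 < P\<close> i_positive sign swapped_i pq(2) by auto
qed

end

subsection \<open>The case of a positive value\<close>

locale positive_left_swap = left_swap +
  assumes g_s_pos: "0 < g s"
begin

lemma i_pos: "0 < i" using i_positive sign g_s_pos by simp

lemma g_i: "g i = base i" using base_other[of i] i i_pos r s(1) by auto

lemma swapped_s: "swapped s = g r" using swapped_other[of s] base_s s(1) i r i_pos by auto

lemma swapped_eq_g: "0 < x \<Longrightarrow> x \<noteq> r \<Longrightarrow> x \<noteq> i \<Longrightarrow> x \<noteq> s \<Longrightarrow> swapped x = g x"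
  using swapped_other[of x] base_other[of x] r s(1) i_pos by auto

lemma positive_inversion_g:
  assumes "0 < p" "p < q" "g q < g p" "0 < g q"
  shows "r < q" "g q < g r" "g s < g p"
  using vexillary_inversionsD(3,4)[OF vex, of r s p q] vexillary_inversionsD(3,4)[OF vex, of p q r s]
    assms g_s_pos r s by auto

context
  fixes p q
  assumes p: "0 < p" "p < q" "swapped q < swapped p" "0 < swapped q"
begin

lemma left_end_less_r: "p < r"
proof (rule ccontr)
  assume "\<not> p < r"
  then have p_eq: "p = r" using inversion_le_r[OF p(2,3)] by simp
  then have less: "swapped q < base i" using p swapped_r by simp
  then have "q \<noteq> s" using swapped_s base_i_less s(2) by auto
  then have "swapped q = g q" using swapped_eq_g[of q] p p_eq i r by auto
  then have "g s < g i" using positive_inversion_g(3)[of i q] i_pos p p_eq i g_i less by auto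
  then show False using g_i base_i_less by simp
qed

lemma right_end_ge_r: "r \<le> q"
proof (rule ccontr)
  assume "\<not> r \<le> q"
  then have q: "q < r" by simp
  consider "p = i" | "q = i" | "p \<noteq> i" "q \<noteq> i" by blast
  then show False
  proof cases
    case 1
    then have eq: "swapped q = g q" "base q = g q"
      using swapped_eq_g[of q] base_other[of q] p q s(1) r by auto
    then have "base q < base i" using below_g_s[of q] q p 1 swapped_i by auto
    then show False using positive_inversion_g(1)[of i q] p 1 g_i q eq by auto
  next
    case 2
    then have "swapped p = g p" using swapped_eq_g[of p] p q s(1) by auto
    then show False
      using positive_inversion_g(1)[of p i] p 2 g_i swapped_i base_i_less sign g_s_pos q by auto
  next
    case 3
    then show False
      using swapped_eq_g[of p] swapped_eq_g[of q] p q s(1) positive_inversion_g(1)[of p q] by auto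
  qed
qed

lemma upper_value_ge: "g s \<le> swapped p"
proof (rule ccontr)
  assume less: "\<not> g s \<le> swapped p"
  note pr = left_end_less_r
  have "p \<noteq> i" using less swapped_i by auto
  then have eq: "swapped p = g p" "base p = g p"
    using swapped_eq_g[of p] base_other[of p] p pr r s(1) by auto
  then have "g p < base i" using below_g_s[of p] pr less \<open>p \<noteq> i\<close> by simp
  then have "q \<noteq> r" "q \<noteq> s" using p swapped_r swapped_s eq base_i_less s(2) by auto
  then have "swapped q = g q" using swapped_eq_g[of q] p right_end_ge_r i by auto
  then show False using positive_inversion_g(3)[of p q] eq p less by auto
qed

lemma lower_value_less: "swapped q < g s"
proof -
  note pr = left_end_less_r and rq = right_end_ge_r
  consider "q = r" | "q = s" | "q \<noteq> r" "q \<noteq> s" by blast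
  then show ?thesis
  proof cases
    case 1
    then show ?thesis using swapped_r base_i_less by simp
  next
    case 2
    then have "g r < swapped p" using p swapped_s by simp
    then have "p \<noteq> i" using swapped_i s(2) by auto
    then have "g p = swapped p" using swapped_eq_g[of p] p pr s(1) by auto
    then show ?thesis
      using positive_inversion_g(1)[of p r] \<open>g r < swapped p\<close> p pr g_s_pos s(2) by auto
  next
    case 3
    then have q_eq: "swapped q = g q" using swapped_eq_g[of q] p rq i by auto
    show ?thesis
    proof (cases "p = i")
      case True
      then show ?thesis using p swapped_i by simp
    next
      case False
      then have "g p = swapped p" using swapped_eq_g[of p] p pr s(1) by auto
      then have "g q < g r" using positive_inversion_g(2)[of p q] p q_eq by auto
      then have "g q \<le> g s" using lower_after_r_le[of q] rq 3 by auto
      then show ?thesis using q_eq 3 g_eq_iff[of q s] by auto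
    qed
  qed
qed

end

lemma inversions_bipartite:
  assumes "0 < p" "p < q" "swapped q < swapped p" "0 < swapped q"
    and "0 < p'" "p' < q'" "swapped q' < swapped p'" "0 < swapped q'"
  shows "p < q' \<and> swapped q' < swapped p"
  using left_end_less_r[OF assms(1-4)] right_end_ge_r[OF assms(5-8)]
    upper_value_ge[OF assms(1-4)] lower_value_less[OF assms(5-8)] by auto

end

subsection \<open>The case of a negative value\<close>

locale negative_left_swap = left_swap +
  assumes g_s_neg: "g s < 0"
begin

lemma base_i_neg: "base i < 0" using sign_negative g_s_neg by simp

lemma positive_value_position: "0 < swapped x \<Longrightarrow> x \<noteq> r \<and> x \<noteq> i"
  using swapped_r swapped_i base_i_neg g_s_neg by auto

lemma swapped_eq_base: "0 < x \<Longrightarrow> x \<noteq> r \<Longrightarrow> x \<noteq> i \<Longrightarrow> x \<noteq> - i \<Longrightarrow> swapped x = base x"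
  using swapped_other[of x] r by auto

lemma base_positive:
  assumes "0 < x" "0 < swapped x" shows "0 < base x"
proof (cases "x = - i")
  case True
  then show ?thesis using base_i_neg by (simp add: base_minus)
next
  case False
  then show ?thesis using swapped_eq_base[of x] positive_value_position[OF assms(2)] assms by simp
qed

lemma base_less_iff:
  assumes "0 < x" "0 < y" "0 < swapped x" "0 < swapped y"
  shows "base y < base x \<longleftrightarrow> swapped y < swapped x"
proof -
  note ne = positive_value_position[OF assms(3)] positive_value_position[OF assms(4)]
  consider "x = - i" "y = - i" | "x = - i" "y \<noteq> - i" | "x \<noteq> - i" "y = - i" | "x \<noteq> - i" "y \<noteq> - i"
    by blast
  then show ?thesis
  proof cases
    case 2
    then have "swapped y = base y" using swapped_eq_base[of y] assms ne by simp
    then show ?thesis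
      using 2 swapped_minus_i base_i_less below_minus_base_i[of y] assms r
      by (auto simp: base_minus)
  next
    case 3
    then have "swapped x = base x" using swapped_eq_base[of x] assms ne by simp
    then show ?thesis
      using 3 swapped_minus_i base_i_less above_minus_g_s[of x] assms r by (auto simp: base_minus)
  qed (use swapped_eq_base assms ne in auto)
qed

lemma inversions_bipartite:
  assumes p: "0 < p" "p < q" "swapped q < swapped p" "0 < swapped q"
    and p': "0 < p'" "p' < q'" "swapped q' < swapped p'" "0 < swapped q'"
  shows "p < q' \<and> swapped q' < swapped p"
proof -
  have order: "p < r" "p' < r" if "p \<le> r" "p' \<le> r"
    using that positive_value_position[of p] positive_value_position[of p'] p p' by auto
  then have lt: "p < r" "p' < r" using inversion_le_r p(2,3) p'(2,3) by auto
  have q'_ne: "q' \<noteq> r" using positive_value_position[OF p'(4)] by simp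
  have "base q < base p" "base q' < base p'" using base_less_iff p p' by auto
  then obtain Q Q' where Q: "p < Q" "g Q < g p" "g Q = base q"
    and Q': "p' < Q'" "g Q' < g p'" "g Q' = base q'" "Q' = q' \<or> q' = s \<and> Q' = r"
    using inversion_of_base[of p q] inversion_of_base[of p' q'] p p' r q'_ne by force
  have "0 < g Q + g Q'" using base_positive[of q] base_positive[of q'] p p' Q(3) Q'(3) by auto
  then have less: "p < Q'" "base q' < g p"
    using vexillary_inversionsD(3,4)[OF vex Q(1,2) Q'(1,2)] p p' Q'(3) by auto
  have "g p = base p" using base_other[of p] lt p(1) r s(1) by auto
  then have "swapped q' < swapped p" using less(2) base_less_iff[of p q'] p p' by auto
  moreover have "p < q'" using less(1) Q'(4) lt(1) s(1) by auto
  ultimately show ?thesis by blast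
qed

end

context left_swap
begin

lemma inversions_bipartite:
  assumes "0 < p" "p < q" "swapped q < swapped p" "0 < swapped q"
    and "0 < p'" "p' < q'" "swapped q' < swapped p'" "0 < swapped q'"
  shows "p < q' \<and> swapped q' < swapped p"
proof (cases "0 < g s")
  case True
  then interpret positive_left_swap g n r s i by unfold_locales
  show ?thesis by (rule inversions_bipartite[OF assms])
next
  case False
  then interpret negative_left_swap g n r s i by unfold_locales (use g_s_nonzero in auto)
  show ?thesis by (rule inversions_bipartite[OF assms])
qed

lemma vexillary_swapped: "vexillary_inversions swapped"
proof (rule vexillary_inversionsI)
  fix p q p' q'
  assume pq: "p < q" "swapped q < swapped p" and pq': "p' < q'" "swapped q' < swapped p'"
    and pos: "0 < p + p'" "0 < swapped q + swapped q'"
  have "0 < p \<and> 0 < swapped q" "0 < p' \<and> 0 < swapped q'"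
    using inversions_positive[OF pq pq'] inversions_positive[OF pq' pq] pos
    by (auto simp: add.commute)
  then show "0 < p \<and> 0 < swapped q \<and> p < q' \<and> swapped q' < swapped p"
    using inversions_bipartite pq pq' by blast
qed

lemma transition_step_swapped: "transition_step n r g swapped"
  by (rule gen_fun_transition_step[OF swapped_def i(3,4,1) _ not_covering_later vexillary_swapped _
        swapped_lower_after])
     (use covering_unique covering_i swapped_less in \<open>auto intro: strict_mono_onI\<close>)

end

subsection \<open>Changing a sign\<close>

locale sign_change = last_descent +
  assumes g_s_pos: "0 < g s" and none_below: "\<And>j. j < r \<Longrightarrow> \<not> (0 < base j \<and> base j < g s)"
begin

definition negated :: "int \<Rightarrow> int" where "negated = base \<circ> signed_transpose (- r) r"

lemma negated_r: "negated r = - g s" and negated_minus_r: "negated (- r) = g s"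
  and negated_other: "x \<noteq> r \<Longrightarrow> x \<noteq> - r \<Longrightarrow> negated x = base x"
  using r by (simp_all add: negated_def signed_transpose_values base_r base_minus_r)

lemma before_r: assumes "0 < l" "l < r" shows "base l = g l" "g s < base l"
proof -
  show "base l = g l" using base_other[of l] assms s(1) by auto
  moreover have "base l \<noteq> g s" using base_eq_iff[of l r] base_r assms by auto
  ultimately show "g s < base l"
    using positive_before_r[OF assms g_s_pos] none_below[of l] assms by auto
qed

lemma covering_iff: assumes t: "t < r" "t \<noteq> 0" shows "covering base t r \<longleftrightarrow> t = - r"
proof
  assume cover: "covering base t r"
  show "t = - r"
  proof (rule ccontr)
    assume ne: "t \<noteq> - r"
    then have less: "base t < g s" and empty: "between base t r = {}"
      using cover base_r by (simp_all add: covering_def)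
    show False
    proof (cases "0 < t")
      case True
      then show False using before_r(2)[of t] t less by simp
    next
      case False
      then have "0 \<notin> between base t r" "t < 0" using empty t by auto
      then have "\<not> base t < 0" using r base_0 base_r g_s_pos by (simp add: between_def)
      moreover have "base t \<noteq> 0" using base_eq_iff[of t 0] base_0 t by simp
      ultimately show False using none_below[of t] t less by simp
    qed
  qed
next
  assume t_eq: "t = - r"
  have "j = 0" if "- r < j" "j < r" "- g s < base j" "base j < g s" for j
  proof (rule ccontr)
    assume "j \<noteq> 0"
    then show False
      using before_r(2)[of j] before_r(2)[of "- j"] that by (cases "0 < j") (auto simp: base_minus)
  qed
  then show "covering base t r"
    using t_eq t g_s_pos base_r base_minus_r by (auto simp: covering_def between_def)
qed

lemma negated_less: "r < x \<Longrightarrow> x < y \<Longrightarrow> negated x < negated y"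
  using negated_other[of x] negated_other[of y] r base_less by auto

lemma not_covering_later:
  assumes t: "t < r" "t \<noteq> 0" "left_end_key r (- r) < left_end_key r t"
  shows "\<not> covering negated t r"
proof -
  have pos: "0 < t" using t(3) r by (auto simp: left_end_key_def split: if_splits)
  then have "negated r < negated t"
    using negated_r negated_other[of t] before_r(2)[of t] t g_s_pos by auto
  then show ?thesis by (simp add: covering_def)
qed

lemma negated_lower_after:
  assumes j: "r < j" "negated j < negated r" shows "g j < g r \<and> j \<noteq> s"
proof -
  have less: "base j < - g s" using negated_other[of j] negated_r r j by auto
  then have "j \<noteq> s" using base_s g_s_pos s(2) by auto
  then show ?thesis using less base_other[of j] j r s g_s_pos by auto
qed

lemma inversion_of_negated:
  assumes "- r < p" "p < q" "negated q < negated p" "q \<noteq> r"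
  shows "\<exists>q'. p < q' \<and> g q' < g p \<and> g q' = negated q \<and> (q' = q \<or> q = s \<and> q' = r)"
proof -
  have "negated q = base q" using negated_other[of q] assms by auto
  moreover have "base q < base p"
    using calculation assms negated_r base_r g_s_pos negated_other[of p] by (cases "p = r") auto
  ultimately show ?thesis using inversion_of_base[of p q] assms by metis
qed

lemma right_end_not_r:
  assumes p: "- r < p" "p < r" and pq': "- r < p'" "p' < q'" "negated q' < negated p'"
    and pos: "0 < p + p'" "0 < negated r + negated q'"
  shows False
proof -
  have "q' \<noteq> r" using pos(2) negated_r g_s_pos by auto
  then obtain Q where Q: "p' < Q" "g Q < g p'" "g Q = negated q'"
    using inversion_of_negated[OF pq'] by blast
  have g_Q: "g s < g Q" using Q pos(2) negated_r by simp
  show False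
  proof (cases "0 < p'")
    case True
    then have "r < Q \<and> g Q < g r"
      using vexillary_inversionsD(3,4)[OF vex, of r s p' Q] Q g_Q s r g_s_pos by auto
    then show False using lower_after_r_le[of Q] g_Q by auto
  next
    case False
    then have "0 < p" using pos(1) by simp
    then have "g s < g p" using before_r[of p] p(2) by simp
    then show False
      using vexillary_inversionsD(1)[OF vex Q(1,2), of p s] g_Q p s pos(1) g_s_pos False by auto
  qed
qed

lemma vexillary_negated: "vexillary_inversions negated"
proof (rule vexillary_inversionsI)
  fix p q p' q'
  assume pq: "p < q" "negated q < negated p" and pq': "p' < q'" "negated q' < negated p'"
    and pos: "0 < p + p'" "0 < negated q + negated q'"
  have le: "p \<le> r" "p' \<le> r" using negated_less[of p q] negated_less[of p' q'] pq pq' by force+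
  then have gt: "- r < p" "- r < p'" using pos(1) by auto
  have "q \<noteq> r" using right_end_not_r[of p p' q'] pq pq' gt pos by auto
  then obtain Q where Q: "p < Q" "g Q < g p" "g Q = negated q"
    using inversion_of_negated[OF gt(1) pq] by blast
  have "q' \<noteq> r" using right_end_not_r[of p' p q] pq pq' gt pos by (auto simp: add.commute)
  then obtain Q' where Q': "p' < Q'" "g Q' < g p'" "g Q' = negated q'" "Q' = q' \<or> q' = s \<and> Q' = r"
    using inversion_of_negated[OF gt(2) pq'] by blast
  have result: "0 < p" "0 < negated q" "p < Q'" "negated q' < g p"
    using vexillary_inversionsD[OF vex Q(1,2) Q'(1,2)] pos Q(3) Q'(3) by auto
  have "p \<noteq> r" using pq(2) result(2) negated_r g_s_pos by auto
  then have "negated p = g p"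
    using negated_other[of p] base_other[of p] result(1) le(1) r s(1) by auto
  then show "0 < p \<and> 0 < negated q \<and> p < q' \<and> negated q' < negated p"
    using result Q'(4) s(1) le(1) \<open>p \<noteq> r\<close> by auto
qed

lemma transition_step_negated: "transition_step n r g negated"
  by (rule gen_fun_transition_step[OF negated_def _ _ _ covering_iff not_covering_later
        vexillary_negated _ negated_lower_after])
     (use r s_le s(1) negated_less in \<open>auto intro: strict_mono_onI\<close>)

end

subsection \<open>Iteration\<close>

context last_descent
begin

definition candidates :: "int set" where
  "candidates = {t. - int (Suc n) \<le> t \<and> t < r \<and> base t < g s \<and> (g s < 0 \<or> 0 < base t)}"

lemma finite_candidates: "finite candidates"
  by (rule finite_subset[of _ "{- int (Suc n)..<r}"]) (auto simp: candidates_def)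

lemma base_far_left: "j < - int n \<Longrightarrow> base j = j"
  using signed_perms_fixes[OF base, of j] by simp

lemma far_left_candidate: "g s < 0 \<Longrightarrow> - int (Suc n) \<in> candidates"
  using base_far_left[of "- int (Suc n)"] signed_perms_abs_le[OF g, of s] s_le r s(1)
  by (simp add: candidates_def)

lemma transition_step_no_candidates:
  assumes "candidates = {}" shows "\<exists>h. transition_step n r g h"
proof -
  have pos: "0 < g s" using far_left_candidate assms g_s_nonzero by (metis empty_iff linorder_neqE)
  have "\<not> (0 < base j \<and> base j < g s)" if "j < r" for j
  proof (cases "- int (Suc n) \<le> j")
    case True
    then show ?thesis using assms that unfolding candidates_def by blast
  next
    case False
    then show ?thesis using base_far_left[of j] by simp
  qed
  then interpret sign_change g n r s by unfold_locales (use pos in auto)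
  show ?thesis using transition_step_negated by blast
qed

lemma transition_step_candidate:
  assumes i: "i \<in> candidates" and max: "\<And>t. t \<in> candidates \<Longrightarrow> base t \<le> base i"
  shows "\<exists>h. transition_step n r g h"
proof -
  have i': "- int (Suc n) \<le> i" "i < r" "base i < g s" "g s < 0 \<or> 0 < base i"
    using i by (auto simp: candidates_def)
  have "\<not> (base i < base j \<and> base j < g s)" if "j < r" for j
  proof
    assume j: "base i < base j \<and> base j < g s"
    show False
    proof (cases "- int (Suc n) \<le> j")
      case True
      then have "j \<in> candidates" using j i' that by (auto simp: candidates_def)
      then show False using max[of j] j by simp
    next
      case False
      then have far: "base j = j" using base_far_left[of j] by simp
      have "- int (Suc n) \<le> base i" if "g s < 0"
        using max[OF far_left_candidate[OF that]] base_far_left[of "- int (Suc n)"] by simp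
      then show False using j far False i'(4) by auto
    qed
  qed
  then interpret left_swap g n r s i
    by unfold_locales (use i' base_minus_r base_0 in auto)
  show ?thesis using transition_step_swapped by blast
qed

lemma exists_transition_step: "\<exists>h. transition_step n r g h"
proof (cases "candidates = {}")
  case False
  have "Max (base ` candidates) \<in> base ` candidates"
    by (rule Max_in) (use finite_candidates False in auto)
  then obtain i where "i \<in> candidates" "base i = Max (base ` candidates)" by auto
  then show ?thesis using finite_candidates by (intro transition_step_candidate[of i]) auto
qed (rule transition_step_no_candidates)

end

lemma vexillary_transition_step:
  assumes g: "g \<in> signed_perms n" "vexillary_inversions g" and r: "0 < r" "strict_mono_on {r<..} g"
    and lower: "lower_after r g \<noteq> {}"
  shows "\<exists>h. transition_step n r g h"
proof -
  note fin = finite_lower_after[OF g(1), of r]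
  define s where "s = Max (lower_after r g)"
  have s: "s \<in> lower_after r g" unfolding s_def by (rule Max_in[OF fin lower])
  have "g r < g j" if "s < j" for j
  proof -
    have "j \<notin> lower_after r g" using that fin unfolding s_def by (metis Max_ge not_le)
    moreover have "r < j" using that s by (simp add: lower_after_def)
    moreover have "g j \<noteq> g r" using signed_perm_eq_iff[OF signed_permI[OF g(1)]] calculation by simp
    ultimately show ?thesis by (auto simp: lower_after_def)
  qed
  then interpret last_descent g n r s
    by unfold_locales (use g r s in \<open>auto simp: lower_after_def\<close>)
  show ?thesis by (rule exists_transition_step)
qed

lemma strict_mono_on_extend:
  assumes g: "signed_perm g" "strict_mono_on {r<..} g" and lower: "lower_after r g = {}"
  shows "strict_mono_on {r - 1<..} g"
proof (rule strict_mono_onI)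
  fix x y assume xy: "x \<in> {r - 1<..}" "y \<in> {r - 1<..}" "x < y"
  show "g x < g y"
  proof (cases "x = r")
    case True
    then have "\<not> g y < g r" "g y \<noteq> g r"
      using lower xy signed_perm_eq_iff[OF g(1)] by (auto simp: lower_after_def)
    then show ?thesis using True by simp
  next
    case False
    then show ?thesis using strict_mono_onD[OF g(2), of x y] xy by simp
  qed
qed

lemma reduce_descent:
  "g \<in> signed_perms n \<Longrightarrow> vexillary_inversions g \<Longrightarrow> 0 < r \<Longrightarrow> strict_mono_on {r<..} g \<Longrightarrow>
    \<exists>m h. n \<le> m \<and> h \<in> signed_perms m \<and> vexillary_inversions h \<and> strict_mono_on {r - 1<..} h \<and>
      same_gen_fun m g h"
proof (induction "card (lower_after r g)" arbitrary: g n rule: less_induct)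
  case less
  show ?case
  proof (cases "lower_after r g = {}")
    case True
    then show ?thesis
      using less.prems strict_mono_on_extend[OF signed_permI[OF less.prems(1)] less.prems(4)]
      by (intro exI[of _ n] exI[of _ g]) (simp add: same_gen_fun_def)
  next
    case False
    obtain h where h: "h \<in> signed_perms (Suc n)" "vexillary_inversions h" "strict_mono_on {r<..} h"
      "card (lower_after r h) < card (lower_after r g)" "same_gen_fun (Suc n) g h"
      using vexillary_transition_step[OF less.prems False]
      unfolding transition_step_def by blast
    obtain m h' where h': "Suc n \<le> m" "h' \<in> signed_perms m" "vexillary_inversions h'"
      "strict_mono_on {r - 1<..} h'" "same_gen_fun m h h'"
      using less.hyps[OF h(4,1,2) less.prems(3) h(3)] by blast
    have "same_gen_fun m g h"
      using same_gen_fun_mono[OF h(5) h'(1)] signed_perms_mono[OF _ less.prems(1)] h(1) by simp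
    then have "same_gen_fun m g h'" using h'(5) by (simp add: same_gen_fun_def)
    then show ?thesis using h' by (intro exI[of _ m] exI[of _ h']) auto
  qed
qed

lemma reduce_to_increasing:
  "g \<in> signed_perms n \<Longrightarrow> vexillary_inversions g \<Longrightarrow> strict_mono_on {int r<..} g \<Longrightarrow>
    \<exists>m h. n \<le> m \<and> h \<in> signed_perms m \<and> strict_mono_on {0<..} h \<and> same_gen_fun m g h"
proof (induction r arbitrary: g n)
  case 0
  then show ?case by (intro exI[of _ n] exI[of _ g]) (simp add: same_gen_fun_def)
next
  case (Suc r)
  obtain m h where h: "n \<le> m" "h \<in> signed_perms m" "vexillary_inversions h" "strict_mono_on {int r<..} h"
    "same_gen_fun m g h"
    using reduce_descent[OF Suc.prems(1,2) _ Suc.prems(3)] by auto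
  obtain k h' where h': "m \<le> k" "h' \<in> signed_perms k" "strict_mono_on {0<..} h'" "same_gen_fun k h h'"
    using Suc.IH[OF h(2,3,4)] by blast
  have "same_gen_fun k g h"
    using same_gen_fun_mono[OF h(5) h'(1)] signed_perms_mono[OF h(1) Suc.prems(1)] h(2) by simp
  then have "same_gen_fun k g h'" using h'(4) by (simp add: same_gen_fun_def)
  then show ?case using h(1) h' by (intro exI[of _ k] exI[of _ h']) auto
qed

section \<open>The eighteen patterns\<close>

fun order_matches :: "int list \<Rightarrow> int list \<Rightarrow> bool" where
  "order_matches [] [] \<longleftrightarrow> True"
| "order_matches (x # xs) (a # as) \<longleftrightarrow> sgn x = sgn a \<and>
     list_all2 (\<lambda>y b. (\<bar>x\<bar> < \<bar>y\<bar> \<longleftrightarrow> \<bar>a\<bar> < \<bar>b\<bar>) \<and> (\<bar>y\<bar> < \<bar>x\<bar> \<longleftrightarrow> \<bar>b\<bar> < \<bar>a\<bar>)) xs as \<and> order_matches xs as"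
| "order_matches _ _ \<longleftrightarrow> False"

lemma order_matches_nth:
  assumes "order_matches xs as"
  shows "length xs = length as \<and> (\<forall>i < length as. sgn (xs ! i) = sgn (as ! i)) \<and>
    (\<forall>i < length as. \<forall>j < length as. \<bar>xs ! i\<bar> < \<bar>xs ! j\<bar> \<longleftrightarrow> \<bar>as ! i\<bar> < \<bar>as ! j\<bar>)"
  using assms
proof (induction xs as rule: order_matches.induct)
  case (2 x xs a as)
  then show ?case by (auto simp: list_all2_conv_all_nth nth_Cons split: nat.splits)
qed auto

lemma subseq_one_line:
  assumes "sorted_wrt (<) ps" "set ps \<subseteq> {0<..int n}"
  shows "subseq (map w ps) (one_line n w)"
proof -
  let ?I = "map int [1..<Suc n]"
  have set_I: "set ?I = {0<..int n}"
  proof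
    have "x \<in> int ` {1..<Suc n}" if "x \<in> {0<..int n}" for x
      using that by (intro image_eqI[of _ _ "nat x"]) auto
    then show "{0<..int n} \<subseteq> set ?I" by (auto simp del: upt_Suc)
  qed (auto simp del: upt_Suc)
  have "filter (\<lambda>x. x \<in> set ps) ?I = ps"
  proof (rule sorted_distinct_set_unique)
    show "sorted (filter (\<lambda>x. x \<in> set ps) ?I)"
      by (rule sorted_wrt_filter) (simp add: sorted_map del: upt_Suc)
    show "sorted ps" "distinct ps" using assms(1) strict_sorted_iff by blast+
    show "set (filter (\<lambda>x. x \<in> set ps) ?I) = set ps"
      using assms(2) unfolding set_filter set_I by blast
  qed (auto simp: distinct_map del: upt_Suc)
  then have "subseq ps ?I" by (metis subseq_filter_left)
  then have "subseq (map w ps) (map w ?I)" by (rule subseq_map)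
  then show ?thesis by (simp add: one_line_def comp_def del: upt_Suc)
qed

locale vexillary_perm =
  fixes n :: nat and w :: "int \<Rightarrow> int"
  assumes w: "w \<in> signed_perms n" and vexillary: "vexillary n w"
begin

lemma signed_perm_w: "signed_perm w" by (rule signed_permI[OF w])

lemma w_minus: "w (- x) = - w x" by (rule signed_perm_minus[OF signed_perm_w])
lemma w_0: "w 0 = 0" by (rule signed_perm_0[OF signed_perm_w])
lemma w_nonzero: "x \<noteq> 0 \<Longrightarrow> w x \<noteq> 0" using signed_perm_eq_0_iff[OF signed_perm_w] by simp

lemma w_distinct: assumes "0 < x" "x < y" shows "w x \<noteq> w y" "w x \<noteq> - w y"
  using assms signed_perm_eq_iff[OF signed_perm_w, of x y] signed_perm_eq_minus_iff[OF signed_perm_w, of x y]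
  by auto

lemma inversion_le: "x < y \<Longrightarrow> w y < w x \<Longrightarrow> y \<le> int n"
  using inversion_bounds(2)[OF w, of x y] by (simp add: inversions_def)

lemma avoids:
  assumes "as \<in> vexillary_patterns" "sorted_wrt (<) ps" "set ps \<subseteq> {0<..int n}" "order_matches (map w ps) as"
  shows False
proof -
  have "contains_pattern (one_line n w) as"
    unfolding contains_pattern_def
    using subseq_one_line[OF assms(2,3), of w] order_matches_nth[OF assms(4)] by blast
  then show False using vexillary assms(1) unfolding vexillary_def by blast
qed

lemma no_negative_before_positive_inversion:
  assumes "0 < x" "x < y" "y < z" "z \<le> int n" "w x < 0" "w z < w y" "0 < w z"
  shows False
proof -
  have "w x \<noteq> - w y" "w x \<noteq> - w z" using w_distinct(2)[of x y] w_distinct(2)[of x z] assms by auto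
  then consider "- w x < w z" | "w z < - w x" "- w x < w y" | "w y < - w x" by linarith
  then show False
  proof cases
    case 1
    then show False using avoids[of "[-1, 3, 2]" "[x, y, z]"] assms
      by (auto simp: vexillary_patterns_def)
  next
    case 2
    then show False using avoids[of "[-2, 3, 1]" "[x, y, z]"] assms
      by (auto simp: vexillary_patterns_def)
  next
    case 3
    then show False using avoids[of "[-3, 2, 1]" "[x, y, z]"] assms
      by (auto simp: vexillary_patterns_def)
  qed
qed

lemma no_positive_between_negatives:
  assumes "0 < x" "x < y" "y < z" "z \<le> int n" "w z < 0" "- w z < w y" "w y < - w x"
  shows False
  using avoids[of "[-3, 2, -1]" "[x, y, z]"] assms by (auto simp: vexillary_patterns_def)

lemma no_positive_decreasing_triple:
  assumes "0 < x" "x < y" "y < z" "z \<le> int n" "0 < w z" "w z < w y" "w y < w x"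
  shows False
  using avoids[of "[3, 2, 1]" "[x, y, z]"] assms by (auto simp: vexillary_patterns_def)

lemma no_negative_with_positive_inversion:
  assumes "0 < p" "p < q" "q \<le> int n" "w q < w p" "0 < x" "x \<le> int n" "w x < 0" "- w x < w q"
  shows False
proof -
  have "x \<noteq> p" "x \<noteq> q" using assms by auto
  then consider "x < p" | "p < x" "x < q" | "q < x" by linarith
  then show False
  proof cases
    case 1
    then show False using no_negative_before_positive_inversion[of x p q] assms by auto
  next
    case 2
    then show False using avoids[of "[3, -1, 2]" "[p, x, q]"] assms
      by (auto simp: vexillary_patterns_def)
  next
    case 3
    then show False using avoids[of "[3, 2, -1]" "[p, q, x]"] assms
      by (auto simp: vexillary_patterns_def)
  qed
qed

lemma value_between_cases:
  assumes "0 < x" "x < y" "y < z" "z \<le> int n" "w x < w z" "w z < 0" "w z < w y"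
  obtains "w y < 0" | "0 < w y" "w y < - w z" | "- w x < w y"
proof -
  have "w y \<noteq> 0" "w y \<noteq> - w x" "w y \<noteq> - w z"
    using w_nonzero[of y] w_distinct(2)[of x y] w_distinct(2)[of y z] assms by auto
  then show thesis
    using that no_positive_between_negatives[of x y z] assms by (meson linorder_less_linear)
qed

lemma no_middle_value_before:
  assumes "0 < u" "u < x" "x < y" "y < z" "z \<le> int n"
    "w z < 0" "w z < w y" "- w z < \<bar>w u\<bar>" "\<bar>w u\<bar> < - w x"
  shows False
proof (rule value_between_cases[of x y z])
  assume "w y < 0"
  then show False
    using avoids[of "[3, -4, -1, -2]" "[u, x, y, z]"] avoids[of "[-3, -4, -1, -2]" "[u, x, y, z]"] assms
    by (cases "0 < w u") (auto simp: vexillary_patterns_def)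
next
  assume "0 < w y" "w y < - w z"
  then show False
    using avoids[of "[3, -4, 1, -2]" "[u, x, y, z]"] avoids[of "[-3, -4, 1, -2]" "[u, x, y, z]"] assms
    by (cases "0 < w u") (auto simp: vexillary_patterns_def)
next
  assume "- w x < w y"
  then show False
    using avoids[of "[2, -3, 4, -1]" "[u, x, y, z]"] avoids[of "[-2, -3, 4, -1]" "[u, x, y, z]"] assms
    by (cases "0 < w u") (auto simp: vexillary_patterns_def)
qed (use assms in linarith)+

lemma no_middle_value_after:
  assumes "0 < x" "x < y" "y < z" "z < u" "u \<le> int n"
    "w z < 0" "w z < w y" "- w z < w u" "w u < - w x"
  shows False
proof (rule value_between_cases[of x y z])
  assume "w y < 0"
  then show False using avoids[of "[-4, -1, -2, 3]" "[x, y, z, u]"] assms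
    by (auto simp: vexillary_patterns_def)
next
  assume "0 < w y" "w y < - w z"
  then show False using avoids[of "[-4, 1, -2, 3]" "[x, y, z, u]"] assms
    by (auto simp: vexillary_patterns_def)
next
  assume "- w x < w y"
  then show False using no_negative_before_positive_inversion[of x y u] assms by auto
qed (use assms in linarith)+

text \<open>Two inversions as in the definition of \<^const>\<open>vexillary_inversions\<close>, the first one with
  \<open>p = - m < 0\<close>.\<close>

lemma no_inversion_from_negative_position:
  assumes "0 < m" "m < p'" "p' < q'" "q' \<le> int n" "w q' < w p'"
    and "- m < q" "q \<le> int n" "w m < - w q" "- w q < w q'"
  shows False
proof -
  have "\<not> (w m < 0 \<and> 0 < w q')"
    using no_negative_before_positive_inversion[of m p' q'] assms by auto
  then consider (pos) "0 < w m" | (neg) "w q' < 0"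
    using w_nonzero[of m] w_nonzero[of q'] assms by force
  then show False
  proof cases
    case pos
    show False
    proof (cases "0 < q")
      case True
      then show False using no_negative_with_positive_inversion[of p' q' q] pos assms by auto
    next
      case False
      moreover have "q \<noteq> 0" using pos assms w_0 by auto
      ultimately show False
        using avoids[of "[2, 1, 4, 3]" "[- q, m, p', q']"] pos assms w_minus[of q]
        by (auto simp: vexillary_patterns_def)
    qed
  next
    case neg
    then have "0 < w q" "q \<noteq> m" "q \<noteq> q'" "q \<noteq> 0" using assms w_0 by auto
    then consider "\<bar>q\<bar> < m" | "m < q" "q < q'" | "q' < q" using assms by linarith
    then show False
    proof cases
      case 1
      moreover have "\<bar>w \<bar>q\<bar>\<bar> = w q" using \<open>0 < w q\<close> w_minus[of q] by (auto simp: abs_if)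
      ultimately show False
        using no_middle_value_before[of "\<bar>q\<bar>" m p' q'] neg assms \<open>q \<noteq> 0\<close> by auto
    next
      case 2
      then show False using no_positive_between_negatives[of m q q'] neg assms by auto
    next
      case 3
      then show False using no_middle_value_after[of m p' q' q] neg assms by auto
    qed
  qed
qed

lemma inversion_position_pos:
  assumes "p < q" "w q < w p" "p' < q'" "w q' < w p'" "0 < p + p'" "0 < w q + w q'"
  shows "0 < p"
proof (rule ccontr)
  assume "\<not> 0 < p"
  have bounds: "q \<le> int n" "q' \<le> int n" using inversion_le assms by blast+
  show False
  proof (cases "p = 0")
    case True
    then show False
      using no_negative_with_positive_inversion[of p' q' q] bounds assms w_0 by auto
  next
    case False
    then show False
      using no_inversion_from_negative_position[of "- p" p' q' q] \<open>\<not> 0 < p\<close> bounds assms w_minus[of p]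
      by auto
  qed
qed

lemma inversion_value_pos:
  assumes "p < q" "w q < w p" "p' < q'" "w q' < w p'" "0 < p + p'" "0 < w q + w q'"
  shows "0 < w q"
proof (rule ccontr)
  have pos: "0 < p" "0 < p'"
    using inversion_position_pos[of p q p' q'] inversion_position_pos[of p' q' p q] assms by auto
  assume "\<not> 0 < w q"
  then show False
    using no_negative_with_positive_inversion[of p' q' q] w_nonzero[of q] pos assms
      inversion_le[of p q] inversion_le[of p' q'] by auto
qed

lemma positive_inversions_overlap:
  assumes "0 < p" "p < q" "q \<le> int n" "w q < w p" "0 < p'" "p' < q'" "q' \<le> int n" "w q' < w p'"
    and "0 < w q" "0 < w q'"
  shows "p < q'"
proof (rule ccontr)
  assume "\<not> p < q'"
  show False
  proof (cases "q' = p")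
    case True
    then show False using no_positive_decreasing_triple[of p' p q] assms by auto
  next
    case False
    then have "q' < p" using \<open>\<not> p < q'\<close> by simp
    then have "w p' \<noteq> w p" "w p' \<noteq> w q" "w q' \<noteq> w q"
      using w_distinct(1)[of p' p] w_distinct(1)[of p' q] w_distinct(1)[of q' q] assms by auto
    then consider "w p < w p'" | "w p' < w q" | "w q < w p'" "w p' < w p" "w q < w q'"
      | "w q < w p'" "w p' < w p" "w q' < w q"
      by linarith
    then show False
    proof cases
      case 1
      then show False using no_positive_decreasing_triple[of p' p q] assms \<open>q' < p\<close> by auto
    next
      case 2
      then show False
        using avoids[of "[2, 1, 4, 3]" "[p', q', p, q]"] assms \<open>q' < p\<close>
        by (auto simp: vexillary_patterns_def)
    next
      case 3
      then show False using no_positive_decreasing_triple[of p' q' q] assms \<open>q' < p\<close> by auto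
    next
      case 4
      then show False
        using avoids[of "[3, 1, 4, 2]" "[p', q', p, q]"] assms \<open>q' < p\<close>
        by (auto simp: vexillary_patterns_def)
    qed
  qed
qed

lemma positive_inversion_values_overlap:
  assumes "0 < p" "p < q" "q \<le> int n" "w q < w p" "0 < p'" "p' < q'" "q' \<le> int n" "w q' < w p'"
    and "0 < w q" "0 < w q'"
  shows "w q' < w p"
proof (rule ccontr)
  assume "\<not> w q' < w p"
  moreover have "p < q'" using positive_inversions_overlap[of p q p' q'] assms by simp
  ultimately have gt: "w p < w q'" using w_distinct(1)[of p q'] assms(1) by auto
  then have "p \<noteq> p'" "q \<noteq> p'" "q \<noteq> q'" using assms by auto
  then consider "p' < p" | "p < p'" "q < p'" | "p < p'" "p' < q" "q < q'" | "p < p'" "q' < q"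
    by linarith
  then show False
  proof cases
    case 1
    then show False using no_positive_decreasing_triple[of p' p q] assms gt by auto
  next
    case 2
    then show False
      using avoids[of "[2, 1, 4, 3]" "[p, q, p', q']"] assms gt
      by (auto simp: vexillary_patterns_def)
  next
    case 3
    then show False
      using avoids[of "[2, 4, 1, 3]" "[p, p', q, q']"] assms gt
      by (auto simp: vexillary_patterns_def)
  next
    case 4
    then show False using no_positive_decreasing_triple[of p' q' q] assms gt by auto
  qed
qed

lemma vexillary_inversions: "vexillary_inversions w"
proof (rule vexillary_inversionsI)
  fix p q p' q'
  assume h: "p < q" "w q < w p" "p' < q'" "w q' < w p'" "0 < p + p'" "0 < w q + w q'"
  have "0 < p" "0 < p'" "0 < w q" "0 < w q'"
    using inversion_position_pos[of p q p' q'] inversion_position_pos[of p' q' p q]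
      inversion_value_pos[of p q p' q'] inversion_value_pos[of p' q' p q] h by auto
  then show "0 < p \<and> 0 < w q \<and> p < q' \<and> w q' < w p"
    using positive_inversions_overlap[of p q p' q'] positive_inversion_values_overlap[of p q p' q'] h
      inversion_le[of p q] inversion_le[of p' q'] by auto
qed

end

section \<open>Set-valued tableaux\<close>

definition semistandard :: "(nat \<times> nat \<Rightarrow> int set) \<Rightarrow> bool" where
  "semistandard T \<longleftrightarrow> (\<forall>b. finite (T b) \<and> 0 \<notin> T b) \<and>
     (\<forall>i j. \<forall>x\<in>T (i, j). \<forall>y\<in>T (i + 1, j). prec_rank x < prec_rank y \<or> x = y \<and> x < 0) \<and>
     (\<forall>i j. \<forall>x\<in>T (i, j). \<forall>y\<in>T (i, j + 1). prec_rank x < prec_rank y \<or> x = y \<and> 0 < x)"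

definition boxes :: "('b \<Rightarrow> 'a set) \<Rightarrow> 'b set" where
  "boxes T = {b. T b \<noteq> {}}"

lemma semistandard_finite: "semistandard T \<Longrightarrow> finite (T b)"
  and semistandard_nonzero: "semistandard T \<Longrightarrow> x \<in> T b \<Longrightarrow> x \<noteq> 0"
  unfolding semistandard_def by blast+

lemma semistandard_below:
  "semistandard T \<Longrightarrow> x \<in> T (i, j) \<Longrightarrow> y \<in> T (i + 1, j) \<Longrightarrow> prec_rank x < prec_rank y \<or> x = y \<and> x < 0"
  unfolding semistandard_def by blast

lemma semistandard_right:
  "semistandard T \<Longrightarrow> x \<in> T (i, j) \<Longrightarrow> y \<in> T (i, j + 1) \<Longrightarrow> prec_rank x < prec_rank y \<or> x = y \<and> 0 < x"
  unfolding semistandard_def by blast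

lemma semistandard_subset:
  assumes "semistandard T" "\<And>b. U b \<subseteq> T b" shows "semistandard U"
  using assms finite_subset[OF assms(2)] unfolding semistandard_def by blast

lemma semistandard_insert:
  assumes T: "semistandard T" and x: "x \<noteq> 0" and corner: "T (i, j + 1) = {}" "T (i + 1, j) = {}"
    and left: "\<And>k y. j = k + 1 \<Longrightarrow> y \<in> T (i, k) \<Longrightarrow> prec_rank y < prec_rank x \<or> y = x \<and> 0 < x"
    and above: "\<And>k y. i = k + 1 \<Longrightarrow> y \<in> T (k, j) \<Longrightarrow> prec_rank y < prec_rank x \<or> y = x \<and> x < 0"
  shows "semistandard (T((i, j) := insert x (T (i, j))))" (is "semistandard ?T")
  unfolding semistandard_def
proof (intro conjI allI ballI)
  fix b
  show "finite (?T b)" "0 \<notin> ?T b"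
    using T x unfolding semistandard_def by (simp_all del: split_paired_All)
next
  fix k l y z
  assume y: "y \<in> ?T (k, l)" and z: "z \<in> ?T (k + 1, l)"
  have "(k, l) \<noteq> (i, j)" using z corner by auto
  then have "y \<in> T (k, l)" using y by (metis fun_upd_other)
  then show "prec_rank y < prec_rank z \<or> y = z \<and> y < 0"
    using z semistandard_below[OF T, of y k l z] above[of k y] by (cases "(k + 1, l) = (i, j)") auto
next
  fix k l y z
  assume y: "y \<in> ?T (k, l)" and z: "z \<in> ?T (k, l + 1)"
  have "(k, l) \<noteq> (i, j)" using z corner by auto
  then have "y \<in> T (k, l)" using y by (metis fun_upd_other)
  then show "prec_rank y < prec_rank z \<or> y = z \<and> 0 < y"
    using z semistandard_right[OF T, of y k l z] left[of l y] by (cases "(k, l + 1) = (i, j)") auto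
qed

lemma prec_rank_eq_iff: "x \<noteq> 0 \<Longrightarrow> y \<noteq> 0 \<Longrightarrow> prec_rank x = prec_rank y \<longleftrightarrow> x = y"
  by (auto simp: prec_rank_def split: if_splits) presburger+

lemma abs_le_prec_rank: "x \<noteq> 0 \<Longrightarrow> \<bar>x\<bar> \<le> prec_rank x"
  by (auto simp: prec_rank_def)

lemma prec_min_mem: "finite S \<Longrightarrow> S \<noteq> {} \<Longrightarrow> prec_min S \<in> S"
  and prec_min_le: "finite S \<Longrightarrow> x \<in> S \<Longrightarrow> prec_rank (prec_min S) \<le> prec_rank x"
  unfolding prec_min_def by (rule arg_min_if_finite(1), assumption+) (rule arg_min_least, auto)

lemma prec_max_mem: "finite S \<Longrightarrow> S \<noteq> {} \<Longrightarrow> prec_max S \<in> S"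
  and prec_max_ge: "finite S \<Longrightarrow> x \<in> S \<Longrightarrow> prec_rank x \<le> prec_rank (prec_max S)"
proof -
  have "prec_max S = arg_min_on (\<lambda>x. - prec_rank x) S"
    by (simp add: prec_max_def arg_max_on_def arg_max_def is_arg_max_def arg_min_on_def arg_min_def
        is_arg_min_def)
  then show "finite S \<Longrightarrow> S \<noteq> {} \<Longrightarrow> prec_max S \<in> S"
    "finite S \<Longrightarrow> x \<in> S \<Longrightarrow> prec_rank x \<le> prec_rank (prec_max S)"
    using arg_min_if_finite(1)[of S "\<lambda>x. - prec_rank x"] arg_min_least[of S x "\<lambda>x. - prec_rank x"]
    by auto
qed

lemma prec_max_prec_min_iff:
  assumes A: "finite A" "A \<noteq> {}" "0 \<notin> A" and B: "finite B" "B \<noteq> {}" "0 \<notin> B"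
  shows "prec_rank (prec_max A) < prec_rank (prec_min B) \<or> prec_max A = prec_min B \<and> Q (prec_max A)
    \<longleftrightarrow> (\<forall>x\<in>A. \<forall>y\<in>B. prec_rank x < prec_rank y \<or> x = y \<and> Q x)"
proof
  assume extremes: "prec_rank (prec_max A) < prec_rank (prec_min B) \<or> prec_max A = prec_min B \<and> Q (prec_max A)"
  show "\<forall>x\<in>A. \<forall>y\<in>B. prec_rank x < prec_rank y \<or> x = y \<and> Q x"
  proof (intro ballI)
    fix x y
    assume x: "x \<in> A" and y: "y \<in> B"
    note bounds = prec_max_ge[OF A(1) x] prec_min_le[OF B(1) y]
    show "prec_rank x < prec_rank y \<or> x = y \<and> Q x"
    proof (cases "prec_rank x < prec_rank y")
      case False
      then have "prec_max A = prec_min B" "Q (prec_max A)" using extremes bounds by auto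
      moreover from this have "prec_rank x = prec_rank (prec_max A)" "prec_rank y = prec_rank (prec_max A)"
        using False bounds by auto
      then have "x = prec_max A" "y = prec_max A"
        using x y A B prec_max_mem[OF A(1,2)] by (metis prec_rank_eq_iff)+
      ultimately show ?thesis by simp
    qed simp
  qed
next
  assume "\<forall>x\<in>A. \<forall>y\<in>B. prec_rank x < prec_rank y \<or> x = y \<and> Q x"
  then show "prec_rank (prec_max A) < prec_rank (prec_min B) \<or> prec_max A = prec_min B \<and> Q (prec_max A)"
    using prec_max_mem[OF A(1,2)] prec_min_mem[OF B(1,2)] by blast
qed

lemma set_valued_tableaux_iff:
  "T \<in> set_valued_tableaux lam \<longleftrightarrow> semistandard T \<and> boxes T = shifted_diagram lam"
proof (cases "(\<forall>b. finite (T b) \<and> 0 \<notin> T b) \<and> boxes T = shifted_diagram lam")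
  case True
  then have cells: "finite (T b)" "0 \<notin> T b" "b \<in> shifted_diagram lam \<longleftrightarrow> T b \<noteq> {}" for b
    unfolding boxes_def by blast+
  then have filled: "(\<forall>b. b \<notin> shifted_diagram lam \<longrightarrow> T b = {}) \<and>
      (\<forall>b\<in>shifted_diagram lam. finite (T b) \<and> T b \<noteq> {} \<and> 0 \<notin> T b)" by blast
  have neighbours: "(a \<in> shifted_diagram lam \<and> b \<in> shifted_diagram lam \<longrightarrow>
        prec_rank (prec_max (T a)) < prec_rank (prec_min (T b)) \<or>
        prec_max (T a) = prec_min (T b) \<and> Q (prec_max (T a))) \<longleftrightarrow>
      (\<forall>x\<in>T a. \<forall>y\<in>T b. prec_rank x < prec_rank y \<or> x = y \<and> Q x)" for a b Q
    using prec_max_prec_min_iff[of "T a" "T b" Q] cells[of a] cells[of b] by blast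
  show ?thesis
    unfolding set_valued_tableaux_def semistandard_def mem_Collect_eq
    by (simp only: neighbours[where Q = "\<lambda>x. x < 0"] neighbours[where Q = "\<lambda>x. 0 < x"])
       (use filled True in blast)
next
  case False
  have "(\<forall>b. finite (T b) \<and> 0 \<notin> T b) \<and> boxes T = shifted_diagram lam"
    if "T \<in> set_valued_tableaux lam"
  proof -
    have "\<forall>b. b \<notin> shifted_diagram lam \<longrightarrow> T b = {}"
      "\<forall>b\<in>shifted_diagram lam. finite (T b) \<and> T b \<noteq> {} \<and> 0 \<notin> T b"
      using that unfolding set_valued_tableaux_def by blast+
    then show ?thesis unfolding boxes_def
      by (metis (mono_tags, lifting) Collect_cong Collect_mem_eq empty_iff finite.emptyI)
  qed
  then show ?thesis using False semistandard_finite semistandard_nonzero by blast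
qed

text \<open>The largest admissible letter, the one of rank \<open>L\<close>, may occur only in boxes of \<open>P\<close>.\<close>

definition tabs :: "(nat \<times> nat) set \<Rightarrow> int \<Rightarrow> (nat \<times> nat) set \<Rightarrow> (nat \<times> nat \<Rightarrow> int set) set" where
  "tabs D L P = {T. semistandard T \<and> boxes T = D \<and>
     (\<forall>b. \<forall>x\<in>T b. prec_rank x \<le> L \<and> (prec_rank x = L \<longrightarrow> b \<in> P))}"

lemma tabsI:
  "semistandard T \<Longrightarrow> boxes T = D \<Longrightarrow>
    (\<And>b x. x \<in> T b \<Longrightarrow> prec_rank x \<le> L \<and> (prec_rank x = L \<longrightarrow> b \<in> P)) \<Longrightarrow> T \<in> tabs D L P"
  unfolding tabs_def by blast

lemma tabs_semistandard: "T \<in> tabs D L P \<Longrightarrow> semistandard T"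
  and tabs_boxes: "T \<in> tabs D L P \<Longrightarrow> boxes T = D"
  and tabs_rank_le: "T \<in> tabs D L P \<Longrightarrow> x \<in> T b \<Longrightarrow> prec_rank x \<le> L"
  and tabs_top_letter: "T \<in> tabs D L P \<Longrightarrow> x \<in> T b \<Longrightarrow> prec_rank x = L \<Longrightarrow> b \<in> P"
  unfolding tabs_def by blast+

lemma tabs_mem_iff: "T \<in> tabs D L P \<Longrightarrow> b \<in> D \<longleftrightarrow> T b \<noteq> {}"
  unfolding tabs_def boxes_def by blast

lemma finite_tabs: assumes "finite D" shows "finite (tabs D L P)"
proof (rule finite_subset)
  show "tabs D L P \<subseteq> {T. \<forall>b. (b \<in> D \<longrightarrow> T b \<in> Pow {- L..L}) \<and> (b \<notin> D \<longrightarrow> T b = {})}"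
  proof (intro subsetI CollectI allI conjI impI)
    fix T b
    assume T: "T \<in> tabs D L P"
    have "x \<in> {- L..L}" if "x \<in> T b" for x
      using abs_le_prec_rank[OF semistandard_nonzero[OF tabs_semistandard[OF T] that]] tabs_rank_le[OF T that]
      by auto
    then show "T b \<in> Pow {- L..L}" by blast
    show "T b = {}" if "b \<notin> D" using tabs_mem_iff[OF T] that by blast
  qed
  show "finite {T. \<forall>b. (b \<in> D \<longrightarrow> T b \<in> Pow {- L..L}) \<and> (b \<notin> D \<longrightarrow> T b = ({}::int set))}"
    by (rule finite_set_of_finite_funs[OF assms]) simp
qed

lemma tabs_restrict:
  assumes "Q \<subseteq> P" "\<And>T b x. T \<in> tabs D L P \<Longrightarrow> x \<in> T b \<Longrightarrow> prec_rank x = L \<Longrightarrow> b \<in> Q"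
  shows "tabs D L P = tabs D L Q"
  using assms unfolding tabs_def by blast

definition box_weight :: "int set \<Rightarrow> x_polynomial" where
  "box_weight S = beta_x ^ (card S - 1) * (\<Prod>s\<in>S. x_var (nat \<bar>s\<bar>))"

definition tab_weight :: "(nat \<times> nat) set \<Rightarrow> (nat \<times> nat \<Rightarrow> int set) \<Rightarrow> x_polynomial" where
  "tab_weight D T = (\<Prod>b\<in>D. box_weight (T b))"

definition tab_sum :: "(nat \<times> nat) set \<Rightarrow> int \<Rightarrow> (nat \<times> nat) set \<Rightarrow> x_polynomial" where
  "tab_sum D L P = (\<Sum>T\<in>tabs D L P. tab_weight D T)"

lemma box_weight_empty: "box_weight {} = 1"
  by (simp add: box_weight_def)

lemma box_weight_insert:
  assumes "finite S" "x \<notin> S"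
  shows "box_weight (insert x S) = x_var (nat \<bar>x\<bar>) * (if S = {} then 1 else beta_x) * box_weight S"
proof (cases "S = {}")
  case False
  then have "card S = Suc (card S - 1)" using assms(1) by (simp add: card_gt_0_iff)
  then have "beta_x ^ card S = beta_x * beta_x ^ (card S - 1)" by (metis power_Suc)
  then show ?thesis using assms False by (simp add: box_weight_def mult_ac)
qed (simp add: box_weight_def)

lemma tab_weight_insert:
  assumes "finite D" "b \<in> D" "finite (T b)" "x \<notin> T b"
  shows "tab_weight D (T(b := insert x (T b))) =
    x_var (nat \<bar>x\<bar>) * (if T b = {} then 1 else beta_x) * tab_weight D T"
  using assms by (simp add: tab_weight_def prod.remove[of D b] box_weight_insert mult.assoc)

lemma tab_weight_remove_empty: "finite D \<Longrightarrow> T b = {} \<Longrightarrow> tab_weight (D - {b}) T = tab_weight D T"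
  unfolding tab_weight_def by (rule prod.mono_neutral_left) (auto simp: box_weight_empty)

lemma tab_sum_empty: "tab_sum {} L P = 1"
proof -
  have "tabs {} L P = {\<lambda>b. {}}" by (auto simp: tabs_def semistandard_def boxes_def)
  then show ?thesis by (simp add: tab_sum_def tab_weight_def)
qed

lemma tab_sum_no_letters: assumes "D \<noteq> {}" shows "tab_sum D 0 P = 0"
proof -
  obtain b where b: "b \<in> D" using assms by blast
  have "tabs D 0 P = {}"
  proof (rule equals0I)
    fix T assume T: "T \<in> tabs D 0 P"
    obtain x where x: "x \<in> T b" using tabs_mem_iff[OF T] b by blast
    have "x \<noteq> 0" using semistandard_nonzero[OF tabs_semistandard[OF T] x] .
    then show False using tabs_rank_le[OF T x] abs_le_prec_rank[of x] by simp
  qed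
  then show ?thesis by (simp add: tab_sum_def)
qed

lemma tab_sum_whole_shape: assumes "D \<subseteq> P" shows "tab_sum D L UNIV = tab_sum D L P"
proof -
  have "tabs D L UNIV = tabs D L P"
    by (rule tabs_restrict) (use tabs_mem_iff assms in blast)+
  then show ?thesis by (simp add: tab_sum_def)
qed

lemma tab_sum_next_letter: assumes "D \<inter> P = {}" shows "tab_sum D (L + 1) P = tab_sum D L UNIV"
proof -
  have "prec_rank x \<le> L" if T: "T \<in> tabs D (L + 1) P" and x: "x \<in> T b" for T b x
    using tabs_rank_le[OF T x] tabs_top_letter[OF T x] tabs_mem_iff[OF T, of b] x assms
    by (cases "prec_rank x = L + 1") auto
  then have "tabs D (L + 1) P = tabs D L UNIV" unfolding tabs_def by (auto 5 0) fastforce+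
  then show ?thesis by (simp add: tab_sum_def)
qed

text \<open>When the letter \<open>x\<close> of rank \<open>L\<close> is also allowed in the corner \<open>b\<close> of \<open>D\<close>, removing it
  from \<open>b\<close> leaves a tableau of shape \<open>D\<close> or \<open>D - {b}\<close>.\<close>

locale tableau_corner =
  fixes D P :: "(nat \<times> nat) set" and i j :: nat and b :: "nat \<times> nat" and x L :: int
  defines "b \<equiv> (i, j)"
  assumes finite_D: "finite D" and b_mem: "b \<in> D" and corner: "(i, j + 1) \<notin> D" "(i + 1, j) \<notin> D"
    and x_nonzero: "x \<noteq> 0" and rank_x: "prec_rank x = L" and b_notin: "b \<notin> P"
    and left: "\<And>k. j = k + 1 \<Longrightarrow> (i, k) \<in> P \<Longrightarrow> 0 < x"
    and above: "\<And>k. i = k + 1 \<Longrightarrow> (k, j) \<in> P \<Longrightarrow> x < 0"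
begin

definition without :: "(nat \<times> nat \<Rightarrow> int set) set" where
  "without = tabs D L P \<union> tabs (D - {b}) L P"

definition ins :: "(nat \<times> nat \<Rightarrow> int set) \<Rightarrow> nat \<times> nat \<Rightarrow> int set" where
  "ins T = T(b := insert x (T b))"

lemma rank_eq_L: "y \<noteq> 0 \<Longrightarrow> prec_rank y = L \<longleftrightarrow> y = x"
  using prec_rank_eq_iff[OF _ x_nonzero] rank_x by simp

lemma without_semistandard: "T \<in> without \<Longrightarrow> semistandard T"
  and without_rank_le: "T \<in> without \<Longrightarrow> y \<in> T a \<Longrightarrow> prec_rank y \<le> L"
  and without_top_letter: "T \<in> without \<Longrightarrow> y \<in> T a \<Longrightarrow> prec_rank y = L \<Longrightarrow> a \<in> P"
  and without_boxes: "T \<in> without \<Longrightarrow> boxes T = D \<or> boxes T = D - {b}"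
  unfolding without_def tabs_def by blast+

lemma without_letter: "T \<in> without \<Longrightarrow> x \<notin> T b"
  using without_top_letter rank_x b_notin by blast

lemma ins_tabs: assumes T: "T \<in> without" shows "ins T \<in> tabs D L (insert b P)"
proof (rule tabsI)
  have neighbour: "prec_rank y < prec_rank x \<or> y = x \<and> a \<in> P" if "y \<in> T a" for y a
    using without_rank_le[OF T that] without_top_letter[OF T that] rank_x
      rank_eq_L[OF semistandard_nonzero[OF without_semistandard[OF T] that]] by auto
  have outside: "T a = {}" if "a \<notin> D" for a
    using without_boxes[OF T] that unfolding boxes_def by blast
  show "semistandard (ins T)"
    unfolding ins_def b_def
  proof (rule semistandard_insert[OF without_semistandard[OF T] x_nonzero outside outside])
    show "(i, j + 1) \<notin> D" "(i + 1, j) \<notin> D" by (fact corner)+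
    show "prec_rank y < prec_rank x \<or> y = x \<and> 0 < x" if "j = k + 1" "y \<in> T (i, k)" for k y
      using neighbour[OF that(2)] left[OF that(1)] by blast
    show "prec_rank y < prec_rank x \<or> y = x \<and> x < 0" if "i = k + 1" "y \<in> T (k, j)" for k y
      using neighbour[OF that(2)] above[OF that(1)] by blast
  qed
  have "boxes (ins T) = insert b (boxes T)" by (auto simp: boxes_def ins_def)
  then show "boxes (ins T) = D" using without_boxes[OF T] b_mem by (metis insert_Diff insert_absorb)
  show "prec_rank y \<le> L \<and> (prec_rank y = L \<longrightarrow> a \<in> insert b P)" if "y \<in> ins T a" for a y
    using that without_rank_le[OF T, of y a] without_top_letter[OF T, of y a] rank_x
    by (auto simp: ins_def split: if_splits)
qed

lemma remove_letter:
  assumes T: "T \<in> tabs D L (insert b P)" and xT: "x \<in> T b"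
  shows "T(b := T b - {x}) \<in> without"
proof -
  let ?U = "T(b := T b - {x})"
  have subset: "?U a \<subseteq> T a" for a by simp
  have "boxes ?U = (if T b = {x} then boxes T - {b} else boxes T)"
    using xT by (auto simp: boxes_def)
  then have "boxes ?U = D \<or> boxes ?U = D - {b}" using tabs_boxes[OF T] by simp
  moreover have "?U \<in> tabs (boxes ?U) L P"
  proof (rule tabsI[OF semistandard_subset[OF tabs_semistandard[OF T] subset] refl])
    fix y a
    assume y: "y \<in> ?U a"
    have yT: "y \<in> T a" using y subset by blast
    have "a \<noteq> b" if "prec_rank y = L"
    proof
      assume "a = b"
      then have "y \<noteq> x" using y by simp
      then show False
        using that rank_eq_L[OF semistandard_nonzero[OF tabs_semistandard[OF T] yT]] by simp
    qed
    then show "prec_rank y \<le> L \<and> (prec_rank y = L \<longrightarrow> a \<in> P)"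
      using tabs_rank_le[OF T yT] tabs_top_letter[OF T yT] by blast
  qed
  ultimately show ?thesis unfolding without_def by (elim disjE) simp_all
qed

lemma tabs_insert: "tabs D L (insert b P) = tabs D L P \<union> ins ` without"
proof (intro equalityI subsetI)
  fix T assume T: "T \<in> tabs D L (insert b P)"
  show "T \<in> tabs D L P \<union> ins ` without"
  proof (cases "x \<in> T b")
    case True
    then have "T = ins (T(b := T b - {x}))" by (simp add: ins_def insert_absorb)
    then show ?thesis using remove_letter[OF T True] by blast
  next
    case False
    have "T \<in> tabs D L P"
    proof (rule tabsI[OF tabs_semistandard[OF T] tabs_boxes[OF T]])
      fix y a
      assume y: "y \<in> T a"
      have "a \<noteq> b" if "prec_rank y = L"
        using rank_eq_L[OF semistandard_nonzero[OF tabs_semistandard[OF T] y]] that y False by auto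
      then show "prec_rank y \<le> L \<and> (prec_rank y = L \<longrightarrow> a \<in> P)"
        using tabs_rank_le[OF T y] tabs_top_letter[OF T y] by blast
    qed
    then show ?thesis by blast
  qed
next
  fix T assume "T \<in> tabs D L P \<union> ins ` without"
  then consider "T \<in> tabs D L P" | U where "U \<in> without" "T = ins U" by blast
  then show "T \<in> tabs D L (insert b P)"
    using ins_tabs by cases (auto simp: tabs_def)
qed

lemma inj_on_ins: "inj_on ins without"
proof (rule inj_onI)
  fix T U
  assume h: "T \<in> without" "U \<in> without" "ins T = ins U"
  have "(ins T)(b := ins T b - {x}) = T" if "T \<in> without" for T
    using without_letter[OF that] by (auto simp: ins_def)
  then show "T = U" using h by metis
qed

lemma tab_weight_ins:
  assumes "T \<in> without"
  shows "tab_weight D (ins T) = x_var (nat \<bar>x\<bar>) * (if T b = {} then 1 else beta_x) * tab_weight D T"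
  unfolding ins_def
  using finite_D b_mem semistandard_finite[OF without_semistandard[OF assms]] without_letter[OF assms]
  by (rule tab_weight_insert)

lemma tab_sum_corner:
  "tab_sum D L (insert b P) =
    tab_sum D L P + x_var (nat \<bar>x\<bar>) * (tab_sum (D - {b}) L P + beta_x * tab_sum D L P)"
proof -
  let ?A = "tabs D L P" and ?B = "tabs (D - {b}) L P"
  have nonempty: "T b \<noteq> {}" if "T \<in> ?A" for T using tabs_mem_iff[OF that] b_mem by blast
  have empty: "T b = {}" if "T \<in> ?B" for T using tabs_mem_iff[OF that] by blast
  have "x \<in> ins T b" for T by (simp add: ins_def)
  then have disjoint: "?A \<inter> ins ` without = {}" using without_letter unfolding without_def by blast
  have "(\<Sum>T\<in>ins ` without. tab_weight D T) = (\<Sum>T\<in>?A \<union> ?B. tab_weight D (ins T))"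
    using sum.reindex[OF inj_on_ins] by (simp add: without_def)
  also have "\<dots> = (\<Sum>T\<in>?A. tab_weight D (ins T)) + (\<Sum>T\<in>?B. tab_weight D (ins T))"
    using nonempty empty finite_D by (intro sum.union_disjoint finite_tabs) auto
  also have "(\<Sum>T\<in>?A. tab_weight D (ins T)) = (\<Sum>T\<in>?A. x_var (nat \<bar>x\<bar>) * beta_x * tab_weight D T)"
    using nonempty by (intro sum.cong refl) (simp add: tab_weight_ins without_def)
  also have "(\<Sum>T\<in>?B. tab_weight D (ins T)) = (\<Sum>T\<in>?B. x_var (nat \<bar>x\<bar>) * tab_weight (D - {b}) T)"
    using empty by (intro sum.cong refl)
      (simp add: tab_weight_ins without_def tab_weight_remove_empty[OF finite_D])
  finally have inserted: "(\<Sum>T\<in>ins ` without. tab_weight D T) =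
      x_var (nat \<bar>x\<bar>) * (tab_sum (D - {b}) L P + beta_x * tab_sum D L P)"
    by (simp add: tab_sum_def sum_distrib_left distrib_left mult.assoc)
  have "tab_sum D L (insert b P) = tab_sum D L P + (\<Sum>T\<in>ins ` without. tab_weight D T)"
    unfolding tab_sum_def tabs_insert using disjoint finite_D
    by (intro sum.union_disjoint) (simp_all add: finite_tabs without_def)
  then show ?thesis unfolding inserted .
qed

end

lemma prod_single:
  "(\<Prod>i\<in>A. Poly_Mapping.single (k i) (c i)) = Poly_Mapping.single (\<Sum>i\<in>A. k i) (\<Prod>i\<in>A. c i)"
  for k :: "'i \<Rightarrow> 'k::comm_monoid_add" and c :: "'i \<Rightarrow> 'a::comm_semiring_1"
  by (induction A rule: infinite_finite_induct) (simp_all add: mult_single)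

lemma power_single_0:
  "Poly_Mapping.single 0 c ^ k = Poly_Mapping.single (0 :: 'k::comm_monoid_add) (c ^ k)"
  for c :: "'a::comm_semiring_1"
  by (induction k) (simp_all add: mult_single)

lemma box_weight_eq_single:
  "box_weight S = Poly_Mapping.single (\<Sum>s\<in>S. Poly_Mapping.single (nat \<bar>s\<bar>) 1) (beta ^ (card S - 1))"
  by (simp add: box_weight_def x_var_def beta_x_def prod_single power_single_0 mult_single)

lemma tab_weight_eq_single:
  assumes "semistandard T"
  shows "tab_weight (boxes T) T =
    Poly_Mapping.single (\<Sum>b\<in>boxes T. \<Sum>s\<in>T b. Poly_Mapping.single (nat \<bar>s\<bar>) 1)
      (beta ^ ((\<Sum>b\<in>boxes T. card (T b)) - card (boxes T)))"
proof -
  have "1 \<le> card (T b)" if "b \<in> boxes T" for b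
    using that semistandard_finite[OF assms, of b] by (simp add: boxes_def Suc_le_eq card_gt_0_iff)
  then have "(\<Sum>b\<in>boxes T. card (T b) - 1) = (\<Sum>b\<in>boxes T. card (T b)) - card (boxes T)"
    using sum_subtractf_nat[of "boxes T" "\<lambda>b. 1" "\<lambda>b. card (T b)"] by simp
  then show ?thesis
    by (simp add: tab_weight_def box_weight_eq_single prod_single flip: power_sum)
qed

section \<open>Shifted shapes\<close>

text \<open>A strict partition is given by its set \<open>\<Lambda>\<close> of parts. The box \<open>(i, j)\<close> has content \<open>j - i\<close>.\<close>

definition num_parts_above :: "nat set \<Rightarrow> nat \<Rightarrow> nat" where
  "num_parts_above \<Lambda> c = card {l \<in> \<Lambda>. c < l}"

definition shifted_shape :: "nat set \<Rightarrow> (nat \<times> nat) set" where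
  "shifted_shape \<Lambda> = {(i, j). 1 \<le> i \<and> i \<le> j \<and> i \<le> num_parts_above \<Lambda> (j - i)}"

definition content :: "nat \<times> nat \<Rightarrow> nat" where
  "content a = snd a - fst a"

definition lower_part :: "nat \<Rightarrow> nat set \<Rightarrow> nat set" where
  "lower_part c \<Lambda> = (\<Lambda> - {Suc c}) \<union> ({c} - {0})"

definition corner_box :: "nat set \<Rightarrow> nat \<Rightarrow> nat \<times> nat" where
  "corner_box \<Lambda> c = (num_parts_above \<Lambda> c, num_parts_above \<Lambda> c + c)"

lemma content_corner_box: "content (corner_box \<Lambda> c) = c"
  by (simp add: content_def corner_box_def)

lemma num_parts_above_Suc:
  assumes "finite \<Lambda>"
  shows "num_parts_above \<Lambda> c = num_parts_above \<Lambda> (Suc c) + (if Suc c \<in> \<Lambda> then 1 else 0)"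
proof (cases "Suc c \<in> \<Lambda>")
  case True
  then have "{l \<in> \<Lambda>. c < l} = insert (Suc c) {l \<in> \<Lambda>. Suc c < l}" by auto
  then show ?thesis using True assms by (simp add: num_parts_above_def)
next
  case False
  then have "{l \<in> \<Lambda>. c < l} = {l \<in> \<Lambda>. Suc c < l}" by (auto simp: less_Suc_eq) (metis Suc_lessI)
  then show ?thesis using False by (simp add: num_parts_above_def)
qed

lemma num_parts_above_lower_part:
  assumes \<Lambda>: "finite \<Lambda>" and c: "Suc c \<in> \<Lambda>" "c \<notin> \<Lambda>"
  shows "num_parts_above (lower_part c \<Lambda>) d =
    (if d = c then num_parts_above \<Lambda> d - 1 else num_parts_above \<Lambda> d)"
proof -
  consider "d < c" | "d = c" | "c < d" by linarith
  then show ?thesis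
  proof cases
    case 1
    have "{l \<in> lower_part c \<Lambda>. d < l} = insert c ({l \<in> \<Lambda>. d < l} - {Suc c})"
      using 1 by (auto simp: lower_part_def)
    then have "num_parts_above (lower_part c \<Lambda>) d = Suc (card ({l \<in> \<Lambda>. d < l} - {Suc c}))"
      using c \<Lambda> by (simp add: num_parts_above_def)
    also have "\<dots> = num_parts_above \<Lambda> d"
      unfolding num_parts_above_def using c \<Lambda> 1 by (intro card_Suc_Diff1) auto
    finally show ?thesis using 1 by simp
  next
    case 2
    have "{l \<in> lower_part c \<Lambda>. d < l} = {l \<in> \<Lambda>. d < l} - {Suc c}"
      using 2 by (auto simp: lower_part_def)
    then show ?thesis using 2 c \<Lambda> by (simp add: num_parts_above_def)
  next
    case 3
    have "{l \<in> lower_part c \<Lambda>. d < l} = {l \<in> \<Lambda>. d < l}" using 3 by (auto simp: lower_part_def)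
    then show ?thesis using 3 by (simp add: num_parts_above_def)
  qed
qed

lemma shifted_shape_content_less: "a \<in> shifted_shape \<Lambda> \<Longrightarrow> \<exists>l\<in>\<Lambda>. content a < l"
proof -
  assume "a \<in> shifted_shape \<Lambda>"
  then have "0 < card {l \<in> \<Lambda>. content a < l}"
    by (auto simp: shifted_shape_def num_parts_above_def content_def)
  then show "\<exists>l\<in>\<Lambda>. content a < l" by (auto simp: card_gt_0_iff)
qed

lemma finite_shifted_shape: assumes "finite \<Lambda>" shows "finite (shifted_shape \<Lambda>)"
proof (rule finite_subset)
  show "shifted_shape \<Lambda> \<subseteq> {..card \<Lambda>} \<times> {..card \<Lambda> + Max (insert 0 \<Lambda>)}"
  proof
    fix a
    assume a: "a \<in> shifted_shape \<Lambda>"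
    obtain l where l: "l \<in> \<Lambda>" "content a < l" using shifted_shape_content_less[OF a] by blast
    have "num_parts_above \<Lambda> (content a) \<le> card \<Lambda>"
      unfolding num_parts_above_def by (rule card_mono) (use assms in auto)
    then have "fst a \<le> card \<Lambda>" using a by (auto simp: shifted_shape_def content_def)
    moreover have "l \<le> Max (insert 0 \<Lambda>)" using l assms by simp
    ultimately show "a \<in> {..card \<Lambda>} \<times> {..card \<Lambda> + Max (insert 0 \<Lambda>)}"
      using l(2) by (cases a) (simp add: content_def)
  qed
qed simp

lemma corner_box_mem: "finite \<Lambda> \<Longrightarrow> Suc c \<in> \<Lambda> \<Longrightarrow> corner_box \<Lambda> c \<in> shifted_shape \<Lambda>"
  using num_parts_above_Suc[of \<Lambda> c] by (simp add: shifted_shape_def corner_box_def)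

lemma shifted_shape_empty_iff: assumes "finite \<Lambda>" "0 \<notin> \<Lambda>" shows "shifted_shape \<Lambda> = {} \<longleftrightarrow> \<Lambda> = {}"
proof
  assume empty: "shifted_shape \<Lambda> = {}"
  have "l \<notin> \<Lambda>" for l using corner_box_mem[OF assms(1), of "l - 1"] empty assms(2) by (cases l) auto
  then show "\<Lambda> = {}" by blast
next
  assume "\<Lambda> = {}"
  then show "shifted_shape \<Lambda> = {}" by (auto simp: shifted_shape_def num_parts_above_def)
qed

lemma shifted_shape_corner_iff:
  assumes \<Lambda>: "finite \<Lambda>" "0 \<notin> \<Lambda>" and a: "(i, j) \<in> shifted_shape \<Lambda>"
  defines "c \<equiv> content (i, j)"
  shows "(i, j + 1) \<notin> shifted_shape \<Lambda> \<and> (i + 1, j) \<notin> shifted_shape \<Lambda> \<longleftrightarrow>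
    Suc c \<in> \<Lambda> \<and> c \<notin> \<Lambda> \<and> (i, j) = corner_box \<Lambda> c"
proof -
  have ij: "1 \<le> i" "i \<le> num_parts_above \<Lambda> c" "j = i + c"
    using a by (auto simp: shifted_shape_def content_def c_def)
  have right: "(i, j + 1) \<in> shifted_shape \<Lambda> \<longleftrightarrow> i \<le> num_parts_above \<Lambda> (Suc c)"
    using ij by (simp add: shifted_shape_def)
  show ?thesis
  proof (cases c)
    case 0
    then have "(i + 1, j) \<notin> shifted_shape \<Lambda>" using ij by (simp add: shifted_shape_def)
    then show ?thesis
      using right ij num_parts_above_Suc[OF \<Lambda>(1), of c] 0 \<Lambda>(2) by (auto simp: corner_box_def)
  next
    case (Suc d)
    then have "j - (i + 1) = d" using ij by simp
    then have "(i + 1, j) \<in> shifted_shape \<Lambda> \<longleftrightarrow> i + 1 \<le> num_parts_above \<Lambda> d"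
      using ij Suc by (simp add: shifted_shape_def)
    then show ?thesis
      using right ij num_parts_above_Suc[OF \<Lambda>(1), of c] num_parts_above_Suc[OF \<Lambda>(1), of d] Suc
      by (auto simp: corner_box_def split: if_splits)
  qed
qed

lemma shifted_shape_lower_part:
  assumes "finite \<Lambda>" "Suc c \<in> \<Lambda>" "c \<notin> \<Lambda>"
  shows "shifted_shape (lower_part c \<Lambda>) = shifted_shape \<Lambda> - {corner_box \<Lambda> c}"
  using num_parts_above_Suc[OF assms(1), of c] assms
  by (auto simp: shifted_shape_def corner_box_def num_parts_above_lower_part split: if_splits)

lemma le_num_parts_above_iff:
  assumes "sorted_wrt (>) lam" "1 \<le> i"
  shows "i \<le> num_parts_above (set lam) c \<longleftrightarrow> i \<le> length lam \<and> c < lam ! (i - 1)"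
  using assms
proof (induction lam arbitrary: i)
  case Nil
  then show ?case by (simp add: num_parts_above_def)
next
  case (Cons a lam)
  have less: "l < a" if "l \<in> set lam" for l using Cons.prems that by simp
  show ?case
  proof (cases "c < a")
    case True
    then have "{l \<in> set (a # lam). c < l} = insert a {l \<in> set lam. c < l}" by auto
    then have "num_parts_above (set (a # lam)) c = Suc (num_parts_above (set lam) c)"
      using less[of a] by (simp add: num_parts_above_def) (subst card_insert_disjoint, auto)
    moreover obtain k where "i = Suc k" using Cons.prems(2) by (cases i) auto
    ultimately show ?thesis using Cons.IH[of k] Cons.prems True by (cases k) auto
  next
    case False
    have le: "l \<le> a" if "l \<in> set (a # lam)" for l using less that by (auto simp: le_less)
    have "{l \<in> set (a # lam). c < l} = {}" using False le by fastforce
    then have none: "num_parts_above (set (a # lam)) c = 0"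
      by (simp only: num_parts_above_def card.empty)
    have "(a # lam) ! (i - 1) \<le> a" if "i \<le> length (a # lam)"
      using that Cons.prems(2) by (intro le nth_mem) simp
    then show ?thesis using none False Cons.prems(2) by auto
  qed
qed

lemma shifted_diagram_eq_shifted_shape:
  assumes "sorted_wrt (>) lam" shows "shifted_diagram lam = shifted_shape (set lam)"
proof (rule set_eqI)
  fix a :: "nat \<times> nat"
  obtain i j where a: "a = (i, j)" by (cases a)
  show "a \<in> shifted_diagram lam \<longleftrightarrow> a \<in> shifted_shape (set lam)"
    using le_num_parts_above_iff[OF assms, of i "j - i"]
    unfolding a shifted_diagram_def shifted_shape_def by auto
qed

lemma exists_strict_partition:
  assumes "finite \<Lambda>" "0 \<notin> \<Lambda>"
  shows "\<exists>lam. strict_partition lam \<and> shifted_diagram lam = shifted_shape \<Lambda>"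
proof -
  let ?lam = "rev (sorted_list_of_set \<Lambda>)"
  have "sorted_wrt (>) ?lam" "set ?lam = \<Lambda>" using assms(1) by (simp_all add: sorted_wrt_rev)
  then show ?thesis
    using assms(2) shifted_diagram_eq_shifted_shape[of ?lam]
    by (intro exI[of _ ?lam]) (auto simp: strict_partition_def intro: Nat.gr0I)
qed

lemma card_shifted_diagram: "card (shifted_diagram lam) = sum_list lam"
proof -
  have rows: "shifted_diagram lam = Sigma {1..length lam} (\<lambda>i. {i..lam ! (i - 1) + i - 1})"
    by (auto simp: shifted_diagram_def)
  have "card (shifted_diagram lam) = (\<Sum>i = 1..length lam. card {i..lam ! (i - 1) + i - 1})"
    unfolding rows by (rule card_SigmaI) auto
  also have "\<dots> = (\<Sum>i = 1..length lam. lam ! (i - 1))" by (rule sum.cong) auto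
  also have "\<dots> = (\<Sum>i<length lam. lam ! i)"
    by (rule sum.reindex_bij_witness[of _ Suc "\<lambda>i. i - 1"]) auto
  finally show ?thesis by (simp add: sum_list_sum_nth atLeast0LessThan)
qed

text \<open>Letters \<open>k\<close> are entered by increasing content, letters \<open>-k\<close> by decreasing content.\<close>

definition earlier :: "int \<Rightarrow> nat \<Rightarrow> (nat \<times> nat) set" where
  "earlier x c = (if 0 < x then {a. content a < c} else {a. c < content a})"

lemma top_letter_at_corner:
  assumes \<Lambda>: "finite \<Lambda>" "0 \<notin> \<Lambda>" and x: "x \<noteq> 0"
    and T: "T \<in> tabs (shifted_shape \<Lambda>) (prec_rank x) (earlier x c \<union> {a. content a = c})"
    and y: "y \<in> T a" "prec_rank y = prec_rank x" and a: "content a = c"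
  shows "a = corner_box \<Lambda> c \<and> Suc c \<in> \<Lambda> \<and> c \<notin> \<Lambda>"
proof -
  let ?D = "shifted_shape \<Lambda>"
  note ss = tabs_semistandard[OF T]
  obtain i j where ij: "a = (i, j)" by (cases a)
  have mem: "(i, j) \<in> ?D" using tabs_mem_iff[OF T] y(1) ij by blast
  have j: "j = i + c" using mem a ij by (auto simp: shifted_shape_def content_def)
  have yx: "y = x" using prec_rank_eq_iff[OF semistandard_nonzero[OF ss y(1)] x] y(2) by simp
  have "(i, j + 1) \<notin> ?D"
  proof
    assume "(i, j + 1) \<in> ?D"
    then obtain z where z: "z \<in> T (i, j + 1)" using tabs_mem_iff[OF T] by blast
    have "z = x" "0 < x" using semistandard_right[OF ss y(1)[unfolded ij] z] tabs_rank_le[OF T z] yx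
      by auto
    then show False using tabs_top_letter[OF T z] j by (simp add: earlier_def content_def)
  qed
  moreover have "(i + 1, j) \<notin> ?D"
  proof
    assume below: "(i + 1, j) \<in> ?D"
    then obtain z where z: "z \<in> T (i + 1, j)" using tabs_mem_iff[OF T] by blast
    have "z = x" "x < 0" using semistandard_below[OF ss y(1)[unfolded ij] z] tabs_rank_le[OF T z] yx
      by auto
    then show False
      using tabs_top_letter[OF T z] j below
      by (auto simp: earlier_def content_def shifted_shape_def)
  qed
  ultimately show ?thesis using shifted_shape_corner_iff[OF \<Lambda> mem] a ij by auto
qed

lemma tab_sum_content_step:
  fixes x :: int and c :: nat
  assumes \<Lambda>: "finite \<Lambda>" "0 \<notin> \<Lambda>" and x: "x \<noteq> 0"
  defines "D \<equiv> shifted_shape \<Lambda>" and "L \<equiv> prec_rank x" and "P \<equiv> earlier x c"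
  shows "tab_sum D L (P \<union> {a. content a = c}) = tab_sum D L P +
    (if Suc c \<in> \<Lambda> \<and> c \<notin> \<Lambda>
     then x_var (nat \<bar>x\<bar>) * (tab_sum (shifted_shape (lower_part c \<Lambda>)) L P + beta_x * tab_sum D L P)
     else 0)"
proof -
  let ?Q = "P \<union> {a. content a = c}"
  have at_corner: "a = corner_box \<Lambda> c \<and> Suc c \<in> \<Lambda> \<and> c \<notin> \<Lambda>"
    if "T \<in> tabs D L ?Q" "y \<in> T a" "prec_rank y = L" "content a = c" for T a y
    using that top_letter_at_corner[OF \<Lambda> x] unfolding D_def L_def P_def by blast
  show ?thesis
  proof (cases "Suc c \<in> \<Lambda> \<and> c \<notin> \<Lambda>")
    case True
    let ?i = "num_parts_above \<Lambda> c"
    have mem: "corner_box \<Lambda> c \<in> D" unfolding D_def using corner_box_mem \<Lambda> True by blast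
    interpret tableau_corner D P ?i "?i + c" "corner_box \<Lambda> c" x L
    proof unfold_locales
      show "corner_box \<Lambda> c \<equiv> (?i, ?i + c)" by (simp add: corner_box_def)
      show "(?i, ?i + c + 1) \<notin> D" "(?i + 1, ?i + c) \<notin> D"
        using shifted_shape_corner_iff[OF \<Lambda> mem[unfolded D_def corner_box_def]] True
        by (simp_all add: D_def content_def corner_box_def)
      show "(?i, ?i + c) \<in> D" using mem by (simp add: corner_box_def)
    qed (use x finite_shifted_shape[OF \<Lambda>(1)] content_corner_box[of \<Lambda> c] in
        \<open>auto simp: D_def L_def P_def earlier_def content_def split: if_splits\<close>)
    have "tabs D L ?Q = tabs D L (insert (corner_box \<Lambda> c) P)"
      by (rule tabs_restrict) (use at_corner tabs_top_letter content_corner_box in blast)+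
    then have "tab_sum D L ?Q = tab_sum D L (insert (corner_box \<Lambda> c) P)" by (simp add: tab_sum_def)
    then show ?thesis
      using tab_sum_corner True by (simp add: shifted_shape_lower_part[OF \<Lambda>(1)] D_def)
  next
    case False
    have "tabs D L ?Q = tabs D L P"
      by (rule tabs_restrict) (use at_corner tabs_top_letter False in blast)+
    then show ?thesis unfolding if_not_P[OF False] by (simp add: tab_sum_def)
  qed
qed

section \<open>The Grassmannian case\<close>

definition grassmannian :: "(int \<Rightarrow> int) \<Rightarrow> bool" where
  "grassmannian w \<longleftrightarrow> signed_perm w \<and> (\<forall>p q. p < q \<longrightarrow> 0 < w p \<longrightarrow> 0 < w q \<longrightarrow> w p < w q)"

definition neg_positions :: "(int \<Rightarrow> int) \<Rightarrow> nat set" where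
  "neg_positions w = {j. 0 < j \<and> w (int j) < 0}"

lemma grassmannian_signed_perm: "grassmannian w \<Longrightarrow> signed_perm w"
  and grassmannian_less: "grassmannian w \<Longrightarrow> p < q \<Longrightarrow> 0 < w p \<Longrightarrow> 0 < w q \<Longrightarrow> w p < w q"
  unfolding grassmannian_def by blast+

lemma grassmannian_inv:
  assumes "signed_perm h" "strict_mono_on {0<..} h" shows "grassmannian (inv h)"
  unfolding grassmannian_def
proof (intro conjI allI impI)
  show "signed_perm (inv h)" using signed_perm_inv[OF assms(1)] .
  show "inv h p < inv h q" if "p < q" "0 < inv h p" "0 < inv h q" for p q
    using strict_mono_on_less[OF assms(2), of "inv h p" "inv h q"] that
    by (simp add: signed_perm_apply_inv[OF assms(1)])
qed

lemma zero_notin_neg_positions: "0 \<notin> neg_positions w" by (simp add: neg_positions_def)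

lemma neg_positions_le: "w \<in> signed_perms m \<Longrightarrow> j \<in> neg_positions w \<Longrightarrow> j \<le> m"
  using signed_perms_fixes[of w m "int j"] by (fastforce simp: neg_positions_def)

lemma finite_neg_positions: assumes "w \<in> signed_perms m" shows "finite (neg_positions w)"
  by (rule finite_subset[of _ "{..m}"]) (use neg_positions_le[OF assms] in auto)

lemma grassmannian_descent_iff:
  assumes g: "grassmannian w"
  shows "descent w c \<longleftrightarrow> Suc c \<in> neg_positions w \<and> c \<notin> neg_positions w"
proof -
  note minus = signed_perm_minus[OF grassmannian_signed_perm[OF g]]
  have nonzero: "w x \<noteq> 0" if "x \<noteq> 0" for x
    using signed_perm_eq_0_iff[OF grassmannian_signed_perm[OF g]] that by simp
  show ?thesis
  proof (cases "c = 0")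
    case True
    then show ?thesis using minus[of 1] by (simp add: neg_positions_def gen_left_def gen_right_def)
  next
    case False
    have pos: "w (int c) < w (int c + 1)" if "0 < w (int c)" "0 < w (int c + 1)"
      using grassmannian_less[OF g _ that] by simp
    have neg: "w (int c) < w (int c + 1)" if "w (int c) < 0" "w (int c + 1) < 0"
      using grassmannian_less[OF g, of "- (int c + 1)" "- int c"] that minus[of "int c"] minus[of "int c + 1"]
      by simp
    have Suc: "int (Suc c) = int c + 1" by simp
    show ?thesis
      using pos neg nonzero[of "int c"] nonzero[of "int c + 1"] False
      unfolding neg_positions_def gen_left_def gen_right_def mem_Collect_eq Suc by fastforce
  qed
qed

lemma grassmannian_comp_cox_gen:
  assumes g: "grassmannian w" and d: "descent w c" shows "grassmannian (w \<circ> cox_gen c)"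
  unfolding grassmannian_def
proof (intro conjI allI impI)
  note w = grassmannian_signed_perm[OF g]
  show "signed_perm (w \<circ> cox_gen c)" by (rule signed_perm_comp[OF w signed_perm_cox_gen])
  fix p q
  assume pq: "p < q" and p: "0 < (w \<circ> cox_gen c) p" and q: "0 < (w \<circ> cox_gen c) q"
  show "(w \<circ> cox_gen c) p < (w \<circ> cox_gen c) q"
  proof (cases "cox_gen c p < cox_gen c q")
    case True
    then show ?thesis using grassmannian_less[OF g True] p q by simp
  next
    case False
    have "p \<noteq> 0" "q \<noteq> 0" using p q signed_perm_0[OF w] signed_perm_0[OF signed_perm_cox_gen] by auto
    then have "(p, q) = (gen_left c, gen_right c) \<or> (p, q) = (- gen_right c, - gen_left c)"
      using False pq by (intro cox_gen_reverses)
    then show ?thesis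
      using d signed_perm_minus[OF w] signed_perm_minus[OF signed_perm_cox_gen]
      by (auto simp: cox_gen_gen_left cox_gen_gen_right)
  qed
qed

lemma neg_positions_comp_cox_gen:
  assumes g: "grassmannian w" and d: "descent w c"
  shows "neg_positions (w \<circ> cox_gen c) = lower_part c (neg_positions w)"
proof (rule set_eqI)
  fix j
  note w = grassmannian_signed_perm[OF g]
  have mem: "Suc c \<in> neg_positions w" "c \<notin> neg_positions w"
    using grassmannian_descent_iff[OF g] d by auto
  then have neg: "w (int c + 1) < 0" by (simp add: neg_positions_def add.commute)
  have pos: "w (int c) > 0" if "c \<noteq> 0"
    using mem(2) that signed_perm_eq_0_iff[OF w, of "int c"] by (simp add: neg_positions_def)
  consider "j = Suc c" | "j = c" "c \<noteq> 0" | "j = 0" | "j \<noteq> 0" "j \<noteq> c" "j \<noteq> Suc c" by blast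
  then show "j \<in> neg_positions (w \<circ> cox_gen c) \<longleftrightarrow> j \<in> lower_part c (neg_positions w)"
  proof cases
    case 1
    have "cox_gen c (int j) = gen_left c"
      using cox_gen_gen_right[of c] 1 by (simp add: gen_right_def add.commute)
    then show ?thesis
      using 1 pos neg signed_perm_minus[OF w, of 1]
      by (auto simp: neg_positions_def lower_part_def gen_left_def)
  next
    case 2
    then have "cox_gen c (int j) = gen_right c"
      using cox_gen_gen_left[of c] by (simp add: gen_left_def)
    then show ?thesis using 2 neg by (simp add: neg_positions_def lower_part_def gen_right_def)
  next
    case 3
    then show ?thesis by (auto simp: neg_positions_def lower_part_def)
  next
    case 4
    then have "cox_gen c (int j) = int j" by (auto simp: cox_gen_apply gen_left_def gen_right_def)
    then show ?thesis using 4 by (simp add: neg_positions_def lower_part_def)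
  qed
qed

lemma neg_positions_empty_iff:
  assumes "w \<in> signed_perms m" "grassmannian w" shows "neg_positions w = {} \<longleftrightarrow> w = id"
proof
  assume "neg_positions w = {}"
  then show "w = id" using no_descent_imp_id[OF assms(1)] grassmannian_descent_iff[OF assms(2)]
    by simp
qed (simp add: neg_positions_def)

definition on_grassmannians ::
    "nat \<Rightarrow> ((int \<Rightarrow> int) \<Rightarrow> x_polynomial) \<Rightarrow> (nat set \<Rightarrow> x_polynomial) \<Rightarrow> bool" where
  "on_grassmannians m f F \<longleftrightarrow> (\<forall>w\<in>signed_perms m. grassmannian w \<longrightarrow> f w = F (neg_positions w))"

lemma on_grassmannians_cong:
  "on_grassmannians m f F \<Longrightarrow>
    (\<And>w. w \<in> signed_perms m \<Longrightarrow> F (neg_positions w) = G (neg_positions w)) \<Longrightarrow> on_grassmannians m f G"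
  unfolding on_grassmannians_def by simp

lemma on_grassmannians_one_plus:
  assumes f: "on_grassmannians m f F" and c: "c < m"
    and G: "\<And>\<Lambda>. finite \<Lambda> \<Longrightarrow> 0 \<notin> \<Lambda> \<Longrightarrow>
      G \<Lambda> = F \<Lambda> + (if Suc c \<in> \<Lambda> \<and> c \<notin> \<Lambda> then x * (F (lower_part c \<Lambda>) + beta_x * F \<Lambda>) else 0)"
  shows "on_grassmannians m (one_plus (u_mult beta_x) x c f) G"
  unfolding on_grassmannians_def
proof (intro ballI impI)
  fix w
  assume w: "w \<in> signed_perms m" and g: "grassmannian w"
  have "f w = F (neg_positions w)" using f w g unfolding on_grassmannians_def by blast
  moreover have "f (w \<circ> cox_gen c) = F (lower_part c (neg_positions w))" if d: "descent w c"
    using f signed_perms_comp[OF w signed_perms_cox_gen[OF c]] grassmannian_comp_cox_gen[OF g d]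
    unfolding on_grassmannians_def neg_positions_comp_cox_gen[OF g d, symmetric] by blast
  ultimately show "one_plus (u_mult beta_x) x c f w = G (neg_positions w)"
    unfolding one_plus_def u_mult_apply G[OF finite_neg_positions[OF w] zero_notin_neg_positions]
    using grassmannian_signed_perm[OF g] grassmannian_descent_iff[OF g, of c]
    by (auto simp del: o_apply)
qed

lemma on_grassmannians_content_step:
  assumes "x \<noteq> 0" "c < m"
    "on_grassmannians m f (\<lambda>\<Lambda>. tab_sum (shifted_shape \<Lambda>) (prec_rank x) (earlier x c))"
  shows "on_grassmannians m (one_plus (u_mult beta_x) (x_var (nat \<bar>x\<bar>)) c f)
    (\<lambda>\<Lambda>. tab_sum (shifted_shape \<Lambda>) (prec_rank x) (earlier x c \<union> {a. content a = c}))"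
  by (rule on_grassmannians_one_plus[OF assms(3,2)]) (rule tab_sum_content_step[OF _ _ assms(1)])

lemma on_grassmannians_negative_letter:
  assumes "k \<le> m" "0 < N"
    "on_grassmannians m f (\<lambda>\<Lambda>. tab_sum (shifted_shape \<Lambda>) (prec_rank (- int N)) {a. k \<le> content a})"
  shows "on_grassmannians m (fold (one_plus (u_mult beta_x) (x_var N)) (rev [0..<k]) f)
    (\<lambda>\<Lambda>. tab_sum (shifted_shape \<Lambda>) (prec_rank (- int N)) UNIV)"
  using assms
proof (induction k arbitrary: f)
  case (Suc k)
  have "earlier (- int N) k = {a. Suc k \<le> content a}"
    "{a. Suc k \<le> content a} \<union> {a. content a = k} = {a. k \<le> content a}"
    by (auto simp: earlier_def)
  then have "on_grassmannians m (one_plus (u_mult beta_x) (x_var N) k f)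
      (\<lambda>\<Lambda>. tab_sum (shifted_shape \<Lambda>) (prec_rank (- int N)) {a. k \<le> content a})"
    using on_grassmannians_content_step[of "- int N" k m f] Suc.prems by simp
  then show ?case using Suc.IH Suc.prems(1,2) by simp
qed simp

lemma on_grassmannians_positive_letter:
  assumes "k \<le> m" "0 < N"
    and f: "on_grassmannians m f (\<lambda>\<Lambda>. tab_sum (shifted_shape \<Lambda>) (prec_rank (int N)) {})"
  shows "on_grassmannians m (fold (one_plus (u_mult beta_x) (x_var N)) [0..<k] f)
    (\<lambda>\<Lambda>. tab_sum (shifted_shape \<Lambda>) (prec_rank (int N)) {a. content a < k})"
  using assms(1,2)
proof (induction k)
  case 0
  then show ?case using f by simp
next
  case (Suc k)
  have "earlier (int N) k = {a. content a < k}"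
    "{a. content a < k} \<union> {a. content a = k} = {a. content a < Suc k}"
    using Suc.prems by (auto simp: earlier_def)
  then show ?case
    using on_grassmannians_content_step[of "int N" k m] Suc by simp
qed

lemma gen_fun_0_grassmannian:
  "on_grassmannians m (gen_fun m 0) (\<lambda>\<Lambda>. tab_sum (shifted_shape \<Lambda>) 0 UNIV)"
  unfolding on_grassmannians_def
proof (intro ballI impI)
  fix w
  assume w: "w \<in> signed_perms m" "grassmannian w"
  have "shifted_shape (neg_positions w) = {} \<longleftrightarrow> w = id"
    using shifted_shape_empty_iff[OF finite_neg_positions[OF w(1)] zero_notin_neg_positions]
      neg_positions_empty_iff[OF w] by blast
  then show "gen_fun m 0 w = tab_sum (shifted_shape (neg_positions w)) 0 UNIV"
    by (auto simp: gen_fun_0 delta_def tab_sum_empty tab_sum_no_letters)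
qed

lemma gen_fun_grassmannian:
  "on_grassmannians m (gen_fun m N) (\<lambda>\<Lambda>. tab_sum (shifted_shape \<Lambda>) (2 * int N) UNIV)"
proof (induction N)
  case 0
  then show ?case using gen_fun_0_grassmannian by simp
next
  case (Suc N)
  let ?S = "\<lambda>L P \<Lambda>. tab_sum (shifted_shape \<Lambda>) L P"
    and ?fold = "fold (one_plus (u_mult beta_x) (x_var (Suc N)))"
    and ?neg = "prec_rank (- int (Suc N))" and ?pos = "prec_rank (int (Suc N))"
  have ranks: "?neg = 2 * int N + 1" "?pos = 2 * int N + 1 + 1" by (simp_all add: prec_rank_def)
  have content_less: "content a < m"
    if "w \<in> signed_perms m" "a \<in> shifted_shape (neg_positions w)" for w a
    using shifted_shape_content_less[OF that(2)] neg_positions_le[OF that(1)] by fastforce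
  have "on_grassmannians m (gen_fun m N) (?S ?neg {a. m \<le> content a})"
    unfolding ranks
    by (rule on_grassmannians_cong[OF Suc.IH], rule tab_sum_next_letter[symmetric])
       (use content_less in fastforce)
  then have "on_grassmannians m (?fold (rev [0..<m]) (gen_fun m N)) (?S ?neg UNIV)"
    by (rule on_grassmannians_negative_letter[OF order_refl zero_less_Suc])
  then have "on_grassmannians m (?fold (rev [0..<m]) (gen_fun m N)) (?S ?pos {})"
    unfolding ranks by (rule on_grassmannians_cong) (rule tab_sum_next_letter[symmetric], simp)
  then have "on_grassmannians m (?fold [0..<m] (?fold (rev [0..<m]) (gen_fun m N)))
      (?S ?pos {a. content a < m})"
    by (rule on_grassmannians_positive_letter[OF order_refl zero_less_Suc])
  then have "on_grassmannians m (gen_fun m (Suc N)) (?S ?pos {a. content a < m})"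
    by (simp add: gen_fun_Suc palindromic_factor_def)
  then have "on_grassmannians m (gen_fun m (Suc N)) (?S ?pos UNIV)"
    by (rule on_grassmannians_cong) (rule tab_sum_whole_shape[symmetric], use content_less in blast)
  then show ?case by (simp add: prec_rank_def)
qed

section \<open>Comparison with \<open>GQ\<close>\<close>

lemma abs_letter_in_keys:
  assumes "semistandard T" "boxes T = shifted_diagram lam" "finite (shifted_diagram lam)" "x \<in> T b"
  shows "nat \<bar>x\<bar> \<in> Poly_Mapping.keys (tableau_monomial lam T)"
proof -
  let ?e = "\<lambda>s. Poly_Mapping.lookup (Poly_Mapping.single (nat \<bar>s\<bar>) (1::nat)) (nat \<bar>x\<bar>)"
  have "b \<in> shifted_diagram lam" using assms(2,4) by (auto simp: boxes_def)
  have "0 < ?e x" by simp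
  also have "\<dots> \<le> (\<Sum>s\<in>T b. ?e s)"
    by (rule member_le_sum[OF assms(4) _ semistandard_finite[OF assms(1)]]) simp
  also have "\<dots> \<le> (\<Sum>b\<in>shifted_diagram lam. \<Sum>s\<in>T b. ?e s)"
    by (rule member_le_sum[OF \<open>b \<in> shifted_diagram lam\<close> _ assms(3)]) simp
  finally show ?thesis by (simp add: tableau_monomial_def lookup_sum in_keys_iff)
qed

lemma lookup_tab_sum:
  assumes keys: "\<forall>i\<in>Poly_Mapping.keys m. i \<le> N" and fin: "finite (shifted_diagram lam)"
  shows "Poly_Mapping.lookup (tab_sum (shifted_diagram lam) (2 * int N) UNIV) m = GQ lam m"
proof -
  let ?tabs = "tabs (shifted_diagram lam) (2 * int N) UNIV"
  have "T \<in> set_valued_tableaux lam \<longleftrightarrow> T \<in> ?tabs" if T: "tableau_monomial lam T = m" for T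
  proof -
    have "prec_rank x \<le> 2 * int N"
      if "semistandard T" "boxes T = shifted_diagram lam" "x \<in> T b" for x b
    proof -
      have "nat \<bar>x\<bar> \<le> N" using abs_letter_in_keys[OF that(1,2) fin that(3)] T keys by blast
      then have "\<bar>x\<bar> \<le> int N" by linarith
      then show ?thesis by (auto simp: prec_rank_def)
    qed
    then show ?thesis unfolding set_valued_tableaux_iff tabs_def by blast
  qed
  then have "GQ lam m =
      (\<Sum>T | T \<in> ?tabs \<and> tableau_monomial lam T = m. beta ^ (tableau_size lam T - sum_list lam))"
    unfolding GQ_def by (metis (mono_tags, lifting))
  also have "\<dots> = (\<Sum>T\<in>?tabs. if tableau_monomial lam T = m
      then beta ^ (tableau_size lam T - sum_list lam) else 0)"
    by (rule sum.inter_filter[OF finite_tabs[OF fin]])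
  also have "\<dots> = (\<Sum>T\<in>?tabs. Poly_Mapping.lookup (tab_weight (shifted_diagram lam) T) m)"
  proof (rule sum.cong[OF refl])
    fix T
    assume T: "T \<in> ?tabs"
    then show "(if tableau_monomial lam T = m then beta ^ (tableau_size lam T - sum_list lam) else 0) =
        Poly_Mapping.lookup (tab_weight (shifted_diagram lam) T) m"
      using tab_weight_eq_single[OF tabs_semistandard[OF T]] unfolding tabs_boxes[OF T]
      by (simp add: lookup_single when_def tableau_monomial_def tableau_size_def card_shifted_diagram)
  qed
  finally show ?thesis by (simp add: tab_sum_def lookup_sum)
qed

lemma reduce_to_grassmannian:
  assumes "w \<in> signed_perms n" "vexillary n w"
  obtains m u where "n \<le> m" "u \<in> signed_perms m" "grassmannian u"
    "\<And>N. gen_fun m N w = gen_fun m N u"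
proof -
  interpret vexillary_perm n w using assms by unfold_locales
  have "strict_mono_on {int n<..} (inv w)"
    using signed_perms_fixes[OF signed_perms_inv[OF assms(1)]] by (simp add: strict_mono_on_def)
  then obtain m h where h: "n \<le> m" "h \<in> signed_perms m" "strict_mono_on {0<..} h"
    "same_gen_fun m (inv w) h"
    using reduce_to_increasing[OF signed_perms_inv[OF assms(1)]
        vexillary_inversions_inv[OF signed_perm_w vexillary_inversions]]
    by blast
  show thesis
    using that[OF h(1) signed_perms_inv[OF h(2)]
        grassmannian_inv[OF signed_permI[OF h(2)] h(3)]] h(4)
    by (simp add: same_gen_fun_def signed_perm_inv_inv[OF signed_perm_w])
qed

theorem theorem1p4:
  fixes n :: nat and w :: "int \<Rightarrow> int"
  assumes "w \<in> signed_perms n"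
    and "vexillary n w"
  shows "\<exists>lam. strict_partition lam \<and> GC n w = GQ lam"
proof -
  obtain m u where u: "n \<le> m" "u \<in> signed_perms m" "grassmannian u"
    "\<And>N. gen_fun m N w = gen_fun m N u"
    using reduce_to_grassmannian[OF assms] by metis
  note fin = finite_neg_positions[OF u(2)]
  obtain lam where lam: "strict_partition lam" "shifted_diagram lam = shifted_shape (neg_positions u)"
    using exists_strict_partition[OF fin zero_notin_neg_positions] by blast
  have "GC n w mon = GQ lam mon" for mon
  proof -
    obtain N where N: "\<forall>i\<in>Poly_Mapping.keys mon. i \<le> N"
      using finite_nat_set_iff_bounded_le finite_keys by blast
    have "GC n w mon = Poly_Mapping.lookup (gen_fun n N w) mon"
      by (rule GC_eq_lookup_gen_fun[OF assms(1) N])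
    also have "gen_fun n N w = gen_fun m N u" using gen_fun_stable[OF u(1) assms(1)] u(4) by simp
    also have "\<dots> = tab_sum (shifted_diagram lam) (2 * int N) UNIV"
      using gen_fun_grassmannian u(2,3) unfolding on_grassmannians_def lam(2) by blast
    also have "Poly_Mapping.lookup \<dots> mon = GQ lam mon"
      using lookup_tab_sum[OF N, of lam] finite_shifted_shape[OF fin] by (simp only: lam(2))
    finally show ?thesis .
  qed
  then show ?thesis using lam(1) by blast
qed

end
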